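(* Let $G$ be a locally compact group, and let $\mu$ be the smallest cardinality of a neighborhood basis about $e\in G$. If $\mu>\aleph_0$, then $P_1(\widehat G)$ contains an orthogonal TI-net of cardinality $\mu$.
   Context: All groups are Hausdorff. Let $\lambda$ be the left regular representation of $G$ on $L_2(G)$, and $VN(G)=\lambda[G]''$. The Fourier algebra $A(G)$ is the predual of $VN(G)$; it consists of the functions $u_{f,g}(x)=\langle\lambda(x)f,g\rangle$ on $G$, $f,g\in L_2(G)$, with duality $\langle T,u_{f,g}\rangle=\langle Tf,g\rangle$ for $T\in VN(G)$, norm $\|u\|=\sup_{\|T\|=1}|\langle T,u\rangle|$, and pointwise multiplication. $P_1(\widehat G)=\{u\in A(G):\|u\|=u(e)=1\}$ is the set of normal states on $VN(G)$. The support $S(u)$ of a normal state $u$ is the infimum of all (orthogonal) projections $P\in VN(G)$ with $\langle P,u\rangle=1$. Normal states $u,v$ are orthogonal if $S(u)S(v)=0$; a net $\{u_\gamma\}_{\gamma\in\Gamma}$ of normal states is orthogonal if $S(u_\gamma)S(u_\beta)=0$ whenever $\gamma\neq\beta$. A net $\{u_\gamma\}\subset P_1(\widehat G)$ is a TI-net if $\lim_\gamma\|vu_\gamma-u_\gamma\|=0$ for all $v\in P_1(\widehat G)$. The cardinality of a net is the cardinality of its index set. (The symbol $\widehat G$ is only notation; $G$ need not be abelian.) *)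

theory Defs
  imports "HOL-Analysis.Analysis"
begin

unbundle cardinal_syntax

text \<open>
  Groups are written additively, following the library class
  \<^class>\<open>topological_group_add\<close>, which does not assume commutativity: the product
  \<open>x y\<close> is \<open>x + y\<close>, the inverse of \<open>x\<close> is \<open>- x\<close> and the identity \<open>e\<close> is \<open>0\<close>.
\<close>

text \<open>
  Regularity is part of the definition because Borel measures on groups that are not second
  countable need not be regular.
\<close>

definition left_haar_measure :: "'a::{topological_group_add, t2_space} measure \<Rightarrow> bool" where
  "left_haar_measure M \<longleftrightarrow>
     sets M = sets borel \<and>
     emeasure M UNIV \<noteq> 0 \<and>
     (\<forall>K. compact K \<longrightarrow> emeasure M K < \<infinity>) \<and>
     (\<forall>A\<in>sets borel. emeasure M A = (INF U\<in>{U. open U \<and> A \<subseteq> U}. emeasure M U)) \<and>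
     (\<forall>U. open U \<longrightarrow> emeasure M U = (SUP K\<in>{K. compact K \<and> K \<subseteq> U}. emeasure M K)) \<and>
     (\<forall>x. \<forall>A\<in>sets borel. emeasure M ((\<lambda>y. x + y) ` A) = emeasure M A)"


section \<open>The Hilbert space \<open>L\<^sub>2\<close> and its bounded operators\<close>

text \<open>
  Elements of \<open>L\<^sub>2\<close> are represented by functions, and equality in \<open>L\<^sub>2\<close> is equality almost
  everywhere.  Accordingly operators act on representatives, their algebraic laws hold almost
  everywhere, and two operators are equal if \<open>l2_op_eq\<close> relates them.
\<close>

definition l2 :: "'a measure \<Rightarrow> ('a \<Rightarrow> complex) set" where
  "l2 M = {f \<in> borel_measurable M. integrable M (\<lambda>x. (cmod (f x))\<^sup>2)}"

definition l2_eq :: "'a measure \<Rightarrow> ('a \<Rightarrow> complex) \<Rightarrow> ('a \<Rightarrow> complex) \<Rightarrow> bool" where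
  "l2_eq M f g \<longleftrightarrow> (AE x in M. f x = g x)"

definition l2_inner :: "'a measure \<Rightarrow> ('a \<Rightarrow> complex) \<Rightarrow> ('a \<Rightarrow> complex) \<Rightarrow> complex" where
  "l2_inner M f g = (LINT x|M. f x * cnj (g x))"

definition l2_norm :: "'a measure \<Rightarrow> ('a \<Rightarrow> complex) \<Rightarrow> real" where
  "l2_norm M f = sqrt (LINT x|M. (cmod (f x))\<^sup>2)"

type_synonym 'a l2_op = "('a \<Rightarrow> complex) \<Rightarrow> ('a \<Rightarrow> complex)"

text \<open>Boundedness and linearity force an operator to respect equality almost everywhere.\<close>

definition bounded_ops :: "'a measure \<Rightarrow> 'a l2_op set" where
  "bounded_ops M = {T.
     (\<forall>f\<in>l2 M. T f \<in> l2 M) \<and>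
     (\<forall>f\<in>l2 M. \<forall>g\<in>l2 M. l2_eq M (T (\<lambda>x. f x + g x)) (\<lambda>x. T f x + T g x)) \<and>
     (\<forall>f\<in>l2 M. \<forall>c. l2_eq M (T (\<lambda>x. c * f x)) (\<lambda>x. c * T f x)) \<and>
     (\<exists>C. \<forall>f\<in>l2 M. l2_norm M (T f) \<le> C * l2_norm M f)}"

definition l2_op_eq :: "'a measure \<Rightarrow> 'a l2_op \<Rightarrow> 'a l2_op \<Rightarrow> bool" where
  "l2_op_eq M S T \<longleftrightarrow> (\<forall>f\<in>l2 M. l2_eq M (S f) (T f))"

definition op_norm :: "'a measure \<Rightarrow> 'a l2_op \<Rightarrow> real" where
  "op_norm M T = (SUP f\<in>{f \<in> l2 M. l2_norm M f \<le> 1}. l2_norm M (T f))"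

definition commutant :: "'a measure \<Rightarrow> 'a l2_op set \<Rightarrow> 'a l2_op set" where
  "commutant M A = {T \<in> bounded_ops M. \<forall>S\<in>A. l2_op_eq M (T \<circ> S) (S \<circ> T)}"

definition is_projection :: "'a measure \<Rightarrow> 'a l2_op \<Rightarrow> bool" where
  "is_projection M P \<longleftrightarrow> P \<in> bounded_ops M \<and> l2_op_eq M (P \<circ> P) P \<and>
     (\<forall>f\<in>l2 M. \<forall>g\<in>l2 M. l2_inner M (P f) g = l2_inner M f (P g))"

definition projection_le :: "'a measure \<Rightarrow> 'a l2_op \<Rightarrow> 'a l2_op \<Rightarrow> bool" where
  "projection_le M P Q \<longleftrightarrow> l2_op_eq M (Q \<circ> P) P"


section \<open>The group von Neumann algebra and the Fourier algebra\<close>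

definition left_regular :: "'a::group_add \<Rightarrow> 'a l2_op" where
  "left_regular x f = (\<lambda>y. f (- x + y))"

definition VN :: "'a::{topological_group_add, t2_space} measure \<Rightarrow> 'a l2_op set" where
  "VN M = commutant M (commutant M (range left_regular))"

definition coefficient ::
  "'a::{topological_group_add, t2_space} measure \<Rightarrow> ('a \<Rightarrow> complex) \<Rightarrow> ('a \<Rightarrow> complex) \<Rightarrow> 'a \<Rightarrow> complex" where
  "coefficient M f g x = l2_inner M (left_regular x f) g"

definition fourier_algebra :: "'a::{topological_group_add, t2_space} measure \<Rightarrow> ('a \<Rightarrow> complex) set" where
  "fourier_algebra M = {coefficient M f g | f g. f \<in> l2 M \<and> g \<in> l2 M}"

text \<open>
  For \<open>T \<in> VN M\<close> the value \<open>\<langle>T f, g\<rangle>\<close> depends only on the function \<open>coefficient M f g\<close>,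
  so that the description below determines a unique number.
\<close>

definition pairing ::
  "'a::{topological_group_add, t2_space} measure \<Rightarrow> 'a l2_op \<Rightarrow> ('a \<Rightarrow> complex) \<Rightarrow> complex" where
  "pairing M T u =
     (THE c. \<exists>f\<in>l2 M. \<exists>g\<in>l2 M. u = coefficient M f g \<and> c = l2_inner M (T f) g)"

definition fourier_norm :: "'a::{topological_group_add, t2_space} measure \<Rightarrow> ('a \<Rightarrow> complex) \<Rightarrow> real" where
  "fourier_norm M u = (SUP T\<in>{T \<in> VN M. op_norm M T = 1}. cmod (pairing M T u))"

definition normal_states :: "'a::{topological_group_add, t2_space} measure \<Rightarrow> ('a \<Rightarrow> complex) set" where
  "normal_states M = {u \<in> fourier_algebra M. fourier_norm M u = 1 \<and> u 0 = 1}"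

text \<open>
  The infimum is taken in the lattice of projections of \<open>VN M\<close>.  It is unique up to
  \<open>l2_op_eq\<close>, hence the indefinite choice in \<open>support_proj\<close>.
\<close>

definition is_support_proj ::
  "'a::{topological_group_add, t2_space} measure \<Rightarrow> ('a \<Rightarrow> complex) \<Rightarrow> 'a l2_op \<Rightarrow> bool" where
  "is_support_proj M u S \<longleftrightarrow>
     S \<in> VN M \<and> is_projection M S \<and>
     (\<forall>P\<in>VN M. is_projection M P \<and> pairing M P u = 1 \<longrightarrow> projection_le M S P) \<and>
     (\<forall>Q\<in>VN M. is_projection M Q \<and>
        (\<forall>P\<in>VN M. is_projection M P \<and> pairing M P u = 1 \<longrightarrow> projection_le M Q P) \<longrightarrow>
        projection_le M Q S)"

definition support_proj ::
  "'a::{topological_group_add, t2_space} measure \<Rightarrow> ('a \<Rightarrow> complex) \<Rightarrow> 'a l2_op" where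
  "support_proj M u = (SOME S. is_support_proj M u S)"

definition orthogonal_states ::
  "'a::{topological_group_add, t2_space} measure \<Rightarrow> ('a \<Rightarrow> complex) \<Rightarrow> ('a \<Rightarrow> complex) \<Rightarrow> bool" where
  "orthogonal_states M u v \<longleftrightarrow>
     l2_op_eq M (support_proj M u \<circ> support_proj M v) (\<lambda>f x. 0)"


section \<open>Nets of normal states\<close>

definition directed_set :: "'i set \<Rightarrow> ('i \<Rightarrow> 'i \<Rightarrow> bool) \<Rightarrow> bool" where
  "directed_set I le \<longleftrightarrow> I \<noteq> {} \<and> reflp_on I le \<and> transp_on I le \<and>
     (\<forall>i\<in>I. \<forall>j\<in>I. \<exists>k\<in>I. le i k \<and> le j k)"

definition net_filter :: "'i set \<Rightarrow> ('i \<Rightarrow> 'i \<Rightarrow> bool) \<Rightarrow> 'i filter" where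
  "net_filter I le = (INF i\<in>I. principal {j \<in> I. le i j})"

definition TI_net ::
  "'a::{topological_group_add, t2_space} measure \<Rightarrow> 'i set \<Rightarrow> ('i \<Rightarrow> 'i \<Rightarrow> bool) \<Rightarrow>
     ('i \<Rightarrow> 'a \<Rightarrow> complex) \<Rightarrow> bool" where
  "TI_net M I le u \<longleftrightarrow> directed_set I le \<and> (\<forall>i\<in>I. u i \<in> normal_states M) \<and>
     (\<forall>v\<in>normal_states M.
        ((\<lambda>i. fourier_norm M (\<lambda>x. v x * u i x - u i x)) \<longlongrightarrow> 0) (net_filter I le))"

definition orthogonal_net ::
  "'a::{topological_group_add, t2_space} measure \<Rightarrow> 'i set \<Rightarrow> ('i \<Rightarrow> 'a \<Rightarrow> complex) \<Rightarrow> bool" where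
  "orthogonal_net M I u \<longleftrightarrow> (\<forall>i\<in>I. \<forall>j\<in>I. i \<noteq> j \<longrightarrow> orthogonal_states M (u i) (u j))"


section \<open>The local weight at a point\<close>

definition nhds_basis :: "'a::topological_space \<Rightarrow> 'a set set \<Rightarrow> bool" where
  "nhds_basis x \<B> \<longleftrightarrow> (\<forall>U\<in>\<B>. \<forall>\<^sub>F y in nhds x. y \<in> U) \<and>
     (\<forall>V. (\<forall>\<^sub>F y in nhds x. y \<in> V) \<longrightarrow> (\<exists>U\<in>\<B>. U \<subseteq> V))"

definition min_nhds_basis_card :: "'a::topological_space \<Rightarrow> 'c rel \<Rightarrow> bool" where
  "min_nhds_basis_card x \<mu> \<longleftrightarrow> Card_order \<mu> \<and>
     (\<exists>\<B>. nhds_basis x \<B> \<and> |\<B>| =o \<mu>) \<and> (\<forall>\<B>. nhds_basis x \<B> \<longrightarrow> \<mu> \<le>o |\<B>| )"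

end

theory Submission
  imports Defs "HOL-Library.Function_Algebras"
begin

text \<open>
  Index the net by a neighbourhood basis of \<open>0\<close> of cardinality \<open>\<mu>\<close>, ordered by reverse
  inclusion, and take vector states \<open>u x = \<langle>\<lambda>(x) h, h\<rangle>\<close> of unit vectors \<open>h\<close> supported in the
  index set.

  Orthogonality: run through the basis along a well-order of type \<open>\<mu>\<close>.  The stabilisers of
  the fewer than \<open>\<mu>\<close> vectors chosen so far are \<open>G\<^sub>\<delta>\<close> subgroups by strong continuity of
  \<open>\<lambda>\<close>, so as \<open>\<mu>\<close> is uncountable they have a common element \<open>x \<noteq> 0\<close> near \<open>0\<close>;
  otherwise \<open>{0}\<close> would be an intersection of fewer than \<open>\<mu>\<close> neighbourhoods.  The next vector
  is \<open>p - \<lambda>(x) p\<close>.  It is orthogonal to all vectors fixed by \<open>\<lambda>(x)\<close>, and this persists after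
  applying operators of the commutant, so the support projections are orthogonal.

  Invariance: for a state \<open>v x = \<langle>\<lambda>(x) f, g\<rangle>\<close> the functional \<open>v u - u\<close> is dominated by a small
  positive definite function with compact support, because \<open>\<lambda>(t) f \<approx> f\<close> and
  \<open>\<lambda>(t) g \<approx> g\<close> on the support of \<open>h\<close>.  By Godement's theorem this function is
  \<open>\<langle>\<lambda>(x) c, c\<rangle>\<close> for some \<open>c \<in> L\<^sub>2\<close>, and Riesz' theorem yields
  \<open>v u - u = \<langle>\<lambda>(x) c, b\<rangle>\<close> with \<open>\<parallel>c\<parallel> \<parallel>b\<parallel>\<close> small.
\<close>

section \<open>Semi-inner product spaces\<close>

text \<open>Vectors of L2 are functions, and \<open>pairing\<close> picks out a number only for a
  function exhibited as one coefficient <\<lambda>(x) c, b>. Two consequences govern the proof. All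
  Hilbert space theory is set up for semi-inner products on a subset H of a vector space, with
  equality replaced by a null difference. And v u - u has no usable norm until one pair c, b is
  found for it: domination by a positive definite function bounds finite sums only, and represents v
  u - u a priori on the abstract Hilbert space of that function. Compact support of h lets
  Godement's theorem realise this space inside L2, where the estimate can be read off from two
  norms. The positive definite function arises by averaging over the support of h: at each t the
  factor v - 1 is split into a part measured by \<lambda>(- t + x) f - f and a part measured by
  \<lambda>(- t) g - g. The well-order that yields orthogonality and the reverse inclusion that
  directs the net are unrelated. They do not interfere, because each vector is confined to its own
  index set whatever its place in the well-order.\<close>

locale semi_inner = vector_space scale
  for scale :: "complex \<Rightarrow> 'v::ab_group_add \<Rightarrow> 'v" (infixr "\<odot>" 75) +
  fixes H :: "'v set" and ip :: "'v \<Rightarrow> 'v \<Rightarrow> complex"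
  assumes H: "subspace H"
    and ip_add: "\<lbrakk>x \<in> H; y \<in> H; z \<in> H\<rbrakk> \<Longrightarrow> ip (x + y) z = ip x z + ip y z"
    and ip_scale: "\<lbrakk>x \<in> H; y \<in> H\<rbrakk> \<Longrightarrow> ip (c \<odot> x) y = c * ip x y"
    and ip_cnj: "\<lbrakk>x \<in> H; y \<in> H\<rbrakk> \<Longrightarrow> ip y x = cnj (ip x y)"
    and ip_nonneg: "x \<in> H \<Longrightarrow> 0 \<le> Re (ip x x)"
begin

definition nrm :: "'v \<Rightarrow> real" where "nrm x = sqrt (Re (ip x x))"

lemma H_closed [simp]:
  "0 \<in> H" "x \<in> H \<Longrightarrow> y \<in> H \<Longrightarrow> x + y \<in> H" "x \<in> H \<Longrightarrow> y \<in> H \<Longrightarrow> x - y \<in> H"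
  "x \<in> H \<Longrightarrow> c \<odot> x \<in> H" "x \<in> H \<Longrightarrow> - x \<in> H"
  using H by (auto intro: subspace_0 subspace_add subspace_diff subspace_scale subspace_neg)

lemma H_sum: "(\<And>i. i \<in> A \<Longrightarrow> f i \<in> H) \<Longrightarrow> sum f A \<in> H"
  using H by (rule subspace_sum)

lemma ip_add_right: "\<lbrakk>x \<in> H; y \<in> H; z \<in> H\<rbrakk> \<Longrightarrow> ip z (x + y) = ip z x + ip z y"
  using ip_cnj[of "x + y" z] ip_cnj[of x z] ip_cnj[of y z] ip_add[of x y z] by simp

lemma ip_scale_right: "\<lbrakk>x \<in> H; y \<in> H\<rbrakk> \<Longrightarrow> ip x (c \<odot> y) = cnj c * ip x y"
  using ip_cnj[of "c \<odot> y" x] ip_cnj[of y x] ip_scale[of y x c] by simp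

lemma ip_minus: "\<lbrakk>x \<in> H; y \<in> H\<rbrakk> \<Longrightarrow> ip (- x) y = - ip x y"
  using ip_scale[of x y "-1"] by simp

lemma ip_minus_right: "\<lbrakk>x \<in> H; y \<in> H\<rbrakk> \<Longrightarrow> ip x (- y) = - ip x y"
  using ip_scale_right[of x y "-1"] by simp

lemma ip_diff: "\<lbrakk>x \<in> H; y \<in> H; z \<in> H\<rbrakk> \<Longrightarrow> ip (x - y) z = ip x z - ip y z"
  using ip_add[of x "- y" z] ip_minus[of y z] by simp

lemma ip_diff_right: "\<lbrakk>x \<in> H; y \<in> H; z \<in> H\<rbrakk> \<Longrightarrow> ip z (x - y) = ip z x - ip z y"
  using ip_add_right[of x "- y" z] ip_minus_right[of z y] by simp

lemma ip_zero: "x \<in> H \<Longrightarrow> ip 0 x = 0" "x \<in> H \<Longrightarrow> ip x 0 = 0"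
  using ip_scale[of x x 0] ip_scale_right[of x x 0] by simp_all

lemmas ip_simps = ip_add ip_scale ip_add_right ip_scale_right ip_minus ip_minus_right
  ip_diff ip_diff_right ip_zero

lemma ip_sum: "\<lbrakk>\<And>i. i \<in> A \<Longrightarrow> f i \<in> H; y \<in> H\<rbrakk> \<Longrightarrow> ip (sum f A) y = (\<Sum>i\<in>A. ip (f i) y)"
  by (induction A rule: infinite_finite_induct) (auto simp: ip_zero ip_add H_sum)

lemma ip_sum_right: "\<lbrakk>\<And>i. i \<in> A \<Longrightarrow> f i \<in> H; y \<in> H\<rbrakk> \<Longrightarrow> ip y (sum f A) = (\<Sum>i\<in>A. ip y (f i))"
  by (induction A rule: infinite_finite_induct) (auto simp: ip_zero ip_add_right H_sum)

lemma ip_lincomb: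
  assumes "\<And>i. x i \<in> H"
  shows "ip (\<Sum>i<n. z i \<odot> x i) (\<Sum>i<n. z i \<odot> x i)
    = (\<Sum>i<n. \<Sum>j<n. z i * cnj (z j) * ip (x i) (x j))"
  using assms
  by (simp add: ip_sum ip_sum_right H_sum ip_simps sum_distrib_left mult.assoc mult.left_commute)
    (rule sum.swap)

lemma nrm_nonneg [simp]: "x \<in> H \<Longrightarrow> 0 \<le> nrm x"
  by (simp add: nrm_def ip_nonneg)

lemma nrm_sq: "x \<in> H \<Longrightarrow> (nrm x)\<^sup>2 = Re (ip x x)"
  by (simp add: nrm_def ip_nonneg)

lemma ip_self: "x \<in> H \<Longrightarrow> ip x x = of_real ((nrm x)\<^sup>2)"
  using ip_cnj[of x x] by (auto simp: nrm_sq complex_eq_iff)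

lemma nrm_scale: "x \<in> H \<Longrightarrow> nrm (c \<odot> x) = cmod c * nrm x"
proof -
  assume x: "x \<in> H"
  have "ip (c \<odot> x) (c \<odot> x) = (c * cnj c) * ip x x" using x by (simp add: ip_simps)
  then have "Re (ip (c \<odot> x) (c \<odot> x)) = (cmod c)\<^sup>2 * Re (ip x x)"
    by (simp add: complex_norm_square[symmetric])
  then show ?thesis by (simp add: nrm_def real_sqrt_mult)
qed

lemma nrm_minus: "x \<in> H \<Longrightarrow> nrm (- x) = nrm x"
  using nrm_scale[of x "-1"] by simp

lemma nrm_minus_commute: "x \<in> H \<Longrightarrow> y \<in> H \<Longrightarrow> nrm (x - y) = nrm (y - x)"
  using nrm_minus[of "x - y"] by simp

lemma nrm_add_sq: "x \<in> H \<Longrightarrow> y \<in> H \<Longrightarrow> (nrm (x + y))\<^sup>2 = (nrm x)\<^sup>2 + 2 * Re (ip x y) + (nrm y)\<^sup>2"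
  using ip_cnj[of x y] by (simp add: nrm_sq ip_simps)

lemma nrm_diff_sq: "x \<in> H \<Longrightarrow> y \<in> H \<Longrightarrow> (nrm (x - y))\<^sup>2 = (nrm x)\<^sup>2 - 2 * Re (ip x y) + (nrm y)\<^sup>2"
  using ip_cnj[of x y] by (simp add: nrm_sq ip_simps)

text \<open>Nonnegativity of |x - t a y|^2 for real t, with a = <x, y>. A null vector y need not be
  0, so \<open>nrm y = 0\<close> is a genuine case: there the expression is affine in t and must be
  constant. Otherwise t = 1 / |y|^2 is optimal.\<close>

lemma cauchy_schwarz: assumes x: "x \<in> H" and y: "y \<in> H" shows "cmod (ip x y) \<le> nrm x * nrm y"
proof -
  let ?a = "ip x y"
  define b where "b = (cmod ?a)\<^sup>2"
  have aa: "?a * cnj ?a = of_real b" unfolding b_def by (simp add: complex_norm_square[symmetric])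
  have key: "0 \<le> (nrm x)\<^sup>2 - 2 * t * b + t\<^sup>2 * b * (nrm y)\<^sup>2" for t :: real
  proof -
    have "0 \<le> (nrm (x - (of_real t * ?a) \<odot> y))\<^sup>2" by simp
    also have "\<dots> = (nrm x)\<^sup>2 - 2 * Re (of_real t * (?a * cnj ?a)) + (cmod (of_real t * ?a) * nrm y)\<^sup>2"
      using x y by (subst nrm_diff_sq) (simp_all add: nrm_scale ip_scale_right mult_ac)
    also have "\<dots> = (nrm x)\<^sup>2 - 2 * t * b + t\<^sup>2 * b * (nrm y)\<^sup>2"
      unfolding aa by (simp add: norm_mult power_mult_distrib b_def)
    finally show ?thesis .
  qed
  have "b \<le> (nrm x)\<^sup>2 * (nrm y)\<^sup>2"
  proof (cases "nrm y = 0")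
    case True
    have "b \<le> 0"
    proof (rule ccontr)
      assume "\<not> b \<le> 0"
      \<comment> \<open>This t lies beyond the zero of |x|^2 - 2 t b.\<close>
      then have "0 \<le> (nrm x)\<^sup>2 - 2 * ((nrm x)\<^sup>2 / b + 1) * b" "b > 0"
        using key[of "(nrm x)\<^sup>2 / b + 1"] True by auto
      moreover have "((nrm x)\<^sup>2 / b + 1) * b = (nrm x)\<^sup>2 + b" using \<open>b > 0\<close> by (simp add: field_simps)
      ultimately have "0 \<le> - (nrm x)\<^sup>2 - 2 * b" by (simp add: algebra_simps)
      then show False using \<open>b > 0\<close> zero_le_power2[of "nrm x"] by linarith
    qed
    then show ?thesis using True by simp
  next
    case False
    then have pos: "(nrm y)\<^sup>2 > 0" by simp
    have "2 * (1 / w) * b - (1 / w)\<^sup>2 * b * w = b / w" if "w > 0" for w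
      using that by (simp add: field_simps power2_eq_square)
    from this[OF pos]
    have "b / (nrm y)\<^sup>2 \<le> (nrm x)\<^sup>2" using key[of "1 / (nrm y)\<^sup>2"] by linarith
    then show ?thesis using pos by (simp add: pos_divide_le_eq)
  qed
  then have "(cmod ?a)\<^sup>2 \<le> (nrm x * nrm y)\<^sup>2" by (simp add: b_def power_mult_distrib)
  then show ?thesis using x y by (simp add: power2_le_iff_abs_le)
qed

lemma nrm_triangle: assumes "x \<in> H" "y \<in> H" shows "nrm (x + y) \<le> nrm x + nrm y"
proof -
  have "Re (ip x y) \<le> nrm x * nrm y"
    using cauchy_schwarz[OF assms] complex_Re_le_cmod[of "ip x y"] by linarith
  then have "(nrm (x + y))\<^sup>2 \<le> (nrm x + nrm y)\<^sup>2"
    using assms by (simp add: nrm_add_sq power2_sum)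
  then show ?thesis using assms by (simp add: power2_le_iff_abs_le)
qed

lemma nrm_triangle_diff:
  assumes "x \<in> H" "y \<in> H" "z \<in> H" shows "nrm (x - z) \<le> nrm (x - y) + nrm (y - z)"
  using nrm_triangle[of "x - y" "y - z"] assms by simp

lemma nrm_zero [simp]: "nrm 0 = 0"
  by (simp add: nrm_def ip_zero)

lemma nrm_sum: "(\<And>i. i \<in> A \<Longrightarrow> f i \<in> H) \<Longrightarrow> nrm (sum f A) \<le> (\<Sum>i\<in>A. nrm (f i))"
proof (induction A rule: infinite_finite_induct)
  case (insert x F)
  then show ?case using nrm_triangle[of "f x" "sum f F"] by (force simp: H_sum)
qed auto

lemma ip_tendsto:
  assumes "\<And>n. X n \<in> H" "\<And>n. Y n \<in> H" "x \<in> H" "y \<in> H"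
    and X: "(\<lambda>n. nrm (X n - x)) \<longlonglongrightarrow> 0" and Y: "(\<lambda>n. nrm (Y n - y)) \<longlonglongrightarrow> 0"
  shows "(\<lambda>n. ip (X n) (Y n)) \<longlonglongrightarrow> ip x y"
proof -
  have "ip (X n) (Y n) - ip x y = ip (X n - x) (Y n - y) + ip (X n - x) y + ip x (Y n - y)" for n
    using assms by (simp add: ip_simps)
  then have b: "cmod (ip (X n) (Y n) - ip x y) \<le>
      nrm (X n - x) * nrm (Y n - y) + nrm (X n - x) * nrm y + nrm x * nrm (Y n - y)" for n
    using cauchy_schwarz[of "X n - x" "Y n - y"] cauchy_schwarz[of "X n - x" y]
      cauchy_schwarz[of x "Y n - y"] assms
    by (smt (verit, best) H_closed norm_triangle_ineq)
  have "(\<lambda>n. nrm (X n - x) * nrm (Y n - y) + nrm (X n - x) * nrm y + nrm x * nrm (Y n - y))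
      \<longlonglongrightarrow> 0 * 0 + 0 * nrm y + nrm x * 0"
    by (intro tendsto_intros X Y)
  then have "(\<lambda>n. ip (X n) (Y n) - ip x y) \<longlonglongrightarrow> 0"
    by (intro Lim_null_comparison[OF always_eventually[OF allI[OF b]]]) simp
  then show ?thesis by (simp add: LIM_zero_iff)
qed

lemma ip_eq_of_nrm_zero:
  assumes "x \<in> H" "x' \<in> H" "y \<in> H" "y' \<in> H" "nrm (x - x') = 0" "nrm (y - y') = 0"
  shows "ip x y = ip x' y'"
proof -
  have "(\<lambda>n::nat. ip x y) \<longlonglongrightarrow> ip x' y'" by (rule ip_tendsto) (use assms in auto)
  then show ?thesis by (simp add: LIMSEQ_const_iff)
qed

end

locale semi_hilbert = semi_inner scale H ip
  for scale :: "complex \<Rightarrow> 'v::ab_group_add \<Rightarrow> 'v" (infixr "\<odot>" 75)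
    and H :: "'v set" and ip :: "'v \<Rightarrow> 'v \<Rightarrow> complex" +
  assumes complete: "\<lbrakk>\<And>n. X n \<in> H; \<And>e. e > 0 \<Longrightarrow> \<exists>N. \<forall>m\<ge>N. \<forall>n\<ge>N. nrm (X m - X n) < e\<rbrakk>
    \<Longrightarrow> \<exists>L\<in>H. (\<lambda>n::nat. nrm (X n - L)) \<longlonglongrightarrow> 0"
begin

text \<open>The functional is given by its graph \<open>D\<close>.  Minimise \<open>\<parallel>d\<parallel>\<^sup>2 - 2 Re r\<close> over \<open>(d, r) \<in> D\<close>: a
  minimising sequence is Cauchy by the parallelogram law and its limit represents the functional.\<close>

lemma riesz:
  assumes DH: "\<And>d r. (d, r) \<in> D \<Longrightarrow> d \<in> H"
    and D0: "(0, 0) \<in> D"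
    and Dadd: "\<And>d r d' r'. (d, r) \<in> D \<Longrightarrow> (d', r') \<in> D \<Longrightarrow> (d + d', r + r') \<in> D"
    and Dscale: "\<And>d r c. (d, r) \<in> D \<Longrightarrow> (c \<odot> d, c * r) \<in> D"
    and bound: "\<And>d r. (d, r) \<in> D \<Longrightarrow> cmod r \<le> C * nrm d"
  obtains b where "b \<in> H" "\<And>d r. (d, r) \<in> D \<Longrightarrow> r = ip d b"
    "\<And>e. e > 0 \<Longrightarrow> \<exists>(d, r)\<in>D. nrm (b - d) < e"
proof -
  define J where "J p = (nrm (fst p))\<^sup>2 - 2 * Re (snd p)" for p :: "'v \<times> complex"
  have J_ge: "- (C\<^sup>2) \<le> J p" if "p \<in> D" for p
  proof -
    have "cmod (snd p) \<le> C * nrm (fst p)" using bound[of "fst p" "snd p"] that by simp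
    then have "Re (snd p) \<le> C * nrm (fst p)" using complex_Re_le_cmod[of "snd p"] by linarith
    moreover have "0 \<le> (nrm (fst p) - C)\<^sup>2" by simp
    ultimately show ?thesis unfolding J_def by (simp add: power2_diff algebra_simps)
  qed
  define m where "m = (INF p\<in>D. J p)"
  have bdd: "bdd_below (J ` D)" using J_ge by (auto intro!: bdd_belowI[of _ "- (C\<^sup>2)"])
  have m_le: "m \<le> J p" if "p \<in> D" for p unfolding m_def by (rule cINF_lower[OF bdd that])
  have "\<exists>p\<in>D. J p < m + 1 / (real n + 1)" for n
  proof -
    have "m < m + 1 / (real n + 1)" by simp
    then show ?thesis unfolding m_def using cINF_less_iff[OF _ bdd] D0 by blast
  qed
  then obtain p where p: "\<And>n. p n \<in> D" "\<And>n. J (p n) < m + 1 / (real n + 1)" by metis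
  define X where "X n = fst (p n)" for n
  define r where "r n = snd (p n)" for n
  have Xr: "(X n, r n) \<in> D" for n using p(1)[of n] by (simp add: X_def r_def)
  have XH: "X n \<in> H" for n using DH[OF Xr] .
  have JX: "(nrm (X n))\<^sup>2 - 2 * Re (r n) < m + 1 / (real n + 1)" for n
    using p(2)[of n] by (simp add: J_def X_def r_def)
  have linear_inequality: "A \<le> 2 * u + 2 * v"
    if "m \<le> S / 4 - y - z" "A + S = 2 * a + 2 * b" "a - 2 * y < m + u" "b - 2 * z < m + v"
    for A S a b m y z u v :: real using that by argo
  have cau: "(nrm (X n - X k))\<^sup>2 \<le> 2 / (real n + 1) + 2 / (real k + 1)" for n k
  proof -
    have "((1/2) \<odot> (X n + X k), (1/2) * (r n + r k)) \<in> D" by (intro Dscale Dadd Xr)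
    from m_le[OF this] have "m \<le> (nrm (X n + X k))\<^sup>2 / 4 - Re (r n) - Re (r k)"
      using XH by (simp add: J_def nrm_scale power_divide add_divide_distrib)
    moreover have "(nrm (X n - X k))\<^sup>2 + (nrm (X n + X k))\<^sup>2 = 2 * (nrm (X n))\<^sup>2 + 2 * (nrm (X k))\<^sup>2"
      using XH by (simp add: nrm_diff_sq nrm_add_sq)
    ultimately show ?thesis
      using JX[of n] JX[of k] linear_inequality[of "(nrm (X n - X k))\<^sup>2" "(nrm (X n + X k))\<^sup>2"
        "(nrm (X n))\<^sup>2" "(nrm (X k))\<^sup>2" m "Re (r n)" "Re (r k)" "1 / (real n + 1)" "1 / (real k + 1)"]
      by simp
  qed
  have "\<exists>N. \<forall>m\<ge>N. \<forall>n\<ge>N. nrm (X m - X n) < e" if "e > 0" for e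
  proof -
    obtain N :: nat where N: "4 / e\<^sup>2 < real N" using reals_Archimedean2 by blast
    have "nrm (X i - X j) < e" if "i \<ge> N" "j \<ge> N" for i j
    proof -
      have le: "2 / (real i + 1) \<le> 2 / (real N + 1)" "2 / (real j + 1) \<le> 2 / (real N + 1)"
        using that by (auto intro!: divide_left_mono)
      have "4 / e\<^sup>2 < real N + 1" using N by simp
      then have "4 < (real N + 1) * e\<^sup>2" using \<open>e > 0\<close> by (simp add: field_simps)
      then have "4 / (real N + 1) < e\<^sup>2" by (subst pos_divide_less_eq) (simp_all add: mult.commute)
      then have "2 / (real N + 1) + 2 / (real N + 1) < e\<^sup>2" by (simp add: add_divide_distrib[symmetric])
      then have "(nrm (X i - X j))\<^sup>2 < e\<^sup>2" using cau[of i j] le by linarith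
      then show ?thesis using \<open>e > 0\<close> by (simp add: power2_less_imp_less)
    qed
    then show ?thesis by blast
  qed
  then obtain b where b: "b \<in> H" "(\<lambda>n. nrm (X n - b)) \<longlonglongrightarrow> 0" using complete[of X] XH by blast
  have Re_eq: "Re (ip d b) = Re s" if ds: "(d, s) \<in> D" for d s
  proof -
    have dH: "d \<in> H" using DH ds by blast
    \<comment> \<open>First variation of J: (X n + t d, r n + t s) competes with the infimum m, and
      J at (X n, r n) is within 1/(n+1) of m. The limit in n replaces X n by b.\<close>
    have step: "0 \<le> 2 * t * (Re (ip d b) - Re s) + t\<^sup>2 * (nrm d)\<^sup>2" for t :: real
    proof -
      have ge: "- 1 / (real n + 1) \<le> 2 * t * (Re (ip d (X n)) - Re s) + t\<^sup>2 * (nrm d)\<^sup>2" for n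
      proof -
        have "(X n + of_real t \<odot> d, r n + of_real t * s) \<in> D" by (intro Dadd Dscale Xr ds)
        from m_le[OF this] have "m \<le> (nrm (X n))\<^sup>2 + 2 * t * Re (ip d (X n)) + t\<^sup>2 * (nrm d)\<^sup>2
            - 2 * Re (r n) - 2 * t * Re s"
          using XH[of n] dH ip_cnj[of "X n" d]
          by (simp add: J_def nrm_add_sq nrm_scale ip_simps power_mult_distrib)
        then show ?thesis using JX[of n] by (simp add: algebra_simps)
      qed
      have "(\<lambda>n. ip d (X n)) \<longlonglongrightarrow> ip d b"
        by (rule ip_tendsto) (use b XH dH in auto)
      then have "(\<lambda>n. 2 * t * (Re (ip d (X n)) - Re s) + t\<^sup>2 * (nrm d)\<^sup>2) \<longlonglongrightarrow>
          2 * t * (Re (ip d b) - Re s) + t\<^sup>2 * (nrm d)\<^sup>2"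
        by (intro tendsto_intros)
      moreover have "(\<lambda>n. - 1 / (real n + 1)) \<longlonglongrightarrow> 0"
        using tendsto_minus[OF LIMSEQ_inverse_real_of_nat] by (simp add: inverse_eq_divide add.commute)
      ultimately show ?thesis using ge by (intro LIMSEQ_le[OF _ _ exI[of _ 0]]) auto
    qed
    define q where "q = Re (ip d b) - Re s"
    have "q = 0"
    proof (rule ccontr)
      assume "q \<noteq> 0"
      \<comment> \<open>Adding 1 covers a null d. At t = - q / w the quadratic is at most - q^2 /
        w.\<close>
      define w where "w = (nrm d)\<^sup>2 + 1"
      have w: "w > 0" by (simp add: w_def add_nonneg_pos)
      have "0 \<le> 2 * (- q / w) * q + (- q / w)\<^sup>2 * (nrm d)\<^sup>2" using step[of "- q / w"] q_def by simp
      also have "\<dots> \<le> 2 * (- q / w) * q + (- q / w)\<^sup>2 * w"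
        by (intro add_left_mono mult_left_mono) (auto simp: w_def)
      also have "\<dots> = - (q\<^sup>2 / w)" using w by (simp add: field_simps power2_eq_square)
      also have "\<dots> < 0" using w \<open>q \<noteq> 0\<close> by simp
      finally show False by simp
    qed
    then show ?thesis by (simp add: q_def)
  qed
  show ?thesis
  proof (rule that[OF b(1)])
    fix d s assume ds: "(d, s) \<in> D"
    have dH: "d \<in> H" using DH ds by blast
    \<comment> \<open>The real part of the identity at i d is, up to sign, its imaginary part at
      d.\<close>
    have "Re (ip (\<i> \<odot> d) b) = Re (\<i> * s)" by (rule Re_eq) (rule Dscale[OF ds])
    then have "Im (ip d b) = Im s" using dH b by (simp add: ip_simps)
    then show "s = ip d b" using Re_eq[OF ds] by (simp add: complex_eq_iff)
  next
    fix e :: real assume "e > 0"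
    then have "\<exists>n. nrm (X n - b) < e"
      using b(2) by (metis (no_types, lifting) LIMSEQ_iff abs_ge_self diff_zero le_less_trans order_refl real_norm_def)
    then show "\<exists>(d, r)\<in>D. nrm (b - d) < e" using Xr nrm_minus_commute[OF XH b(1)] by force
  qed
qed

text \<open>Riesz' theorem for \<open>d \<mapsto> ip d f\<close> on D. As D need not be closed, p is
  only a limit of elements of D, which is the third clause.\<close>

lemma projection_exists:
  assumes D: "subspace D" "D \<subseteq> H" and f: "f \<in> H"
  obtains p where "p \<in> H" "\<And>d. d \<in> D \<Longrightarrow> ip (f - p) d = 0" "\<And>e. e > 0 \<Longrightarrow> \<exists>d\<in>D. nrm (p - d) < e"
proof -
  have sub: "d \<in> H" if "d \<in> D" for d using D that by blast
  obtain b where b: "b \<in> H" "\<And>d r. (d, r) \<in> (\<lambda>d. (d, ip d f)) ` D \<Longrightarrow> r = ip d b"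
    "\<And>e. e > 0 \<Longrightarrow> \<exists>(d, r) \<in> (\<lambda>d. (d, ip d f)) ` D. nrm (b - d) < e"
  proof (rule riesz[of "(\<lambda>d. (d, ip d f)) ` D" "nrm f"])
    show "cmod r \<le> nrm f * nrm d" if "(d, r) \<in> (\<lambda>d. (d, ip d f)) ` D" for d r
      using that cauchy_schwarz[OF _ f] sub by (auto simp: mult.commute)
  qed (use sub f D(1) in \<open>auto simp: ip_simps intro!: image_eqI subspace_0 subspace_add subspace_scale\<close>)
  have "ip (f - b) d = 0" if "d \<in> D" for d
    using b(2)[of d "ip d f"] that sub[OF that] f b(1) ip_cnj[of d f] ip_cnj[of d b] by (simp add: ip_simps)
  then show ?thesis using b(1,3) by (intro that[of b]) auto
qed

end

subsection \<open>The binomial series for the square root of an operator\<close>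

text \<open>The coefficients of the power series of sqrt (1 - t).\<close>

definition sqrt_coeff :: "nat \<Rightarrow> real" where
  "sqrt_coeff n = (-1) ^ n * ((1/2) gchoose n)"

lemma sqrt_coeff_conv: "(\<Sum>i\<le>k. sqrt_coeff i * sqrt_coeff (k - i)) = (-1) ^ k * (1 gchoose k)"
proof -
  have "(\<Sum>i\<le>k. sqrt_coeff i * sqrt_coeff (k - i))
      = (\<Sum>i\<le>k. (-1) ^ k * (((1/2) gchoose i) * ((1/2) gchoose (k - i))))"
    by (intro sum.cong) (auto simp: sqrt_coeff_def power_add[symmetric])
  also have "\<dots> = (-1) ^ k * (\<Sum>i=0..k. ((1/2) gchoose i) * ((1/2::real) gchoose (k - i)))"
    by (simp add: sum_distrib_left atLeast0AtMost)
  also have "\<dots> = (-1) ^ k * (1 gchoose k)"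
    by (subst gbinomial_Vandermonde) simp
  finally show ?thesis .
qed

text \<open>The Cauchy square of the series for sqrt (1 - t) is 1 - t; Vandermonde's identity has
  evaluated the convolution.\<close>

lemma sqrt_coeff_conv_eq: "(\<Sum>i\<le>k. sqrt_coeff i * sqrt_coeff (k - i)) = (if k = 0 then 1 else if k = 1 then -1 else 0)"
proof -
  have "((1::real) gchoose k) = (if k = 0 then 1 else if k = 1 then 1 else 0)"
    using binomial_gbinomial[of 1 k, where 'a=real] by (cases k) (auto simp: binomial_eq_0)
  then show ?thesis by (simp add: sqrt_coeff_conv)
qed

lemma sqrt_coeff_Suc: "sqrt_coeff (Suc n) = sqrt_coeff n * ((real n - 1/2) / (real n + 1))"
  by (simp add: sqrt_coeff_def gbinomial_Suc_rec gbinomial_absorption field_simps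
      gbinomial_prod_rev prod.atLeast0_lessThan_Suc)

lemma sqrt_coeff_nonpos: "sqrt_coeff (Suc n) \<le> 0"
proof (induction n)
  case 0 show ?case by (simp add: sqrt_coeff_def)
next
  case (Suc n)
  then show ?case unfolding sqrt_coeff_Suc[of "Suc n"]
    by (intro mult_nonpos_nonneg divide_nonneg_nonneg) auto
qed

text \<open>The partial sums are the numbers (-1)^n (-1/2 choose n), whose signs cancel. As all
  terms after the first are nonpositive, this yields absolute summability, that is, convergence up
  to t = 1, which an operator of norm 1 requires.\<close>

lemma sqrt_coeff_partial_sum: "(\<Sum>i\<le>n. sqrt_coeff i) \<ge> 0"
proof -
  have nonneg: "0 \<le> (-1) ^ n * ((-1/2::real) gchoose n)" for n
    by (induction n) (auto simp: gbinomial_prod_rev prod.atLeast0_lessThan_Suc field_simps mult_nonneg_nonneg)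
  have "(\<Sum>i\<le>n. sqrt_coeff i) = (-1) ^ n * ((1/2 - 1::real) gchoose n)"
    unfolding sqrt_coeff_def by (subst gbinomial_sum_lower_neg[symmetric]) (simp add: mult.commute)
  then show ?thesis using nonneg[of n] by simp
qed

lemma summable_abs_sqrt_coeff: "summable (\<lambda>n. \<bar>sqrt_coeff n\<bar>)"
proof (rule summableI_nonneg_bounded)
  fix n
  have "(\<Sum>i<n. \<bar>sqrt_coeff i\<bar>) \<le> (\<Sum>i\<le>n. \<bar>sqrt_coeff i\<bar>)" by (intro sum_mono2) auto
  also have "\<dots> = \<bar>sqrt_coeff 0\<bar> + (\<Sum>i<n. \<bar>sqrt_coeff (Suc i)\<bar>)" by (rule sum.atMost_shift)
  also have "(\<Sum>i<n. \<bar>sqrt_coeff (Suc i)\<bar>) = - (\<Sum>i<n. sqrt_coeff (Suc i))"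
    by (simp add: sum_negf[symmetric] abs_of_nonpos[OF sqrt_coeff_nonpos])
  also have "\<bar>sqrt_coeff 0\<bar> + - (\<Sum>i<n. sqrt_coeff (Suc i)) = 2 * sqrt_coeff 0 - (\<Sum>i\<le>n. sqrt_coeff i)"
    by (simp add: sum.atMost_shift sqrt_coeff_def)
  also have "\<dots> \<le> 2" using sqrt_coeff_partial_sum[of n] by (simp add: sqrt_coeff_def)
  finally show "(\<Sum>i<n. \<bar>sqrt_coeff i\<bar>) \<le> 2" .
qed auto

text \<open>Applied with \<beta> k = <B^k p, q>. Over the triangle i + j < N the convolution
  identity leaves only the terms k = 0 and k = 1. Squares and triangles have the same limit, because
  the double sums of absolute values over both converge to the same number.\<close>

lemma sqrt_coeff_double_sum:
  assumes \<beta>: "\<And>k. cmod (\<beta> k) \<le> K"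
  shows "(\<lambda>N. \<Sum>i<N. \<Sum>j<N. of_real (sqrt_coeff i * sqrt_coeff j) * \<beta> (i + j)) \<longlonglongrightarrow> \<beta> 0 - \<beta> 1"
proof -
  let ?b = sqrt_coeff
  define T where "T N = (SIGMA i:{..<N}. {..<N - i})" for N :: nat
  define S where "S N = {..<N} \<times> {..<N::nat}" for N
  have TS: "T N \<subseteq> S N" "finite (S N)" for N by (auto simp: T_def S_def)
  have tri: "(\<Sum>(i,j)\<in>T N. g i j) = (\<Sum>k<N. \<Sum>i\<le>k. g i (k - i))" for N and g :: "nat \<Rightarrow> nat \<Rightarrow> 'c::comm_monoid_add"
  proof -
    have "T N = {(i, j). i + j < N}" by (auto simp: T_def)
    then show ?thesis using sum.triangle_reindex[of g N] by simp
  qed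
  have sq: "(\<Sum>(i,j)\<in>S N. g i j) = (\<Sum>i<N. \<Sum>j<N. g i j)" for N and g :: "nat \<Rightarrow> nat \<Rightarrow> 'c::comm_monoid_add"
    by (simp add: S_def sum.cartesian_product)
  let ?g = "\<lambda>i j. of_real (?b i * ?b j) * \<beta> (i + j)"
  let ?a = "\<lambda>i j. \<bar>?b i\<bar> * \<bar>?b j\<bar>"
  have K: "0 \<le> K" using \<beta>[of 0] norm_ge_zero[of "\<beta> 0"] by linarith
  have diff: "cmod ((\<Sum>(i,j)\<in>S N. ?g i j) - (\<Sum>(i,j)\<in>T N. ?g i j))
      \<le> K * ((\<Sum>(i,j)\<in>S N. ?a i j) - (\<Sum>(i,j)\<in>T N. ?a i j))" for N
  proof -
    have "(\<Sum>(i,j)\<in>S N. ?g i j) - (\<Sum>(i,j)\<in>T N. ?g i j) = (\<Sum>(i,j)\<in>S N - T N. ?g i j)"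
      by (simp add: sum_diff TS finite_subset[OF TS(1) TS(2)])
    also have "cmod \<dots> \<le> (\<Sum>(i,j)\<in>S N - T N. K * ?a i j)"
    proof (rule sum_norm_le, clarify)
      fix i j
      show "cmod (?g i j) \<le> K * ?a i j"
        using mult_right_mono[OF \<beta>[of "i + j"], of "?a i j"] by (simp add: norm_mult abs_mult mult_ac)
    qed
    also have "\<dots> = K * ((\<Sum>(i,j)\<in>S N. ?a i j) - (\<Sum>(i,j)\<in>T N. ?a i j))"
      by (simp add: sum_diff[symmetric] TS sum_distrib_left case_prod_beta)
    finally show ?thesis .
  qed
  define A where "A = (\<Sum>n. \<bar>?b n\<bar>)"
  have s1: "(\<lambda>N. \<Sum>(i,j)\<in>S N. ?a i j) \<longlonglongrightarrow> A * A"
    unfolding sq sum_product[symmetric] A_def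
    by (intro tendsto_mult summable_LIMSEQ summable_abs_sqrt_coeff)
  have s2: "(\<lambda>N. \<Sum>(i,j)\<in>T N. ?a i j) \<longlonglongrightarrow> A * A"
    unfolding tri using Cauchy_product_sums[of "\<lambda>n. \<bar>?b n\<bar>" "\<lambda>n. \<bar>?b n\<bar>"] summable_abs_sqrt_coeff
    by (simp add: sums_def A_def)
  have "(\<lambda>N. K * ((\<Sum>(i,j)\<in>S N. ?a i j) - (\<Sum>(i,j)\<in>T N. ?a i j))) \<longlonglongrightarrow> K * (A * A - A * A)"
    by (intro tendsto_intros s1 s2)
  then have "(\<lambda>N. (\<Sum>(i,j)\<in>S N. ?g i j) - (\<Sum>(i,j)\<in>T N. ?g i j)) \<longlonglongrightarrow> 0"
    by (intro Lim_null_comparison[OF always_eventually[OF allI[OF diff]]]) simp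
  moreover have "(\<lambda>N. \<Sum>(i,j)\<in>T N. ?g i j) \<longlonglongrightarrow> \<beta> 0 - \<beta> 1"
  proof -
    have inner: "(\<Sum>i\<le>k. ?g i (k - i)) = of_real (if k = 0 then 1 else if k = 1 then -1 else 0) * \<beta> k" for k
    proof -
      have "(\<Sum>i\<le>k. ?g i (k - i)) = (\<Sum>i\<le>k. of_real (?b i * ?b (k - i))) * \<beta> k"
        by (simp add: sum_distrib_right)
      then show ?thesis unfolding of_real_sum[symmetric] sqrt_coeff_conv_eq .
    qed
    have "(\<Sum>(i,j)\<in>T N. ?g i j) = \<beta> 0 - \<beta> 1" if "N \<ge> 2" for N
    proof -
      have "(\<Sum>(i,j)\<in>T N. ?g i j) = (\<Sum>k<N. of_real (if k = 0 then 1 else if k = 1 then -1 else 0) * \<beta> k)"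
        unfolding tri inner ..
      also have "\<dots> = (\<Sum>k\<in>{0,1}. of_real (if k = 0 then 1 else if k = 1 then -1 else 0) * \<beta> k)"
        by (intro sum.mono_neutral_right) (use that in auto)
      finally show ?thesis by simp
    qed
    then show ?thesis by (intro tendsto_eventually eventually_sequentiallyI[of 2]) auto
  qed
  ultimately have "(\<lambda>N. ((\<Sum>(i,j)\<in>S N. ?g i j) - (\<Sum>(i,j)\<in>T N. ?g i j)) + (\<Sum>(i,j)\<in>T N. ?g i j)) \<longlonglongrightarrow> 0 + (\<beta> 0 - \<beta> 1)"
    by (rule tendsto_add)
  then show ?thesis by (simp add: sq)
qed

context semi_inner
begin

text \<open>The partial sums of sqrt (1 - B).\<close>

definition sqrt_approx :: "('v \<Rightarrow> 'v) \<Rightarrow> nat \<Rightarrow> 'v \<Rightarrow> 'v" where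
  "sqrt_approx B N p = (\<Sum>i<N. of_real (sqrt_coeff i) \<odot> (B ^^ i) p)"

text \<open>The series converges on every vector of D since |B^i p| \<le> |p| and the coefficients
  are absolutely summable. The third claim says that the limit S satisfies <S p, S q> = <(1 - B) p,
  q>. Only D has to be invariant under B and it need not be complete, so S is met only through its
  approximations.\<close>

lemma sqrt_approx_properties:
  assumes DH: "D \<subseteq> H" and BD: "\<And>p. p \<in> D \<Longrightarrow> B p \<in> D"
    and sym: "\<And>p q. p \<in> D \<Longrightarrow> q \<in> D \<Longrightarrow> ip (B p) q = ip p (B q)"
    and contr: "\<And>p. p \<in> D \<Longrightarrow> nrm (B p) \<le> nrm p"
  shows sqrt_approx_mem: "p \<in> D \<Longrightarrow> sqrt_approx B N p \<in> H"
    and sqrt_approx_Cauchy: "p \<in> D \<Longrightarrow> e > 0 \<Longrightarrow>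
      \<exists>N. \<forall>m\<ge>N. \<forall>n\<ge>N. nrm (sqrt_approx B m p - sqrt_approx B n p) < e"
    and sqrt_approx_ip: "p \<in> D \<Longrightarrow> q \<in> D \<Longrightarrow>
      (\<lambda>N. ip (sqrt_approx B N p) (sqrt_approx B N q)) \<longlonglongrightarrow> ip p q - ip (B p) q"
proof -
  have BnD: "(B ^^ n) p \<in> D" if "p \<in> D" for n p using that BD by (induction n) auto
  then have BnH: "(B ^^ n) p \<in> H" if "p \<in> D" for n p using DH that by blast
  have Bn: "nrm ((B ^^ n) p) \<le> nrm p" if "p \<in> D" for n p
    by (induction n) (use contr[OF BnD[OF that]] order_trans in auto)
  have ipn: "ip ((B ^^ i) p) ((B ^^ j) q) = ip ((B ^^ (i + j)) p) q" if "p \<in> D" "q \<in> D" for i j p q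
  proof (induction j arbitrary: i)
    case (Suc j)
    have "ip ((B ^^ i) p) ((B ^^ Suc j) q) = ip ((B ^^ Suc i) p) ((B ^^ j) q)"
      using sym[OF BnD[OF that(1), of i] BnD[OF that(2), of j]] by simp
    also have "\<dots> = ip ((B ^^ (Suc i + j)) p) q" by (rule Suc)
    finally show ?case by simp
  qed simp
  show mem: "sqrt_approx B N p \<in> H" if "p \<in> D" for N p
    unfolding sqrt_approx_def by (intro H_sum H_closed BnH that)
  show "\<exists>N. \<forall>m\<ge>N. \<forall>n\<ge>N. nrm (sqrt_approx B m p - sqrt_approx B n p) < e" if p: "p \<in> D" and "e > 0" for p e
  proof -
    have pH: "p \<in> H" using p DH by blast
    have le: "nrm (sqrt_approx B m p - sqrt_approx B n p) \<le> (\<Sum>i=n..<m. \<bar>sqrt_coeff i\<bar>) * nrm p" if "n \<le> m" for m n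
    proof -
      have "sqrt_approx B m p - sqrt_approx B n p = (\<Sum>i=n..<m. of_real (sqrt_coeff i) \<odot> (B ^^ i) p)"
        unfolding sqrt_approx_def lessThan_atLeast0
        using sum_diff_nat_ivl[of 0 n m "\<lambda>i. of_real (sqrt_coeff i) \<odot> (B ^^ i) p"] that by simp
      also have "nrm \<dots> \<le> (\<Sum>i=n..<m. nrm (of_real (sqrt_coeff i) \<odot> (B ^^ i) p))"
        by (rule nrm_sum) (use BnH p in auto)
      also have "\<dots> \<le> (\<Sum>i=n..<m. \<bar>sqrt_coeff i\<bar> * nrm p)"
        by (intro sum_mono) (simp add: nrm_scale BnH p mult_left_mono Bn)
      finally show ?thesis by (simp add: sum_distrib_right)
    qed
    obtain N where N: "\<And>m n. m \<ge> N \<Longrightarrow> norm (\<Sum>i=m..<n. \<bar>sqrt_coeff i\<bar>) < e / (nrm p + 1)"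
      using summable_abs_sqrt_coeff[unfolded summable_Cauchy, rule_format, of "e / (nrm p + 1)"] pH \<open>e > 0\<close>
      by (metis add_nonneg_pos divide_pos_pos nrm_nonneg zero_less_one)
    have lt: "nrm (sqrt_approx B m p - sqrt_approx B n p) < e" if "n \<ge> N" "n \<le> m" for m n
    proof -
      have "nrm (sqrt_approx B m p - sqrt_approx B n p) \<le> (\<Sum>i=n..<m. \<bar>sqrt_coeff i\<bar>) * nrm p"
        by (rule le[OF that(2)])
      also have "\<dots> \<le> (\<Sum>i=n..<m. \<bar>sqrt_coeff i\<bar>) * (nrm p + 1)"
        by (intro mult_left_mono sum_nonneg) auto
      also have "\<dots> < e / (nrm p + 1) * (nrm p + 1)"
        using N[OF that(1), of m] nrm_nonneg[OF pH] by (intro mult_strict_right_mono) auto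
      also have "\<dots> = e" using nrm_nonneg[OF pH] by (simp add: field_simps)
      finally show ?thesis .
    qed
    then show ?thesis
      by (metis (no_types, opaque_lifting) mem nle_le nrm_minus_commute p)
  qed
  show "(\<lambda>N. ip (sqrt_approx B N p) (sqrt_approx B N q)) \<longlonglongrightarrow> ip p q - ip (B p) q"
    if p: "p \<in> D" and q: "q \<in> D" for p q
  proof -
    have pq: "p \<in> H" "q \<in> H" using p q DH by auto
    have "cmod (ip ((B ^^ k) p) q) \<le> nrm p * nrm q" for k
      using cauchy_schwarz[OF BnH[OF p] pq(2), of k] mult_right_mono[OF Bn[OF p, of k], of "nrm q"] pq
      by (force intro: order_trans)
    from sqrt_coeff_double_sum[of "\<lambda>k. ip ((B ^^ k) p) q", OF this]
    have "(\<lambda>N. \<Sum>i<N. \<Sum>j<N. of_real (sqrt_coeff i * sqrt_coeff j) * ip ((B ^^ (i + j)) p) q)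
        \<longlonglongrightarrow> ip p q - ip (B p) q" by simp
    moreover have "ip (sqrt_approx B N p) (sqrt_approx B N q)
        = (\<Sum>i<N. \<Sum>j<N. of_real (sqrt_coeff i * sqrt_coeff j) * ip ((B ^^ (i + j)) p) q)" for N
      unfolding sqrt_approx_def
      by (simp add: ip_sum ip_sum_right H_sum BnH p q ip_scale ip_scale_right sum_distrib_left ipn mult.assoc) (simp only: add.commute)
    ultimately show ?thesis by simp
  qed
qed

end

section \<open>Bounded operators on a semi-Hilbert space\<close>

context semi_inner
begin

text \<open>In L2 this is equality almost everywhere.\<close>

definition eqv :: "'v \<Rightarrow> 'v \<Rightarrow> bool" (infix "\<simeq>" 50) where "x \<simeq> y \<longleftrightarrow> nrm (x - y) = 0"

lemma eqv_refl [simp]: "x \<simeq> x"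
  by (simp add: eqv_def)

lemma eqv_sym: "x \<in> H \<Longrightarrow> y \<in> H \<Longrightarrow> x \<simeq> y \<Longrightarrow> y \<simeq> x"
  by (simp add: eqv_def nrm_minus_commute)

lemma eqv_trans: "\<lbrakk>x \<in> H; y \<in> H; z \<in> H; x \<simeq> y; y \<simeq> z\<rbrakk> \<Longrightarrow> x \<simeq> z"
  using nrm_triangle_diff[of x y z] nrm_nonneg[of "x - z"] by (simp add: eqv_def del: nrm_nonneg)

lemma eqv_add: "\<lbrakk>x \<in> H; y \<in> H; x' \<in> H; y' \<in> H; x \<simeq> x'; y \<simeq> y'\<rbrakk> \<Longrightarrow> x + y \<simeq> x' + y'"
  using nrm_triangle[of "x - x'" "y - y'"] nrm_nonneg[of "x + y - (x' + y')"]
  by (simp add: eqv_def add_diff_add del: nrm_nonneg)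

lemma ip_eqv: "\<lbrakk>x \<in> H; x' \<in> H; y \<in> H; y' \<in> H; x \<simeq> x'; y \<simeq> y'\<rbrakk> \<Longrightarrow> ip x y = ip x' y'"
  unfolding eqv_def by (rule ip_eq_of_nrm_zero)

lemma nrm_eqv: "\<lbrakk>x \<in> H; y \<in> H; x \<simeq> y\<rbrakk> \<Longrightarrow> nrm x = nrm y"
  using ip_eqv[of x y x y] by (simp add: nrm_def)

lemma eqvI: assumes "x \<in> H" "y \<in> H" "\<And>z. z \<in> H \<Longrightarrow> ip x z = ip y z" shows "x \<simeq> y"
proof -
  have "ip (x - y) (x - y) = 0" using assms(3)[of "x - y"] assms(1,2) ip_diff[of x y "x - y"] by simp
  then show ?thesis by (simp add: eqv_def nrm_def)
qed

section \<open>Closures of subspaces and bounded operators\<close>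

definition clo :: "'v set \<Rightarrow> 'v set" where
  "clo D = {p \<in> H. \<forall>e>0. \<exists>d\<in>D. nrm (p - d) < e}"

lemma clo_subset: "D \<subseteq> H \<Longrightarrow> D \<subseteq> clo D"
  by (force simp: clo_def)

lemma clo_H: "p \<in> clo D \<Longrightarrow> p \<in> H"
  by (simp add: clo_def)

lemma clo_eqv: assumes "D \<subseteq> H" "p \<in> clo D" "q \<in> H" "p \<simeq> q" shows "q \<in> clo D"
  unfolding clo_def
proof (intro CollectI conjI allI impI)
  fix e :: real assume "e > 0"
  then obtain d where d: "d \<in> D" "nrm (p - d) < e" using assms by (auto simp: clo_def)
  have "nrm (q - d) \<le> nrm (q - p) + nrm (p - d)"
    by (rule nrm_triangle_diff) (use assms d clo_H in auto)
  moreover have "nrm (q - p) = 0"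
    using assms clo_H[OF assms(2)] nrm_minus_commute[of p q] by (simp add: eqv_def)
  ultimately show "\<exists>d\<in>D. nrm (q - d) < e" using d by (intro bexI[of _ d]) auto
qed (use assms in auto)

lemma subspace_clo: assumes D: "subspace D" "D \<subseteq> H" shows "subspace (clo D)"
proof (rule subspaceI)
  show "0 \<in> clo D" using clo_subset[OF D(2)] subspace_0[OF D(1)] by blast
next
  fix x y assume xy: "x \<in> clo D" "y \<in> clo D"
  have "\<exists>d\<in>D. nrm (x + y - d) < e" if "e > 0" for e
  proof -
    have "e / 2 > 0" using that by simp
    then obtain d d' where d: "d \<in> D" "d' \<in> D" "nrm (x - d) < e / 2" "nrm (y - d') < e / 2"
      using xy unfolding clo_def by blast
    have "nrm (x + y - (d + d')) \<le> nrm (x - d) + nrm (y - d')"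
      using nrm_triangle[OF H_closed(3)[of x d] H_closed(3)[of y d']] xy d D clo_H
      by (auto simp: add_diff_add subset_iff)
    then show ?thesis using d subspace_add[OF D(1) d(1,2)] by (intro bexI[of _ "d + d'"]) auto
  qed
  then show "x + y \<in> clo D" using xy by (simp add: clo_def)
next
  fix c x assume x: "x \<in> clo D"
  have "\<exists>d\<in>D. nrm (c \<odot> x - d) < e" if "e > 0" for e
  proof -
    have "e / (cmod c + 1) > 0" using that by (simp add: add_nonneg_pos)
    then obtain d where d: "d \<in> D" "nrm (x - d) < e / (cmod c + 1)" using x unfolding clo_def by blast
    have dH: "d \<in> H" using d D by blast
    have "nrm (c \<odot> x - c \<odot> d) = cmod c * nrm (x - d)"
      using nrm_scale[of "x - d" c] dH clo_H[OF x] by (simp add: scale_right_diff_distrib)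
    also have "\<dots> \<le> (cmod c + 1) * nrm (x - d)"
      using dH clo_H[OF x] by (intro mult_right_mono) auto
    also have "\<dots> < (cmod c + 1) * (e / (cmod c + 1))"
      using d by (intro mult_strict_left_mono) (auto simp: add_nonneg_pos)
    also have "\<dots> = e" by (smt (verit) nonzero_mult_div_cancel_left norm_ge_zero times_divide_eq_right)
    finally show ?thesis using subspace_scale[OF D(1) d(1)] by blast
  qed
  then show "c \<odot> x \<in> clo D" using x by (simp add: clo_def)
qed

lemma ip_clo:
  assumes D: "D \<subseteq> H" and x: "x \<in> H" and orth: "\<And>d. d \<in> D \<Longrightarrow> ip x d = 0" and p: "p \<in> clo D"
  shows "ip x p = 0"
proof (rule ccontr)
  assume "ip x p \<noteq> 0"
  then have pos: "cmod (ip x p) / (nrm x + 1) > 0" using x by (simp add: add_nonneg_pos)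
  then obtain d where d: "d \<in> D" "nrm (p - d) < cmod (ip x p) / (nrm x + 1)"
    using p unfolding clo_def by blast
  have dH: "d \<in> H" using d D by blast
  have "cmod (ip x p) = cmod (ip x (p - d))" using orth[OF d(1)] x dH clo_H[OF p] by (simp add: ip_simps)
  also have "\<dots> \<le> nrm x * nrm (p - d)" using x dH clo_H[OF p] by (intro cauchy_schwarz) auto
  also have "\<dots> \<le> (nrm x + 1) * nrm (p - d)" using dH clo_H[OF p] by (intro mult_right_mono) auto
  also have "\<dots> < (nrm x + 1) * (cmod (ip x p) / (nrm x + 1))"
    using d x by (intro mult_strict_left_mono) (auto simp: add_nonneg_pos)
  also have "\<dots> = cmod (ip x p)"
    using nrm_nonneg[OF x] by (simp add: field_simps)
  finally show False by simp
qed

text \<open>Linearity is asked for only up to null vectors, so that in L2 these are exactly the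
  \<open>bounded_ops\<close>.\<close>

definition bop :: "('v \<Rightarrow> 'v) set" where
  "bop = {T. (\<forall>x\<in>H. T x \<in> H) \<and> (\<forall>x\<in>H. \<forall>y\<in>H. T (x + y) \<simeq> T x + T y) \<and>
    (\<forall>x\<in>H. \<forall>c. T (c \<odot> x) \<simeq> c \<odot> T x) \<and> (\<exists>C. \<forall>x\<in>H. nrm (T x) \<le> C * nrm x)}"

lemma bop_H: "T \<in> bop \<Longrightarrow> x \<in> H \<Longrightarrow> T x \<in> H"
  by (simp add: bop_def)

lemma bop_add: "T \<in> bop \<Longrightarrow> x \<in> H \<Longrightarrow> y \<in> H \<Longrightarrow> T (x + y) \<simeq> T x + T y"
  by (simp add: bop_def)

lemma bop_scale: "T \<in> bop \<Longrightarrow> x \<in> H \<Longrightarrow> T (c \<odot> x) \<simeq> c \<odot> T x"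
  by (simp add: bop_def)

lemma bop_bound: assumes "T \<in> bop" obtains C where "C > 0" "\<And>x. x \<in> H \<Longrightarrow> nrm (T x) \<le> C * nrm x"
proof -
  obtain C where C: "\<forall>x\<in>H. nrm (T x) \<le> C * nrm x" using assms by (auto simp: bop_def)
  have "nrm (T x) \<le> (\<bar>C\<bar> + 1) * nrm x" if "x \<in> H" for x
  proof -
    have "nrm (T x) \<le> C * nrm x" using C that by blast
    also have "\<dots> \<le> (\<bar>C\<bar> + 1) * nrm x" by (rule mult_right_mono) (use that in auto)
    finally show ?thesis .
  qed
  then show ?thesis by (intro that[of "\<bar>C\<bar> + 1"]) auto
qed

lemma bop_diff: assumes T: "T \<in> bop" and x: "x \<in> H" and y: "y \<in> H" shows "T (x - y) \<simeq> T x - T y"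
proof -
  note m = bop_H[OF T]
  have a: "T (x + (-1) \<odot> y) \<simeq> T x + T ((-1) \<odot> y)" using T x y by (intro bop_add) auto
  have b: "T x + T ((-1) \<odot> y) \<simeq> T x + (-1) \<odot> T y"
    using T x y m by (intro eqv_add bop_scale) auto
  have "T (x + (-1) \<odot> y) \<simeq> T x + (-1) \<odot> T y" by (rule eqv_trans[OF _ _ _ a b]) (use m x y in auto)
  then show ?thesis by simp
qed

text \<open>The bound makes T (x - y) null when x - y is null, and additivity passes from it to T x
  - T y. So operators on representatives act on classes.\<close>

lemma bop_eqv: assumes T: "T \<in> bop" and x: "x \<in> H" and y: "y \<in> H" and "x \<simeq> y" shows "T x \<simeq> T y"
proof -
  obtain C where C: "C > 0" "\<And>x. x \<in> H \<Longrightarrow> nrm (T x) \<le> C * nrm x" using bop_bound[OF T] by blast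
  have "nrm (T (x - y)) = 0"
    using C(2)[of "x - y"] x y \<open>x \<simeq> y\<close> nrm_nonneg[OF bop_H[OF T, of "x - y"]] by (simp add: eqv_def)
  moreover have "nrm (T (x - y)) = nrm (T x - T y)"
    by (rule nrm_eqv) (use T x y bop_H bop_diff in auto)
  ultimately show ?thesis by (simp add: eqv_def)
qed

lemma bop_zero: assumes "T \<in> bop" shows "T 0 \<simeq> 0"
proof -
  obtain C where C: "C > 0" "\<And>x. x \<in> H \<Longrightarrow> nrm (T x) \<le> C * nrm x" using bop_bound[OF assms] by blast
  then show ?thesis using C(2)[of 0] nrm_nonneg[OF bop_H[OF assms, of 0]] by (simp add: eqv_def)
qed

lemma bop_id: "(\<lambda>x. x) \<in> bop"
  by (auto simp: bop_def intro: exI[of _ 1])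

lemma bop_comp: assumes S: "S \<in> bop" and T: "T \<in> bop" shows "S \<circ> T \<in> bop"
proof -
  obtain C where C: "C > 0" "\<And>x. x \<in> H \<Longrightarrow> nrm (S x) \<le> C * nrm x" using bop_bound[OF S] by blast
  obtain C' where C': "C' > 0" "\<And>x. x \<in> H \<Longrightarrow> nrm (T x) \<le> C' * nrm x" using bop_bound[OF T] by blast
  note m = bop_H[OF S] bop_H[OF T]
  have "nrm (S (T x)) \<le> (C * C') * nrm x" if "x \<in> H" for x
    using order_trans[OF C(2)[OF m(2)[OF that]] mult_left_mono[OF C'(2)[OF that], of C]] C(1)
    by (simp add: mult.assoc)
  moreover have "S (T (x + y)) \<simeq> S (T x) + S (T y)" if "x \<in> H" "y \<in> H" for x y
    by (rule eqv_trans[OF _ _ _ bop_eqv[OF S _ _ bop_add[OF T that]] bop_add[OF S]])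
      (use m that in auto)
  moreover have "S (T (c \<odot> x)) \<simeq> c \<odot> S (T x)" if "x \<in> H" for x c
    by (rule eqv_trans[OF _ _ _ bop_eqv[OF S _ _ bop_scale[OF T that]] bop_scale[OF S]])
      (use m that in auto)
  ultimately show ?thesis using m by (auto simp: bop_def)
qed

text \<open>Invariance is tested on generators, which may even be sent into the closure: it passes
  to the span by linearity up to null vectors and to the closure by boundedness.\<close>

lemma bop_clo_span:
  assumes T: "T \<in> bop" and G: "G \<subseteq> H" and inv: "\<And>g. g \<in> G \<Longrightarrow> T g \<in> clo (span G)"
    and p: "p \<in> clo (span G)"
  shows "T p \<in> clo (span G)"
proof -
  have sG: "span G \<subseteq> H" using span_minimal[OF G H] .
  note sc = subspace_clo[OF subspace_span sG]
  have "x \<in> H \<and> T x \<in> clo (span G)" if "x \<in> span G" for x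
    using that
  proof (induction rule: span_induct_alt)
    case base
    then show ?case
      using clo_eqv[OF sG subspace_0[OF sc] bop_H[OF T] eqv_sym[OF _ _ bop_zero[OF T]]] bop_H[OF T] by auto
  next
    case (step c x y)
    have x: "x \<in> H" using G step by auto
    have y: "y \<in> H" "T y \<in> clo (span G)" using step by auto
    have "c \<odot> T x + T y \<in> clo (span G)"
      by (intro subspace_add[OF sc] subspace_scale[OF sc] inv y step)
    moreover have "T (c \<odot> x + y) \<simeq> c \<odot> T x + T y"
      by (rule eqv_trans[OF _ _ _ bop_add[OF T] eqv_add[OF _ _ _ _ bop_scale[OF T]]])
        (use x y bop_H[OF T] in auto)
    ultimately have "T (c \<odot> x + y) \<in> clo (span G)"
      using clo_eqv[OF sG] eqv_sym x y bop_H[OF T] by (metis H_closed(2,4))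
    then show ?case using x y by auto
  qed
  note span_inv = this
  obtain C where C: "C > 0" "\<And>x. x \<in> H \<Longrightarrow> nrm (T x) \<le> C * nrm x" using bop_bound[OF T] by blast
  have pH: "p \<in> H" using clo_H[OF p] .
  have "\<exists>d\<in>span G. nrm (T p - d) < e" if "e > 0" for e
  proof -
    have "e / (2 * C) > 0" using that C by simp
    then obtain d where d: "d \<in> span G" "nrm (p - d) < e / (2 * C)" using p unfolding clo_def by blast
    have dH: "d \<in> H" using d sG by blast
    have "e / 2 > 0" using that by simp
    then obtain d' where d': "d' \<in> span G" "nrm (T d - d') < e / 2"
      using span_inv[OF d(1)] unfolding clo_def by blast
    have d'H: "d' \<in> H" using d' sG by blast
    have "nrm (T p - T d) = nrm (T (p - d))"
      by (rule nrm_eqv[OF _ _ eqv_sym[OF _ _ bop_diff[OF T]]]) (use pH dH bop_H[OF T] in auto)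
    also have "\<dots> \<le> C * nrm (p - d)" using C(2) pH dH by simp
    also have "\<dots> < C * (e / (2 * C))" using d C by (intro mult_strict_left_mono) auto
    also have "\<dots> = e / 2" using C by simp
    finally have "nrm (T p - d') < e"
      using d'(2) nrm_triangle_diff[of "T p" "T d" d'] pH dH d'H bop_H[OF T] by auto
    then show ?thesis using d' by blast
  qed
  then show ?thesis using pH bop_H[OF T] by (simp add: clo_def)
qed

definition comm :: "('v \<Rightarrow> 'v) set \<Rightarrow> ('v \<Rightarrow> 'v) set" where
  "comm A = {T \<in> bop. \<forall>S\<in>A. \<forall>x\<in>H. T (S x) \<simeq> S (T x)}"

lemma comm_bop: "T \<in> comm A \<Longrightarrow> T \<in> bop"
  by (simp add: comm_def)

lemma comm_comp: assumes A: "A \<subseteq> bop" and S: "S \<in> comm A" and T: "T \<in> comm A" shows "S \<circ> T \<in> comm A"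
proof -
  note m = bop_H[OF comm_bop[OF S]] bop_H[OF comm_bop[OF T]]
  have "S (T (U x)) \<simeq> U (S (T x))" if U: "U \<in> A" and x: "x \<in> H" for U x
  proof -
    have mU: "U y \<in> H" if "y \<in> H" for y using bop_H U A that by blast
    show ?thesis
      by (rule eqv_trans[OF _ _ _ bop_eqv[OF comm_bop[OF S], of _ "U (T x)"]])
        (use m mU U x S T in \<open>auto simp: comm_def\<close>)
  qed
  then show ?thesis using bop_comp[OF comm_bop[OF S] comm_bop[OF T]] by (simp add: comm_def)
qed

end

section \<open>Adjoints and orthogonal projections\<close>

context semi_hilbert
begin

text \<open>Riesz' theorem for \<open>x \<mapsto> ip (T x) y\<close>, one y at a time. Linearity of
  T' is read off from the defining identity, since inner products determine a vector up to
  \<open>eqv\<close>, and its bound from |T' y|^2 = <T T' y, y>.\<close>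

lemma adjoint_exists:
  assumes T: "T \<in> bop"
  obtains T' where "T' \<in> bop" "\<And>x y. x \<in> H \<Longrightarrow> y \<in> H \<Longrightarrow> ip (T x) y = ip x (T' y)"
proof -
  note m = bop_H[OF T]
  obtain C where C: "C > 0" "\<And>x. x \<in> H \<Longrightarrow> nrm (T x) \<le> C * nrm x" using bop_bound[OF T] by blast
  have "\<exists>b\<in>H. \<forall>x\<in>H. ip (T x) y = ip x b" if y: "y \<in> H" for y
  proof -
    have add: "ip (T (x + x')) y = ip (T x) y + ip (T x') y" if "x \<in> H" "x' \<in> H" for x x'
      using ip_eqv[OF _ _ y y bop_add[OF T that]] that m y by (simp add: ip_simps)
    have sc: "ip (T (c \<odot> x)) y = c * ip (T x) y" if "x \<in> H" for x c
      using ip_eqv[OF _ _ y y bop_scale[OF T that, of c]] that m y by (simp add: ip_simps)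
    obtain b where b: "b \<in> H" "\<And>d r. (d, r) \<in> (\<lambda>x. (x, ip (T x) y)) ` H \<Longrightarrow> r = ip d b"
    proof (rule riesz[of "(\<lambda>x. (x, ip (T x) y)) ` H" "C * nrm y"])
      show "cmod r \<le> C * nrm y * nrm d" if "(d, r) \<in> (\<lambda>x. (x, ip (T x) y)) ` H" for d r
      proof -
        have d: "d \<in> H" "r = ip (T d) y" using that by auto
        have "cmod r \<le> nrm (T d) * nrm y" unfolding d using m d y by (intro cauchy_schwarz) auto
        also have "\<dots> \<le> C * nrm d * nrm y" using C d y by (intro mult_right_mono) auto
        finally show ?thesis by (simp add: mult_ac)
      qed
      show "(0, 0) \<in> (\<lambda>x. (x, ip (T x) y)) ` H" using sc[of 0 0] by (intro image_eqI[of _ _ 0]) auto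
    qed (auto simp: add sc intro!: image_eqI)
    then show ?thesis by blast
  qed
  then obtain T' where T': "\<And>y. y \<in> H \<Longrightarrow> T' y \<in> H" "\<And>x y. x \<in> H \<Longrightarrow> y \<in> H \<Longrightarrow> ip (T x) y = ip x (T' y)"
    by metis
  have eq: "u \<simeq> v" if "u \<in> H" "v \<in> H" "\<And>x. x \<in> H \<Longrightarrow> ip x u = ip x v" for u v
  proof (rule eqvI[OF that(1,2)])
    show "ip u z = ip v z" if "z \<in> H" for z
      using ip_cnj[of z u] ip_cnj[of z v] that \<open>u \<in> H\<close> \<open>v \<in> H\<close> \<open>\<And>x. x \<in> H \<Longrightarrow> ip x u = ip x v\<close> by simp
  qed
  have "nrm (T' y) \<le> C * nrm y" if y: "y \<in> H" for y
  proof (cases "nrm (T' y) = 0")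
    case True then show ?thesis using y C by simp
  next
    case False
    then have pos: "nrm (T' y) > 0" using nrm_nonneg[OF T'(1)[OF y]] by linarith
    have "nrm (T' y) * nrm (T' y) = cmod (ip (T' y) (T' y))"
      using T'(1)[OF y] by (simp add: ip_self power2_eq_square norm_mult)
    also have "\<dots> = cmod (ip (T (T' y)) y)" using T' y by simp
    also have "\<dots> \<le> nrm (T (T' y)) * nrm y" by (intro cauchy_schwarz m T' y)
    also have "\<dots> \<le> C * nrm (T' y) * nrm y" by (intro mult_right_mono C T' y nrm_nonneg)
    finally have "nrm (T' y) * nrm (T' y) \<le> nrm (T' y) * (C * nrm y)" by (simp add: mult_ac)
    then show ?thesis using pos by simp
  qed
  then have "T' \<in> bop"
    using T' m by (auto simp: bop_def T'(2)[symmetric] ip_simps intro!: eq)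
  then show ?thesis using T'(2) by (rule that)
qed

text \<open>The orthogonal projection onto \<open>clo D\<close>. Its value is determined only up to
  null vectors, hence the choice.\<close>

definition proj :: "'v set \<Rightarrow> 'v \<Rightarrow> 'v" where
  "proj D f = (SOME p. p \<in> clo D \<and> (\<forall>d\<in>D. ip (f - p) d = 0))"

lemma proj_props:
  assumes D: "subspace D" "D \<subseteq> H" and f: "f \<in> H"
  shows proj_clo: "proj D f \<in> clo D" and proj_orth: "d \<in> clo D \<Longrightarrow> ip (f - proj D f) d = 0"
proof -
  obtain p where "p \<in> H" "\<And>d. d \<in> D \<Longrightarrow> ip (f - p) d = 0" "\<And>e. e > 0 \<Longrightarrow> \<exists>d\<in>D. nrm (p - d) < e"
    using projection_exists[OF D f] by blast
  then have "\<exists>p. p \<in> clo D \<and> (\<forall>d\<in>D. ip (f - p) d = 0)" by (auto simp: clo_def)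
  then have "proj D f \<in> clo D \<and> (\<forall>d\<in>D. ip (f - proj D f) d = 0)"
    unfolding proj_def by (rule someI_ex)
  then have *: "proj D f \<in> clo D" "\<And>d. d \<in> D \<Longrightarrow> ip (f - proj D f) d = 0" by auto
  then show "proj D f \<in> clo D" by simp
  then show "ip (f - proj D f) d = 0" if "d \<in> clo D"
    by (intro ip_clo[OF D(2) _ _ that] *) (use f clo_H in auto)
qed

lemma proj_unique:
  assumes D: "subspace D" "D \<subseteq> H" and f: "f \<in> H" and p: "p \<in> clo D" "\<And>d. d \<in> D \<Longrightarrow> ip (f - p) d = 0"
  shows "proj D f \<simeq> p"
proof -
  let ?q = "proj D f"
  have q: "?q \<in> clo D" using proj_clo[OF D f] .
  have H': "p \<in> H" "?q \<in> H" using p q clo_H by auto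
  have dc: "?q - p \<in> clo D" using subspace_diff[OF subspace_clo[OF D]] p q by blast
  have "ip (?q - p) (?q - p) = ip (f - p) (?q - p) - ip (f - ?q) (?q - p)"
    using f H' by (simp add: ip_simps)
  also have "\<dots> = 0"
    using proj_orth[OF D f dc] ip_clo[OF D(2) _ p(2) dc] f H' by simp
  finally show ?thesis by (simp add: eqv_def nrm_def)
qed

lemma proj_fix: assumes D: "subspace D" "D \<subseteq> H" and f: "f \<in> clo D" shows "proj D f \<simeq> f"
  by (rule proj_unique[OF D clo_H[OF f] f]) (use D(2) in \<open>auto intro: ip_zero(1)\<close>)

lemma proj_sym:
  assumes D: "subspace D" "D \<subseteq> H" and f: "f \<in> H" and g: "g \<in> H"
  shows "ip (proj D f) g = ip f (proj D g)"
proof -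
  have H': "proj D f \<in> H" "proj D g \<in> H" using proj_clo[OF D] f g clo_H by auto
  have "ip (proj D f) (g - proj D g) = 0"
    using proj_orth[OF D g proj_clo[OF D f]] ip_cnj[of "g - proj D g" "proj D f"] g H' by simp
  moreover have "ip (f - proj D f) (proj D g) = 0" by (rule proj_orth[OF D f proj_clo[OF D g]])
  ultimately show ?thesis using f g H' by (simp add: ip_simps)
qed

lemma proj_bop: assumes D: "subspace D" "D \<subseteq> H" shows "proj D \<in> bop"
proof -
  have m: "proj D x \<in> H" if "x \<in> H" for x using proj_clo[OF D that] clo_H by blast
  note sc = subspace_clo[OF D]
  have D': "d \<in> clo D" if "d \<in> D" for d using clo_subset[OF D(2)] that by blast
  have "proj D (x + y) \<simeq> proj D x + proj D y" if x: "x \<in> H" and y: "y \<in> H" for x y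
  proof (rule proj_unique[OF D])
    fix d assume d: "d \<in> D"
    have eq: "x + y - (proj D x + proj D y) = (x - proj D x) + (y - proj D y)" by simp
    show "ip (x + y - (proj D x + proj D y)) d = 0"
      unfolding eq using proj_orth[OF D x D'[OF d]] proj_orth[OF D y D'[OF d]] x y m D d by (simp add: ip_add subset_iff)
  qed (use x y proj_clo[OF D] subspace_add[OF sc] in auto)
  moreover have "proj D (c \<odot> x) \<simeq> c \<odot> proj D x" if x: "x \<in> H" for x c
  proof (rule proj_unique[OF D])
    fix d assume d: "d \<in> D"
    have eq: "c \<odot> x - c \<odot> proj D x = c \<odot> (x - proj D x)" by (simp add: scale_right_diff_distrib)
    show "ip (c \<odot> x - c \<odot> proj D x) d = 0"
      unfolding eq using proj_orth[OF D x D'[OF d]] x m D d by (simp add: ip_scale subset_iff)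
  qed (use x proj_clo[OF D] subspace_scale[OF sc] in auto)
  moreover have "nrm (proj D x) \<le> 1 * nrm x" if x: "x \<in> H" for x
  proof -
    have "ip (x - proj D x) (proj D x) = 0" by (rule proj_orth[OF D x proj_clo[OF D x]])
    then have "(nrm x)\<^sup>2 = (nrm (x - proj D x))\<^sup>2 + (nrm (proj D x))\<^sup>2"
      using nrm_add_sq[of "x - proj D x" "proj D x"] x m by simp
    then have "(nrm (proj D x))\<^sup>2 \<le> (nrm x)\<^sup>2" by simp
    then show ?thesis using m[OF x] x by (simp add: power2_le_iff_abs_le)
  qed
  ultimately show ?thesis using m unfolding bop_def by blast
qed

text \<open>A closed subspace invariant under T and its adjoint reduces T: if p is the projection of
  x, then T p stays in the subspace and <T x - T p, d> = <x - p, T' d> = 0.\<close>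

lemma proj_commute:
  assumes G: "G \<subseteq> H" and T: "T \<in> bop" and T': "T' \<in> bop"
    and adj: "\<And>x y. x \<in> H \<Longrightarrow> y \<in> H \<Longrightarrow> ip (T x) y = ip x (T' y)"
    and TG: "\<And>g. g \<in> G \<Longrightarrow> T g \<in> clo (span G)" and T'G: "\<And>g. g \<in> G \<Longrightarrow> T' g \<in> clo (span G)"
    and x: "x \<in> H"
  shows "proj (span G) (T x) \<simeq> T (proj (span G) x)"
proof -
  let ?D = "span G"
  have D: "subspace ?D" "?D \<subseteq> H" using span_minimal[OF G H] by auto
  have m: "proj ?D x \<in> H" using proj_clo[OF D x] clo_H by blast
  show ?thesis
  proof (rule proj_unique[OF D])
    show "T (proj ?D x) \<in> clo ?D" by (rule bop_clo_span[OF T G TG proj_clo[OF D x]])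
    fix d assume d: "d \<in> ?D"
    have dH: "d \<in> H" using d D by blast
    have T'd: "T' d \<in> clo ?D" by (rule bop_clo_span[OF T' G T'G]) (use clo_subset[OF D(2)] d in auto)
    have "ip (T x - T (proj ?D x)) d = ip (x - proj ?D x) (T' d)"
      using x m dH bop_H[OF T] bop_H[OF T'] by (simp add: ip_diff adj)
    also have "\<dots> = 0" by (rule proj_orth[OF D x T'd])
    finally show "ip (T x - T (proj ?D x)) d = 0" .
  qed (use x bop_H[OF T] in auto)
qed

end

subsection \<open>Pairs of vectors and the double commutant\<close>

context semi_hilbert
begin

definition scale2 :: "complex \<Rightarrow> 'v \<times> 'v \<Rightarrow> 'v \<times> 'v" where
  "scale2 c p = (c \<odot> fst p, c \<odot> snd p)"

definition ip2 :: "'v \<times> 'v \<Rightarrow> 'v \<times> 'v \<Rightarrow> complex" where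
  "ip2 p q = ip (fst p) (fst q) + ip (snd p) (snd q)"

text \<open>In H + H the equality <S f, g> = <S f', g'> of two coefficients becomes a single
  orthogonality relation, between (S f, S f') and (g, - g').\<close>

lemma semi_hilbert_pairs: "semi_hilbert scale2 (H \<times> H) ip2"
proof -
  interpret v: vector_space scale2
    by unfold_locales (auto simp: scale2_def scale_right_distrib scale_left_distrib)
  interpret s: semi_inner scale2 "H \<times> H" ip2
  proof unfold_locales
    show "v.subspace (H \<times> H)"
      by (rule v.subspaceI) (auto simp: scale2_def zero_prod_def)
    show "ip2 y x = cnj (ip2 x y)" if "x \<in> H \<times> H" "y \<in> H \<times> H" for x y
      using that ip_cnj[of "fst x" "fst y"] ip_cnj[of "snd x" "snd y"] by (auto simp: ip2_def)
  qed (auto simp: ip2_def scale2_def ip_simps ip_nonneg algebra_simps)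
  have n2: "(s.nrm p)\<^sup>2 = (nrm (fst p))\<^sup>2 + (nrm (snd p))\<^sup>2" if "p \<in> H \<times> H" for p
    using that by (auto simp: s.nrm_sq nrm_sq ip2_def)
  have le: "nrm (fst p) \<le> s.nrm p" "nrm (snd p) \<le> s.nrm p" if "p \<in> H \<times> H" for p
    by ((rule power2_le_imp_le; use n2[OF that] s.nrm_nonneg[OF that] in simp)+)
  have ge: "s.nrm p \<le> nrm (fst p) + nrm (snd p)" if "p \<in> H \<times> H" for p
  proof -
    have "(s.nrm p)\<^sup>2 \<le> (nrm (fst p) + nrm (snd p))\<^sup>2" using n2[OF that] that by (auto simp: power2_sum)
    then show ?thesis using that s.nrm_nonneg[OF that] by (auto simp: power2_le_iff_abs_le)
  qed
  show ?thesis
  proof unfold_locales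
    fix X :: "nat \<Rightarrow> 'v \<times> 'v"
    assume X: "\<And>n. X n \<in> H \<times> H" and C: "\<And>e. e > 0 \<Longrightarrow> \<exists>N. \<forall>m\<ge>N. \<forall>n\<ge>N. s.nrm (X m - X n) < e"
    have Xc: "fst (X n) \<in> H" "snd (X n) \<in> H" for n using X[of n] by auto
    have XX: "X m - X n \<in> H \<times> H" for m n using X by (intro s.H_closed)
    have "\<exists>L\<in>H. (\<lambda>n. nrm (fst (X n) - L)) \<longlonglongrightarrow> 0"
    proof (rule complete[OF Xc(1)])
      fix e :: real assume "e > 0"
      from C[OF this] show "\<exists>N. \<forall>m\<ge>N. \<forall>n\<ge>N. nrm (fst (X m) - fst (X n)) < e"
        using le_less_trans[OF le(1)[OF XX]] by (simp, metis)
    qed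
    moreover have "\<exists>L\<in>H. (\<lambda>n. nrm (snd (X n) - L)) \<longlonglongrightarrow> 0"
    proof (rule complete[OF Xc(2)])
      fix e :: real assume "e > 0"
      from C[OF this] show "\<exists>N. \<forall>m\<ge>N. \<forall>n\<ge>N. nrm (snd (X m) - snd (X n)) < e"
        using le_less_trans[OF le(2)[OF XX]] by (simp, metis)
    qed
    ultimately obtain L L' where L: "L \<in> H" "L' \<in> H"
      "(\<lambda>n. nrm (fst (X n) - L)) \<longlonglongrightarrow> 0" "(\<lambda>n. nrm (snd (X n) - L')) \<longlonglongrightarrow> 0" by blast
    have XL: "X n - (L, L') \<in> H \<times> H" for n using X L by (intro s.H_closed) (auto simp: mem_Times_iff)
    have "(\<lambda>n. nrm (fst (X n) - L) + nrm (snd (X n) - L')) \<longlonglongrightarrow> 0 + 0"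
      by (intro tendsto_add L)
    then have "(\<lambda>n. s.nrm (X n - (L, L'))) \<longlonglongrightarrow> 0"
      by (intro Lim_null_comparison[of "\<lambda>n. s.nrm (X n - (L, L'))", OF always_eventually])
        (use ge[OF XL] s.nrm_nonneg[OF XL] in auto)
    then show "\<exists>L\<in>H \<times> H. (\<lambda>n. s.nrm (X n - L)) \<longlonglongrightarrow> 0" using L by blast
  qed
qed

text \<open>\<open>T\<close> commutes with the matrix entries of the projection of \<open>H \<oplus> H\<close> onto the cyclic subspace
  generated by \<open>(f, f')\<close>; hence \<open>(T f, T f')\<close> lies in that subspace.\<close>

lemma double_commutant_ip_eq:
  assumes U: "\<U> \<subseteq> bop" and Uid: "(\<lambda>x. x) \<in> \<U>"
    and Ucomp: "\<And>S T. S \<in> \<U> \<Longrightarrow> T \<in> \<U> \<Longrightarrow> S \<circ> T \<in> \<U>"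
    and Uadj: "\<And>S. S \<in> \<U> \<Longrightarrow> \<exists>S'\<in>\<U>. \<forall>x\<in>H. \<forall>y\<in>H. ip (S x) y = ip x (S' y)"
    and T: "T \<in> comm (comm \<U>)"
    and f: "f \<in> H" "f' \<in> H" and g: "g \<in> H" "g' \<in> H"
    and eq: "\<And>S. S \<in> \<U> \<Longrightarrow> ip (S f) g = ip (S f') g'"
  shows "ip (T f) g = ip (T f') g'"
proof -
  interpret p: semi_hilbert scale2 "H \<times> H" ip2 by (rule semi_hilbert_pairs)
  have n2: "(p.nrm q)\<^sup>2 = (nrm (fst q))\<^sup>2 + (nrm (snd q))\<^sup>2" if "q \<in> H \<times> H" for q
    using that by (auto simp: p.nrm_sq nrm_sq ip2_def)
  have le2: "nrm (fst q) \<le> p.nrm q" "nrm (snd q) \<le> p.nrm q" if "q \<in> H \<times> H" for q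
    by ((rule power2_le_imp_le; use n2[OF that] p.nrm_nonneg[OF that] in simp)+)
  have eqv2: "p.eqv q r \<longleftrightarrow> fst q \<simeq> fst r \<and> snd q \<simeq> snd r" if "q \<in> H \<times> H" "r \<in> H \<times> H" for q r
    using n2[OF p.H_closed(3)[OF that]] by (auto simp: p.eqv_def eqv_def)
  have bop2: "(\<lambda>q. (S (fst q), S (snd q))) \<in> p.bop" if S: "S \<in> bop" for S
  proof -
    obtain C where C: "C > 0" "\<And>x. x \<in> H \<Longrightarrow> nrm (S x) \<le> C * nrm x" using bop_bound[OF S] by blast
    have "p.nrm (S (fst q), S (snd q)) \<le> C * p.nrm q" if q: "q \<in> H \<times> H" for q
    proof -
      have "(p.nrm (S (fst q), S (snd q)))\<^sup>2 = (nrm (S (fst q)))\<^sup>2 + (nrm (S (snd q)))\<^sup>2"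
        using q bop_H[OF S] n2[of "(S (fst q), S (snd q))"] by (simp add: mem_Times_iff)
      also have "\<dots> \<le> (C * nrm (fst q))\<^sup>2 + (C * nrm (snd q))\<^sup>2"
      proof (intro add_mono power_mono)
        show "nrm (S (fst q)) \<le> C * nrm (fst q)" "nrm (S (snd q)) \<le> C * nrm (snd q)"
          using q by (auto intro: C(2))
        show "0 \<le> nrm (S (fst q))" "0 \<le> nrm (S (snd q))"
          using q by (simp_all add: bop_H[OF S] mem_Times_iff)
      qed
      also have "\<dots> = (C * p.nrm q)\<^sup>2" using n2[OF q] by (simp add: power_mult_distrib algebra_simps)
      finally show ?thesis
        by (rule power2_le_imp_le) (use C(1) p.nrm_nonneg[OF q] in simp)
    qed
    then have "\<exists>C. \<forall>q\<in>H \<times> H. p.nrm (S (fst q), S (snd q)) \<le> C * p.nrm q" by blast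
    moreover have "p.eqv (S (fst (q + r)), S (snd (q + r))) ((S (fst q), S (snd q)) + (S (fst r), S (snd r)))"
      if "q \<in> H \<times> H" "r \<in> H \<times> H" for q r
      by (subst eqv2) (use that bop_H[OF S] bop_add[OF S] in auto)
    moreover have "p.eqv (S (fst (scale2 c q)), S (snd (scale2 c q))) (scale2 c (S (fst q), S (snd q)))"
      if "q \<in> H \<times> H" for q c
      by (subst eqv2) (use that bop_H[OF S] bop_scale[OF S] in \<open>auto simp: scale2_def\<close>)
    ultimately show ?thesis using bop_H[OF S] by (auto simp: p.bop_def)
  qed
  \<comment> \<open>The orbit of (f, f') under the diagonal action of \<U>; by \<open>Uid\<close> it
    contains (f, f').\<close>
  define G where "G = (\<lambda>S. (S f, S f')) ` \<U>"
  have G: "G \<subseteq> H \<times> H" using f U bop_H by (auto simp: G_def)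
  define D where "D = p.span G"
  have D: "p.subspace D" "D \<subseteq> H \<times> H"
    unfolding D_def using p.span_minimal[OF G p.H] by auto
  define P where "P = p.proj D"
  have Pb: "P \<in> p.bop" unfolding P_def by (rule p.proj_bop[OF D])
  have PH: "fst (P q) \<in> H" "snd (P q) \<in> H" if "q \<in> H \<times> H" for q
    using p.bop_H[OF Pb that] by auto
  have Scl: "(S (fst q), S (snd q)) \<in> p.clo D" if S: "S \<in> \<U>" and q: "q \<in> G" for S q
  proof -
    obtain R where "R \<in> \<U>" "q = (R f, R f')" using q by (auto simp: G_def)
    then have "(S (fst q), S (snd q)) \<in> G"
      using Ucomp[OF S, of R] by (auto simp: G_def intro!: image_eqI[of _ _ "S \<circ> R"])
    then show ?thesis using p.clo_subset[OF D(2)] p.span_base[of _ G] by (auto simp: D_def)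
  qed
  have Pcomm: "p.eqv (P (S (fst q), S (snd q))) (S (fst (P q)), S (snd (P q)))"
    if S: "S \<in> \<U>" and q: "q \<in> H \<times> H" for S q
  proof -
    obtain S' where S': "S' \<in> \<U>" "\<And>x y. x \<in> H \<Longrightarrow> y \<in> H \<Longrightarrow> ip (S x) y = ip x (S' y)"
      using Uadj[OF S] by blast
    show ?thesis unfolding P_def D_def
      by (rule p.proj_commute[where T = "\<lambda>q. (S (fst q), S (snd q))"
            and T' = "\<lambda>q. (S' (fst q), S' (snd q))", OF G])
        (use S S' U q Scl in \<open>auto simp: ip2_def D_def intro!: bop2\<close>)
  qed
  \<comment> \<open>The columns of the 2 x 2 operator matrix of P. The entries
    \<open>fst (A q x)\<close> and \<open>snd (A q x)\<close> turn out to lie in the commutant of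
    \<U>, so T commutes with each of them.\<close>
  define A where "A q x = P (if q then (x, 0) else (0, x))" for q x
  have AH: "fst (A q x) \<in> H" "snd (A q x) \<in> H" if "x \<in> H" for q x
    using PH that by (auto simp: A_def)
  have Abop: "(\<lambda>x. fst (A q x)) \<in> bop" "(\<lambda>x. snd (A q x)) \<in> bop" for q
  proof -
    let ?i = "\<lambda>x. if q then (x, 0) else (0, x)"
    have iH: "?i x \<in> H \<times> H" if "x \<in> H" for x using that by auto
    obtain C where C: "C > 0" "\<And>r. r \<in> H \<times> H \<Longrightarrow> p.nrm (P r) \<le> C * p.nrm r" using p.bop_bound[OF Pb] by blast
    have ni: "p.nrm (?i x) = nrm x" if "x \<in> H" for x
      using n2[OF iH[OF that]] that p.nrm_nonneg[OF iH[OF that]] by (auto split: if_splits)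
    have le: "nrm (fst (A q x)) \<le> C * nrm x \<and> nrm (snd (A q x)) \<le> C * nrm x" if "x \<in> H" for x
    proof -
      have "P (?i x) \<in> H \<times> H" using p.bop_H[OF Pb iH[OF that]] .
      from le2[OF this] show ?thesis
        using C(2)[OF iH[OF that]] unfolding ni[OF that] A_def by linarith
    qed
    have mem: "A q x \<in> H \<times> H" if "x \<in> H" for x using AH[OF that] by (simp add: mem_Times_iff)
    have add: "fst (A q (x + y)) \<simeq> fst (A q x) + fst (A q y) \<and> snd (A q (x + y)) \<simeq> snd (A q x) + snd (A q y)"
      if "x \<in> H" "y \<in> H" for x y
    proof -
      have "?i x + ?i y = ?i (x + y)" by simp
      then have "p.eqv (A q (x + y)) (A q x + A q y)"
        using p.bop_add[OF Pb iH[OF that(1)] iH[OF that(2)]] by (simp only: A_def)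
      then show ?thesis
        using eqv2[OF mem[OF H_closed(2)[OF that]] p.H_closed(2)[OF mem[OF that(1)] mem[OF that(2)]]] by simp
    qed
    have sc: "fst (A q (c \<odot> x)) \<simeq> c \<odot> fst (A q x) \<and> snd (A q (c \<odot> x)) \<simeq> c \<odot> snd (A q x)"
      if "x \<in> H" for x c
    proof -
      have "scale2 c (?i x) = ?i (c \<odot> x)" by (simp add: scale2_def)
      then have "p.eqv (A q (c \<odot> x)) (scale2 c (A q x))"
        using p.bop_scale[OF Pb iH[OF that], of c] by (simp only: A_def)
      then show ?thesis
        using eqv2[OF mem[OF H_closed(4)[OF that]] p.H_closed(4)[OF mem[OF that]]] by (simp add: scale2_def)
    qed
    show "(\<lambda>x. fst (A q x)) \<in> bop" "(\<lambda>x. snd (A q x)) \<in> bop"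
      unfolding bop_def mem_Collect_eq using AH[of _ q] le add sc by blast+
  qed
  have Acomm: "fst (A q (S x)) \<simeq> S (fst (A q x)) \<and> snd (A q (S x)) \<simeq> S (snd (A q x))"
    if S: "S \<in> \<U>" and x: "x \<in> H" for q S x
  proof -
    let ?i = "\<lambda>x. if q then (x, 0) else (0, x)"
    have iH: "?i x \<in> H \<times> H" if "x \<in> H" for x using that by auto
    have Sb: "S \<in> bop" using S U by blast
    have SH: "S x \<in> H" "S 0 \<in> H" using bop_H[OF Sb] x by auto
    have Si: "(S (fst (?i x)), S (snd (?i x))) \<in> H \<times> H" using bop_H[OF Sb] x by auto
    have "p.eqv (?i (S x)) (S (fst (?i x)), S (snd (?i x)))"
      by (subst eqv2) (use SH Si eqv_sym[OF _ _ bop_zero[OF Sb]] in auto)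
    then have "p.eqv (P (?i (S x))) (P (S (fst (?i x)), S (snd (?i x))))"
      by (intro p.bop_eqv[OF Pb] iH SH Si)
    then have "p.eqv (P (?i (S x))) (S (fst (P (?i x))), S (snd (P (?i x))))"
      by (rule p.eqv_trans[OF _ _ _ _ Pcomm[OF S iH[OF x]], rotated 3])
        (use p.bop_H[OF Pb] iH SH x Si PH[OF iH[OF x]] bop_H[OF Sb] in auto)
    then show ?thesis
      using eqv2[OF p.bop_H[OF Pb iH[OF SH(1)]]] PH[OF iH[OF x]] bop_H[OF Sb] by (auto simp: A_def)
  qed
  have "(\<lambda>x. fst (A q x)) \<in> comm \<U>" "(\<lambda>x. snd (A q x)) \<in> comm \<U>" for q
    using Abop Acomm by (auto simp: comm_def)
  note Ac = this
  have Tc: "T (S x) \<simeq> S (T x)" if "S \<in> comm \<U>" "x \<in> H" for S x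
    using T that unfolding comm_def[of "comm \<U>"] by blast
  have TA: "T (fst (A q x)) \<simeq> fst (A q (T x))" "T (snd (A q x)) \<simeq> snd (A q (T x))" if "x \<in> H" for q x
    using Tc[OF Ac(1) that] Tc[OF Ac(2) that] by simp_all
  have Tb: "T \<in> bop" using comm_bop[OF T] .
  note TH = bop_H[OF Tb]
  have split: "p.eqv (P (a, b)) (A True a + A False b)" if "a \<in> H" "b \<in> H" for a b
    using p.bop_add[OF Pb, of "(a, 0)" "(0, b)"] that by (auto simp: A_def)
  have mem: "A q x \<in> H \<times> H" if "x \<in> H" for q x using AH[OF that] by (simp add: mem_Times_iff)
  have "(f, f') \<in> G" using Uid by (auto simp: G_def)
  then have "(f, f') \<in> p.clo D" using p.clo_subset[OF D(2)] p.span_base[of _ G] by (auto simp: D_def)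
  then have fix1: "p.eqv (P (f, f')) (f, f')" unfolding P_def by (rule p.proj_fix[OF D])
  have "p.eqv (A True f + A False f') (f, f')"
    by (rule p.eqv_trans[OF _ _ _ p.eqv_sym[OF _ _ split] fix1])
      (use f mem p.bop_H[OF Pb] in \<open>auto simp del: plus_prod_def intro!: p.H_closed(2)\<close>)
  then have ff: "fst (A True f) + fst (A False f') \<simeq> f" "snd (A True f) + snd (A False f') \<simeq> f'"
    using eqv2[OF p.H_closed(2)[OF mem[OF f(1)] mem[OF f(2)]], of "(f, f')"] f by auto
  \<comment> \<open>The row selected by r of the equation P (f, f') = (f, f'), with T moved through
    both entries.\<close>
  have step: "r (A True (T f)) + r (A False (T f')) \<simeq> T z"
    if r: "\<And>q x. x \<in> H \<Longrightarrow> T (r (A q x)) \<simeq> r (A q (T x))" "\<And>q x. x \<in> H \<Longrightarrow> r (A q x) \<in> H"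
      and z: "r (A True f) + r (A False f') \<simeq> z" "z \<in> H" for r z
  proof -
    have m: "r (A True f) \<in> H" "r (A False f') \<in> H" "r (A True (T f)) \<in> H" "r (A False (T f')) \<in> H"
      using r(2) f TH by auto
    have "T (r (A True f) + r (A False f')) \<simeq> T (r (A True f)) + T (r (A False f'))"
      by (rule bop_add[OF Tb m(1,2)])
    moreover have "T (r (A True f)) + T (r (A False f')) \<simeq> r (A True (T f)) + r (A False (T f'))"
      by (intro eqv_add r f TH m)
    moreover have "T (r (A True f) + r (A False f')) \<simeq> T z"
      by (intro bop_eqv[OF Tb] z H_closed m)
    ultimately show ?thesis
      by (smt (verit) H_closed(2) TH eqv_sym eqv_trans m z(2))
  qed
  have Tff: "fst (A True (T f)) + fst (A False (T f')) \<simeq> T f" "snd (A True (T f)) + snd (A False (T f')) \<simeq> T f'"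
    using step[where r = fst, OF TA(1) AH(1) ff(1) f(1)] step[where r = snd, OF TA(2) AH(2) ff(2) f(2)]
    by auto
  have "p.eqv (P (T f, T f')) (T f, T f')"
    by (rule p.eqv_trans[OF _ _ _ split])
      (use f TH mem p.bop_H[OF Pb] Tff in \<open>auto simp: eqv2 intro!: p.H_closed(2)\<close>)
  then have Tclo: "(T f, T f') \<in> p.clo D"
    by (intro p.clo_eqv[OF D(2) p.proj_clo[OF D]]) (use f TH in \<open>auto simp: P_def\<close>)
  \<comment> \<open>The hypothesis \<open>eq\<close> says that (g, - g') is orthogonal to the orbit,
    hence to its closed span, which contains (T f, T f').\<close>
  have "ip2 (g, - g') d = 0" if "d \<in> D" for d
  proof -
    have "d \<in> H \<times> H \<and> ip2 (g, - g') d = 0"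
      using that unfolding D_def
    proof (induction rule: p.span_induct_alt)
      case base
      then show ?case using g by (auto simp: ip2_def ip_simps zero_prod_def)
    next
      case (step c x y)
      obtain S where S: "S \<in> \<U>" "x = (S f, S f')" using step by (auto simp: G_def)
      have SfH: "S f \<in> H" "S f' \<in> H" using S U f bop_H by auto
      have "ip g (S f) = ip g' (S f')"
        using eq[OF S(1)] ip_cnj[OF SfH(1) g(1)] ip_cnj[OF SfH(2) g(2)] by simp
      then show ?case using step SfH g by (auto simp: S ip2_def scale2_def ip_simps)
    qed
    then show ?thesis by simp
  qed
  from p.ip_clo[OF D(2) _ this Tclo] have "ip g (T f) = ip g' (T f')"
    using g f TH by (auto simp: ip2_def ip_simps)
  then show ?thesis
    using ip_cnj[of g "T f"] ip_cnj[of g' "T f'"] f g TH by simp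
qed

end

section \<open>The Hilbert space \<open>L\<^sub>2\<close>\<close>

definition fscale :: "complex \<Rightarrow> ('a \<Rightarrow> complex) \<Rightarrow> 'a \<Rightarrow> complex" where
  "fscale c f = (\<lambda>x. c * f x)"

lemma fscale_apply [simp]: "fscale c f x = c * f x"
  by (simp add: fscale_def)

interpretation fs: vector_space fscale
  by unfold_locales (auto simp: fun_eq_iff algebra_simps)

lemma sum_fun_apply: "sum F A x = (\<Sum>i\<in>A. F i x)" for F :: "'i \<Rightarrow> 'a \<Rightarrow> complex"
  by (induction A rule: infinite_finite_induct) auto

lemma l2_measurable: "f \<in> l2 M \<Longrightarrow> f \<in> borel_measurable M"
  by (simp add: l2_def)

lemma l2_integrable: "f \<in> l2 M \<Longrightarrow> integrable M (\<lambda>x. (cmod (f x))\<^sup>2)"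
  by (simp add: l2_def)

lemma borel_measurable_cnj [measurable]:
  "f \<in> borel_measurable M \<Longrightarrow> (\<lambda>x. cnj (f x)) \<in> borel_measurable M"
  by (rule measurable_compose[OF _ borel_measurable_continuous_onI]) (auto intro: continuous_intros)

lemma l2I_nn:
  assumes [measurable]: "f \<in> borel_measurable M" and le: "(\<integral>\<^sup>+x. ennreal ((cmod (f x))\<^sup>2) \<partial>M) \<le> ennreal K" and K: "0 \<le> K"
  shows "f \<in> l2 M" and "(l2_norm M f)\<^sup>2 \<le> K"
proof -
  have int: "integrable M (\<lambda>x. (cmod (f x))\<^sup>2)"
    using le by (intro integrableI_nonneg) (auto simp: le_less_trans[OF le])
  then show "f \<in> l2 M" by (simp add: l2_def)
  have "(l2_norm M f)\<^sup>2 = (\<integral>x. (cmod (f x))\<^sup>2 \<partial>M)" by (simp add: l2_norm_def)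
  also have "ennreal \<dots> = (\<integral>\<^sup>+x. ennreal ((cmod (f x))\<^sup>2) \<partial>M)" by (simp add: nn_integral_eq_integral[OF int])
  finally show "(l2_norm M f)\<^sup>2 \<le> K" using le K by (metis ennreal_le_iff)
qed

lemma nn_integral_l2: "f \<in> l2 M \<Longrightarrow> (\<integral>\<^sup>+x. ennreal ((cmod (f x))\<^sup>2) \<partial>M) = ennreal ((l2_norm M f)\<^sup>2)"
  by (simp add: l2_norm_def nn_integral_eq_integral[OF l2_integrable])

lemma l2_prod_integrable:
  assumes f: "f \<in> l2 M" and g: "g \<in> l2 M" shows "integrable M (\<lambda>x. f x * cnj (g x))"
proof (rule Bochner_Integration.integrable_bound)
  show "integrable M (\<lambda>x. (cmod (f x))\<^sup>2 + (cmod (g x))\<^sup>2)"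
    by (intro Bochner_Integration.integrable_add l2_integrable f g)
  show "(\<lambda>x. f x * cnj (g x)) \<in> borel_measurable M"
    using l2_measurable[OF f] l2_measurable[OF g] by (intro borel_measurable_times borel_measurable_cnj)
  have "cmod (f x) * cmod (g x) \<le> (cmod (f x))\<^sup>2 + (cmod (g x))\<^sup>2" for x
    using sum_squares_bound[of "cmod (f x)" "cmod (g x)"]
      mult_nonneg_nonneg[OF norm_ge_zero[of "f x"] norm_ge_zero[of "g x"]] by linarith
  then show "AE x in M. norm (f x * cnj (g x)) \<le> norm ((cmod (f x))\<^sup>2 + (cmod (g x))\<^sup>2)"
    by (auto simp: norm_mult intro!: AE_I2 order_trans[OF _ abs_ge_self])
qed

lemma l2_zero: "0 \<in> l2 M"
  by (simp add: l2_def zero_fun_def)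

lemma l2_add: assumes f: "f \<in> l2 M" and g: "g \<in> l2 M" shows "f + g \<in> l2 M"
proof -
  have "integrable M (\<lambda>x. (cmod (f x + g x))\<^sup>2)"
  proof (rule Bochner_Integration.integrable_bound)
    show "integrable M (\<lambda>x. 2 * (cmod (f x))\<^sup>2 + 2 * (cmod (g x))\<^sup>2)"
      by (intro Bochner_Integration.integrable_add integrable_mult_right l2_integrable f g)
    show "(\<lambda>x. (cmod (f x + g x))\<^sup>2) \<in> borel_measurable M"
      using l2_measurable[OF f] l2_measurable[OF g] by measurable
    have "(cmod (f x + g x))\<^sup>2 \<le> 2 * (cmod (f x))\<^sup>2 + 2 * (cmod (g x))\<^sup>2" for x
    proof -
      have "(cmod (f x + g x))\<^sup>2 \<le> (cmod (f x) + cmod (g x))\<^sup>2"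
        by (intro power_mono norm_triangle_ineq) auto
      then show ?thesis using sum_squares_bound[of "cmod (f x)" "cmod (g x)"] by (simp add: power2_sum)
    qed
    then show "AE x in M. norm ((cmod (f x + g x))\<^sup>2) \<le> norm (2 * (cmod (f x))\<^sup>2 + 2 * (cmod (g x))\<^sup>2)"
      by auto
  qed
  then show ?thesis using l2_measurable[OF f] l2_measurable[OF g] by (simp add: l2_def plus_fun_def)
qed

lemma l2_fscale: assumes f: "f \<in> l2 M" shows "fscale c f \<in> l2 M"
  using f by (auto simp: l2_def fscale_def norm_mult power_mult_distrib)

lemma l2_self: "l2_inner M f f = of_real ((l2_norm M f)\<^sup>2)"
proof -
  have "l2_inner M f f = (\<integral>x. complex_of_real ((cmod (f x))\<^sup>2) \<partial>M)"
    unfolding l2_inner_def by (simp only: complex_norm_square)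
  also have "\<dots> = of_real (\<integral>x. (cmod (f x))\<^sup>2 \<partial>M)" by (rule integral_complex_of_real)
  finally show ?thesis by (simp add: l2_norm_def)
qed

lemma semi_inner_l2: "semi_inner fscale (l2 M) (l2_inner M)"
proof unfold_locales
  show "fs.subspace (l2 M)" by (intro fs.subspaceI l2_zero l2_add l2_fscale)
next
  fix f g h assume "f \<in> l2 M" "g \<in> l2 M" "h \<in> l2 M"
  then show "l2_inner M (f + g) h = l2_inner M f h + l2_inner M g h"
    by (simp add: l2_inner_def distrib_right l2_prod_integrable)
next
  fix f g c show "l2_inner M (fscale c f) g = c * l2_inner M f g"
    by (simp add: l2_inner_def mult.assoc)
next
  fix f g show "l2_inner M g f = cnj (l2_inner M f g)"
    unfolding l2_inner_def by (subst Bochner_Integration.integral_cnj[symmetric]) (simp add: mult.commute)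
next
  fix f show "0 \<le> Re (l2_inner M f f)" by (simp add: l2_self)
qed

lemma nrm_l2: "semi_inner.nrm (l2_inner M) = l2_norm M"
proof
  show "semi_inner.nrm (l2_inner M) f = l2_norm M f" for f
    unfolding semi_inner.nrm_def[OF semi_inner_l2] l2_self by (simp add: l2_norm_def)
qed

text \<open>Riesz-Fischer. Along a subsequence whose increments D k have squared norm at most
  4^(-k), the sum of 2^k |D k x|^2 has finite integral. So at almost every x the increments are
  O(2^(-k/2)) and the subsequence converges; Fatou's lemma turns the pointwise limit into a limit in
  norm.\<close>

lemma l2_complete:
  assumes X: "\<And>n. X n \<in> l2 M"
    and Cau: "\<And>e. e > 0 \<Longrightarrow> \<exists>N. \<forall>m\<ge>N. \<forall>n\<ge>N. l2_norm M (X m - X n) < e"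
  shows "\<exists>L\<in>l2 M. (\<lambda>n::nat. l2_norm M (X n - L)) \<longlonglongrightarrow> 0"
proof -
  interpret semi_inner fscale "l2 M" "l2_inner M" by (rule semi_inner_l2)
  note [measurable] = l2_measurable[OF X]
  have "\<exists>N. \<forall>m\<ge>N. \<forall>n\<ge>N. l2_norm M (X m - X n) < (1/2) ^ k" for k using Cau[of "(1/2) ^ k"] by simp
  then obtain N where N: "\<And>k m n. m \<ge> N k \<Longrightarrow> n \<ge> N k \<Longrightarrow> l2_norm M (X m - X n) < (1/2) ^ k" by metis
  \<comment> \<open>The sum makes r k at least N j for every j \<le> k, although N need not be
    monotone.\<close>
  define r where "r k = (\<Sum>j\<le>k. N j) + k" for k
  have rN: "N j \<le> r k" if "j \<le> k" for j k
    using member_le_sum[of j "{..k}" N] that by (simp add: r_def)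
  define D where "D k = X (r (Suc k)) - X (r k)" for k
  have Dl2: "D k \<in> l2 M" for k unfolding D_def by (intro H_closed X)
  have Dn: "(l2_norm M (D k))\<^sup>2 \<le> (1/4) ^ k" for k
  proof -
    have "l2_norm M (D k) < (1/2) ^ k" unfolding D_def by (intro N rN) auto
    then have "(l2_norm M (D k))\<^sup>2 \<le> ((1/2) ^ k)\<^sup>2" by (intro power_mono) (auto simp: l2_norm_def)
    also have "\<dots> = (1/4) ^ k" by (simp add: power2_eq_square power_mult_distrib[symmetric])
    finally show ?thesis .
  qed
  note [measurable] = l2_measurable[OF Dl2]
  have "(\<integral>\<^sup>+x. (\<Sum>k. ennreal (2 ^ k * (cmod (D k x))\<^sup>2)) \<partial>M) = (\<Sum>k. \<integral>\<^sup>+x. ennreal (2 ^ k * (cmod (D k x))\<^sup>2) \<partial>M)"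
    by (rule nn_integral_suminf) measurable
  also have "\<dots> \<le> (\<Sum>k. ennreal ((1/2) ^ k))"
  proof (intro suminf_le summableI)
    fix k
    have "(\<integral>\<^sup>+x. ennreal (2 ^ k * (cmod (D k x))\<^sup>2) \<partial>M) = ennreal (2 ^ k) * ennreal ((l2_norm M (D k))\<^sup>2)"
      by (simp add: ennreal_mult nn_integral_cmult nn_integral_l2[OF Dl2])
    also have "\<dots> = ennreal (2 ^ k * (l2_norm M (D k))\<^sup>2)" by (simp add: ennreal_mult)
    also have "\<dots> \<le> ennreal (2 ^ k * (1/4) ^ k)" by (intro ennreal_leI mult_left_mono Dn) auto
    also have "2 ^ k * (1/4::real) ^ k = (1/2) ^ k" by (simp add: power_mult_distrib[symmetric])
    finally show "(\<integral>\<^sup>+x. ennreal (2 ^ k * (cmod (D k x))\<^sup>2) \<partial>M) \<le> ennreal ((1/2) ^ k)" .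
  qed
  also have "\<dots> < \<infinity>" by (subst suminf_ennreal2) (auto intro: summable_geometric)
  finally have fin: "(\<integral>\<^sup>+x. (\<Sum>k. ennreal (2 ^ k * (cmod (D k x))\<^sup>2)) \<partial>M) < \<infinity>" .
  have "(\<lambda>x. \<Sum>k. ennreal (2 ^ k * (cmod (D k x))\<^sup>2)) \<in> borel_measurable M" by measurable
  then have "AE x in M. (\<Sum>k. ennreal (2 ^ k * (cmod (D k x))\<^sup>2)) \<noteq> \<infinity>"
    by (rule nn_integral_PInf_AE) (use fin in simp)
  then have conv: "AE x in M. convergent (\<lambda>k. X (r k) x)"
  proof (rule AE_mp, intro AE_I2 impI)
    fix x assume fin: "(\<Sum>k. ennreal (2 ^ k * (cmod (D k x))\<^sup>2)) \<noteq> \<infinity>"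
    define C where "C = enn2real (\<Sum>k. ennreal (2 ^ k * (cmod (D k x))\<^sup>2))"
    have bd: "2 ^ k * (cmod (D k x))\<^sup>2 \<le> C" for k
    proof -
      have "(\<Sum>j\<in>{k}. ennreal (2 ^ j * (cmod (D j x))\<^sup>2)) \<le> (\<Sum>k. ennreal (2 ^ k * (cmod (D k x))\<^sup>2))"
        by (rule sum_le_suminf) auto
      also have "\<dots> = ennreal C" using fin by (simp add: C_def less_top)
      finally show ?thesis by (simp add: C_def ennreal_le_iff)
    qed
    have C0: "0 \<le> C" by (simp add: C_def)
    have "cmod (D k x) \<le> sqrt C * (sqrt (1/2)) ^ k" for k
    proof (rule power2_le_imp_le)
      have "(sqrt C * sqrt (1/2) ^ k)\<^sup>2 = C * (1/2) ^ k"
        using C0 by (simp add: power_mult_distrib power_mult[symmetric] mult.commute[of k 2])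
          (simp add: power_mult)
      moreover have "(cmod (D k x))\<^sup>2 \<le> C * (1/2) ^ k"
        using bd[of k] by (simp add: field_simps power_one_over)
      ultimately show "(cmod (D k x))\<^sup>2 \<le> (sqrt C * sqrt (1/2) ^ k)\<^sup>2" by simp
    qed (use C0 in auto)
    moreover have "summable (\<lambda>k. sqrt C * (sqrt (1/2)) ^ k)"
      by (intro summable_mult summable_geometric) (simp add: real_sqrt_divide)
    ultimately have "summable (\<lambda>k. D k x)"
      using summable_comparison_test'[of "\<lambda>k. sqrt C * (sqrt (1/2)) ^ k" 0 "\<lambda>k. D k x"] by blast
    then have "convergent (\<lambda>n. \<Sum>k<n. D k x)" by (simp add: summable_iff_convergent)
    moreover have "(\<Sum>k<n. D k x) = X (r n) x - X (r 0) x" for n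
      unfolding D_def using sum_lessThan_telescope[of "\<lambda>k. X (r k) x" n] by simp
    ultimately have "convergent (\<lambda>n. X (r n) x - X (r 0) x)" by simp
    then show "convergent (\<lambda>k. X (r k) x)"
      using convergent_diff_const_right_iff[of "\<lambda>n. X (r n) x" "X (r 0) x"] by simp
  qed
  \<comment> \<open>\<open>lim\<close> has an unspecified value where the subsequence diverges,
    which happens on a null set.\<close>
  define L where "L x = lim (\<lambda>k. X (r k) x)" for x
  have Lm [measurable]: "L \<in> borel_measurable M" unfolding L_def by measurable
  have bound: "X m - L \<in> l2 M \<and> (l2_norm M (X m - L))\<^sup>2 \<le> (1/4) ^ k" if m: "m \<ge> N k" for m k
  proof -
    have "(\<integral>\<^sup>+x. ennreal ((cmod ((X m - L) x))\<^sup>2) \<partial>M) \<le> (\<integral>\<^sup>+x. liminf (\<lambda>j. ennreal ((cmod (X m x - X (r j) x))\<^sup>2)) \<partial>M)"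
    proof (rule nn_integral_mono_AE, rule AE_mp[OF conv], intro AE_I2 impI)
      fix x assume "convergent (\<lambda>k. X (r k) x)"
      then have "(\<lambda>k. X (r k) x) \<longlonglongrightarrow> L x" by (simp add: L_def convergent_LIMSEQ_iff)
      then have "(\<lambda>j. ennreal ((cmod (X m x - X (r j) x))\<^sup>2)) \<longlonglongrightarrow> ennreal ((cmod (X m x - L x))\<^sup>2)"
        by (intro tendsto_intros)
      from lim_imp_Liminf[OF _ this]
      show "ennreal ((cmod ((X m - L) x))\<^sup>2) \<le> liminf (\<lambda>j. ennreal ((cmod (X m x - X (r j) x))\<^sup>2))"
        by (simp only: minus_apply) simp
    qed
    also have "\<dots> \<le> liminf (\<lambda>j. \<integral>\<^sup>+x. ennreal ((cmod (X m x - X (r j) x))\<^sup>2) \<partial>M)"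
      by (rule nn_integral_liminf) measurable
    also have "\<dots> \<le> limsup (\<lambda>j. \<integral>\<^sup>+x. ennreal ((cmod (X m x - X (r j) x))\<^sup>2) \<partial>M)"
      by (rule Liminf_le_Limsup) simp
    also have "\<dots> \<le> ennreal ((1/4) ^ k)"
    proof (rule Limsup_bounded, rule eventually_sequentiallyI[of k])
      fix j assume "k \<le> j"
      have "l2_norm M (X m - X (r j)) < (1/2) ^ k" by (intro N m rN \<open>k \<le> j\<close>)
      then have "(l2_norm M (X m - X (r j)))\<^sup>2 \<le> ((1/2) ^ k)\<^sup>2" by (intro power_mono) (auto simp: l2_norm_def)
      also have "\<dots> = (1/4) ^ k" by (simp add: power2_eq_square power_mult_distrib[symmetric])
      finally show "(\<integral>\<^sup>+x. ennreal ((cmod (X m x - X (r j) x))\<^sup>2) \<partial>M) \<le> ennreal ((1/4) ^ k)"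
        using nn_integral_l2[of "X m - X (r j)" M] X by (simp add: ennreal_leI)
    qed
    finally have le: "(\<integral>\<^sup>+x. ennreal ((cmod ((X m - L) x))\<^sup>2) \<partial>M) \<le> ennreal ((1/4) ^ k)" .
    have [measurable]: "X m - L \<in> borel_measurable M" by (simp add: fun_diff_def)
    show ?thesis by (intro conjI l2I_nn[OF _ le]) auto
  qed
  have "X (N 0) - (X (N 0) - L) \<in> l2 M" by (rule H_closed(3)[OF X]) (use bound[of 0 "N 0"] in blast)
  moreover have "X (N 0) - (X (N 0) - L) = L" by (simp add: fun_eq_iff)
  ultimately have Ll2: "L \<in> l2 M" by simp
  have "(\<lambda>n. l2_norm M (X n - L)) \<longlonglongrightarrow> 0"
  proof (rule LIMSEQ_I)
    fix e :: real assume "e > 0"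
    then obtain k where k: "(1/2) ^ k < e" using real_arch_pow_inv[of e "1/2"] by auto
    have "l2_norm M (X n - L) \<le> (1/2) ^ k" if "n \<ge> N k" for n
    proof (rule power2_le_imp_le)
      have "((1/2::real) ^ k)\<^sup>2 = (1/4) ^ k" by (simp add: power2_eq_square power_mult_distrib[symmetric])
      then show "(l2_norm M (X n - L))\<^sup>2 \<le> ((1/2) ^ k)\<^sup>2" using bound[OF that] by simp
    qed simp
    then show "\<exists>n0. \<forall>n\<ge>n0. norm (l2_norm M (X n - L) - 0) < e"
      using k by (intro exI[of _ "N k"]) (auto simp: l2_norm_def intro: le_less_trans)
  qed
  then show ?thesis using Ll2 by blast
qed

lemma semi_hilbert_l2: "semi_hilbert fscale (l2 M) (l2_inner M)"
proof -
  show ?thesis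
    by (intro semi_hilbert.intro semi_inner_l2 semi_hilbert_axioms.intro) (unfold nrm_l2, rule l2_complete)
qed

interpretation l2: semi_hilbert fscale "l2 M" "l2_inner M"
  rewrites "semi_inner.nrm (l2_inner M) = l2_norm M" for M :: "'a measure"
  by (rule semi_hilbert_l2, rule nrm_l2)

lemma l2_norm_nonneg: "0 \<le> l2_norm M f"
  by (simp add: l2_norm_def)

lemma l2_norm_eq_0_iff: "f \<in> l2 M \<Longrightarrow> l2_norm M f = 0 \<longleftrightarrow> (AE x in M. f x = 0)"
  using integral_nonneg_eq_0_iff_AE[OF l2_integrable] by (simp add: l2_norm_def)

lemma l2_eqv_iff: "f \<in> l2 M \<Longrightarrow> g \<in> l2 M \<Longrightarrow> l2.eqv M f g \<longleftrightarrow> l2_eq M f g"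
  using l2_norm_eq_0_iff[of "f - g" M] by (simp add: l2.eqv_def l2_eq_def)

lemma bounded_ops_eq: "bounded_ops M = l2.bop M"
proof -
  have "T \<in> bounded_ops M \<longleftrightarrow> T \<in> l2.bop M" for T
  proof (cases "\<forall>f\<in>l2 M. T f \<in> l2 M")
    case True
    then have T: "T f \<in> l2 M" if "f \<in> l2 M" for f using that by blast
    have p: "(\<lambda>x. f x + g x) = f + g" "(\<lambda>x. c * f x) = fscale c f" for f g :: "'a \<Rightarrow> complex" and c
      by (simp_all add: fun_eq_iff)
    show ?thesis
      unfolding bounded_ops_def l2.bop_def p using T by (simp add: l2_eqv_iff)
  qed (auto simp: bounded_ops_def l2.bop_def)
  then show ?thesis by blast
qed

lemma l2_op_eq_iff:
  assumes "\<And>f. f \<in> l2 M \<Longrightarrow> S f \<in> l2 M" "\<And>f. f \<in> l2 M \<Longrightarrow> T f \<in> l2 M"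
  shows "l2_op_eq M S T \<longleftrightarrow> (\<forall>f\<in>l2 M. l2.eqv M (S f) (T f))"
  using assms by (simp add: l2_op_eq_def l2_eqv_iff)

lemma commutant_eq:
  assumes A: "A \<subseteq> l2.bop M" shows "commutant M A = l2.comm M A"
proof -
  have "l2_op_eq M (T \<circ> S) (S \<circ> T) \<longleftrightarrow> (\<forall>f\<in>l2 M. l2.eqv M (T (S f)) (S (T f)))"
    if T: "T \<in> l2.bop M" and S: "S \<in> A" for S T
    using l2.bop_H[OF T] l2.bop_H[of S M] S A by (subst l2_op_eq_iff) auto
  then show ?thesis by (auto simp: commutant_def l2.comm_def bounded_ops_eq)
qed

subsection \<open>Projections onto cyclic subspaces\<close>

context semi_inner
begin

lemma ip_clo_span:
  assumes G: "G \<subseteq> H" and w: "w \<in> H" and orth: "\<And>g. g \<in> G \<Longrightarrow> ip w g = 0" and p: "p \<in> clo (span G)"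
  shows "ip w p = 0"
proof (rule ip_clo[OF span_minimal[OF G H] w _ p])
  fix d assume "d \<in> span G"
  then have "d \<in> H \<and> ip w d = 0"
    by (induction rule: span_induct_alt) (use G w orth in \<open>auto simp: ip_simps\<close>)
  then show "ip w d = 0" by simp
qed

end

context semi_hilbert
begin

definition is_proj :: "('v \<Rightarrow> 'v) \<Rightarrow> bool" where
  "is_proj P \<longleftrightarrow> P \<in> bop \<and> (\<forall>x\<in>H. P (P x) \<simeq> P x) \<and> (\<forall>x\<in>H. \<forall>y\<in>H. ip (P x) y = ip x (P y))"

text \<open>The projection onto the closed span of the vectors T h, T in the commutant. For
  self-adjoint \<U> it is the support, in the double commutant, of the vector state at h.\<close>

definition cyclic_proj :: "('v \<Rightarrow> 'v) set \<Rightarrow> 'v \<Rightarrow> 'v \<Rightarrow> 'v" where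
  "cyclic_proj \<U> h = proj (span ((\<lambda>T. T h) ` comm \<U>))"

context
  fixes \<U> :: "('v \<Rightarrow> 'v) set" and h :: 'v
  assumes U: "\<U> \<subseteq> bop" and Uadj: "\<And>S. S \<in> \<U> \<Longrightarrow> \<exists>S'\<in>\<U>. \<forall>x\<in>H. \<forall>y\<in>H. ip (S x) y = ip x (S' y)"
    and h: "h \<in> H"
begin

lemma cyclic_sub: "(\<lambda>T. T h) ` comm \<U> \<subseteq> H"
  using bop_H[OF comm_bop h] by auto

lemma cyclic_subspace: "subspace (span ((\<lambda>T. T h) ` comm \<U>))" "span ((\<lambda>T. T h) ` comm \<U>) \<subseteq> H"
  using span_minimal[OF cyclic_sub H] by auto

lemma cyclic_proj_clo: "f \<in> H \<Longrightarrow> cyclic_proj \<U> h f \<in> clo (span ((\<lambda>T. T h) ` comm \<U>))"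
  unfolding cyclic_proj_def by (rule proj_clo[OF cyclic_subspace])

lemma cyclic_proj_is_proj: "is_proj (cyclic_proj \<U> h)"
  unfolding is_proj_def cyclic_proj_def
  using proj_bop[OF cyclic_subspace] proj_fix[OF cyclic_subspace proj_clo[OF cyclic_subspace]]
    proj_sym[OF cyclic_subspace] by blast

text \<open>The adjoint W of V is again in \<U> up to equivalence, so S commutes with W; taking
  adjoints gives the relation between S' and V.\<close>

lemma adjoint_in_comm:
  assumes S: "S \<in> comm \<U>" and S': "S' \<in> bop" and adj: "\<And>x y. x \<in> H \<Longrightarrow> y \<in> H \<Longrightarrow> ip (S x) y = ip x (S' y)"
  shows "S' \<in> comm \<U>"
proof -
  have "S' (V x) \<simeq> V (S' x)" if V: "V \<in> \<U>" and x: "x \<in> H" for V x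
  proof (rule eqvI)
    obtain W where W: "W \<in> \<U>" "\<And>x y. x \<in> H \<Longrightarrow> y \<in> H \<Longrightarrow> ip (V x) y = ip x (W y)" using Uadj[OF V] by blast
    have m: "V y \<in> H" "W y \<in> H" "S y \<in> H" "S' y \<in> H" if "y \<in> H" for y
      using that V W U S' bop_H comm_bop[OF S] by blast+
    have W': "ip y (V z) = ip (W y) z" if "y \<in> H" "z \<in> H" for y z
      using ip_cnj[OF m(1)[OF that(2)] that(1)] W(2)[OF that(2,1)] ip_cnj[OF that(2) m(2)[OF that(1)]] by simp
    have S1: "ip (S' y) z = ip y (S z)" if "y \<in> H" "z \<in> H" for y z
      using ip_cnj[OF m(4)[OF that(1)] that(2)] adj[OF that(2,1)] ip_cnj[OF m(3)[OF that(2)] that(1)]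
      by (metis complex_cnj_cnj)
    show "S' (V x) \<in> H" "V (S' x) \<in> H" by (intro m x)+
    fix z assume z: "z \<in> H"
    have "ip (S' (V x)) z = ip (V x) (S z)" by (intro S1 m x z)
    also have "\<dots> = ip x (W (S z))" by (intro W(2) m x z)
    also have "\<dots> = ip x (S (W z))"
      by (rule ip_eqv[OF x x]) (use m z S W(1) eqv_sym in \<open>auto simp: comm_def\<close>)
    also have "\<dots> = ip (S' x) (W z)" by (rule S1[symmetric]) (intro m x z)+
    also have "\<dots> = ip (V (S' x)) z" by (rule W(2)[symmetric]) (intro m x z)+
    finally show "ip (S' (V x)) z = ip (V (S' x)) z" .
  qed
  then show ?thesis using S' by (simp add: comm_def)
qed

text \<open>The cyclic subspace is invariant under \<open>comm \<U>\<close>, a family closed under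
  adjoints, so its projection commutes with that family.\<close>

lemma cyclic_proj_double_comm: "cyclic_proj \<U> h \<in> comm (comm \<U>)"
proof -
  have "cyclic_proj \<U> h (S x) \<simeq> S (cyclic_proj \<U> h x)" if S: "S \<in> comm \<U>" and x: "x \<in> H" for S x
  proof -
    obtain S' where S': "S' \<in> bop" "\<And>x y. x \<in> H \<Longrightarrow> y \<in> H \<Longrightarrow> ip (S x) y = ip x (S' y)"
      using adjoint_exists[OF comm_bop[OF S]] by blast
    have inv: "R g \<in> clo (span ((\<lambda>T. T h) ` comm \<U>))"
      if "R \<in> comm \<U>" and g: "g \<in> (\<lambda>T. T h) ` comm \<U>" for R g
    proof -
      obtain T where T: "T \<in> comm \<U>" "g = T h" using g by blast
      have "R g \<in> (\<lambda>T. T h) ` comm \<U>"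
        using comm_comp[OF U that(1) T(1)] T(2) by (auto intro!: image_eqI[of _ _ "R \<circ> T"])
      then show ?thesis by (intro subsetD[OF clo_subset[OF cyclic_subspace(2)]] span_base)
    qed
    show ?thesis unfolding cyclic_proj_def
      by (rule proj_commute[OF cyclic_sub comm_bop[OF S] S' inv[OF S] inv[OF adjoint_in_comm[OF S S']] x])
  qed
  then show ?thesis using cyclic_proj_is_proj by (simp add: comm_def is_proj_def)
qed

lemma cyclic_proj_self: "cyclic_proj \<U> h h \<simeq> h"
proof -
  have "(\<lambda>x. x) \<in> comm \<U>" by (simp add: comm_def bop_id)
  then have "h \<in> (\<lambda>T. T h) ` comm \<U>" by (auto intro!: image_eqI[of _ _ "\<lambda>x. x"])
  then have "h \<in> clo (span ((\<lambda>T. T h) ` comm \<U>))"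
    by (intro subsetD[OF clo_subset[OF cyclic_subspace(2)]] span_base)
  then show ?thesis unfolding cyclic_proj_def by (rule proj_fix[OF cyclic_subspace])
qed

text \<open>P commutes with every T in \<open>comm \<U>\<close>, so P T h = T P h = T h: the
  generators of the cyclic subspace are fixed by P, and hence its closure.\<close>

lemma cyclic_proj_least:
  assumes P: "P \<in> comm (comm \<U>)" "is_proj P" and Ph: "P h \<simeq> h" and y: "y \<in> clo (span ((\<lambda>T. T h) ` comm \<U>))"
  shows "P y \<simeq> y"
proof (rule eqvI)
  have Pb: "P \<in> bop" using comm_bop[OF P(1)] .
  have yH: "y \<in> H" using clo_H[OF y] .
  show "P y \<in> H" "y \<in> H" using yH bop_H[OF Pb] by auto
  fix z assume z: "z \<in> H"
  have "ip (P z - z) y = 0"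
  proof (rule ip_clo_span[OF cyclic_sub _ _ y])
    fix g assume "g \<in> (\<lambda>T. T h) ` comm \<U>"
    then obtain T where T: "T \<in> comm \<U>" "g = T h" by blast
    have m: "T h \<in> H" "P (T h) \<in> H" "P h \<in> H" "T (P h) \<in> H" "P z \<in> H"
      using bop_H[OF Pb] bop_H[OF comm_bop[OF T(1)]] h z by auto
    have "P (T h) \<simeq> T (P h)" using P(1) T(1) h unfolding comm_def[of "comm \<U>"] by blast
    moreover have "T (P h) \<simeq> T h" by (rule bop_eqv[OF comm_bop[OF T(1)] m(3) h Ph])
    ultimately have "P (T h) \<simeq> T h" using eqv_trans m by blast
    then have "ip z (P (T h)) = ip z (T h)" by (intro ip_eqv z m) auto
    moreover have "ip (P z) (T h) = ip z (P (T h))" using P(2) z m by (simp add: is_proj_def)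
    ultimately show "ip (P z - z) g = 0" using z m T by (simp add: ip_diff)
  qed (use z bop_H[OF Pb] in auto)
  then have "ip (P z) y = ip z y" using z yH bop_H[OF Pb] by (simp add: ip_diff)
  then have "ip z (P y) = ip z y" using P(2) z yH by (simp add: is_proj_def)
  then show "ip (P y) z = ip y z"
    using ip_cnj[of z "P y"] ip_cnj[of z y] z yH bop_H[OF Pb] by simp
qed

end

end

section \<open>The left regular representation\<close>

locale haar_group =
  fixes M :: "'a::{topological_group_add, t2_space} measure"
  assumes haar: "left_haar_measure M"
    and loc_compact: "locally_compact_space (euclidean :: 'a topology)"
begin

lemma sets_M [measurable_cong, simp]: "sets M = sets borel"
  using haar by (simp add: left_haar_measure_def)

lemma space_M [simp]: "space M = UNIV"
  using sets_eq_imp_space_eq[OF sets_M] by simp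

lemma borel_M_iff: "f \<in> borel_measurable M \<longleftrightarrow> f \<in> borel_measurable borel"
  by (intro arg_cong[where f = "\<lambda>S. f \<in> S"] measurable_cong_sets) auto

lemma emeasure_translate: "A \<in> sets borel \<Longrightarrow> emeasure M ((\<lambda>y. x + y) ` A) = emeasure M A"
  using haar by (simp add: left_haar_measure_def)

lemma continuous_translate: "continuous_on UNIV (\<lambda>y::'a. x + y)"
  by (intro continuous_intros)

lemma measurable_translate [measurable]: "(\<lambda>y. x + y) \<in> measurable M M"
proof -
  have "(\<lambda>y. x + y) \<in> borel_measurable borel"
    by (rule borel_measurable_continuous_onI[OF continuous_translate])
  then show ?thesis by (simp add: measurable_cong_sets[OF sets_M sets_M])
qed

lemma translate_image: "(\<lambda>y. x + y) ` A = (\<lambda>y. - x + y) -` A" for x :: 'a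
proof safe
  fix y assume "- x + y \<in> A"
  then have "x + (- x + y) \<in> (\<lambda>y. x + y) ` A" by blast
  then show "y \<in> (\<lambda>y. x + y) ` A" by (simp add: add.assoc[symmetric])
qed (simp add: add.assoc[symmetric])

lemma distr_translate: "distr M M (\<lambda>y. x + y) = M"
proof (rule measure_eqI)
  fix A assume "A \<in> sets (distr M M (\<lambda>y. x + y))"
  then have A: "A \<in> sets borel" by simp
  have "emeasure (distr M M (\<lambda>y. x + y)) A = emeasure M ((\<lambda>y. x + y) -` A \<inter> space M)"
    by (rule emeasure_distr) (use A in auto)
  also have "\<dots> = emeasure M ((\<lambda>y. - x + y) ` A)" using translate_image[of "- x" A] by simp
  finally show "emeasure (distr M M (\<lambda>y. x + y)) A = emeasure M A" by (simp add: emeasure_translate A)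
qed simp

lemma integral_translate:
  "f \<in> borel_measurable M \<Longrightarrow> (LINT y|M. f (x + y)) = integral\<^sup>L M f"
  for f :: "'a \<Rightarrow> 'b::{banach, second_countable_topology}"
  using integral_distr[OF measurable_translate[of x], where f = f] by (simp add: distr_translate)

lemma integrable_translate:
  "integrable M f \<Longrightarrow> integrable M (\<lambda>y. f (x + y))"
  for f :: "'a \<Rightarrow> 'b::{banach, second_countable_topology}"
  using integrable_distr[OF measurable_translate[of x], where f = f] by (simp add: distr_translate)

lemma measurable_left_regular:
  "f \<in> borel_measurable M \<Longrightarrow> left_regular x f \<in> borel_measurable M"
  unfolding left_regular_def by (rule measurable_compose[OF measurable_translate])

lemma left_regular_l2: assumes f: "f \<in> l2 M" shows "left_regular x f \<in> l2 M"
  using measurable_left_regular[OF l2_measurable[OF f]] integrable_translate[OF l2_integrable[OF f], of "- x"]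
  by (simp add: l2_def left_regular_def)

lemma left_regular_inner:
  assumes f: "f \<in> l2 M" and g: "g \<in> l2 M"
  shows "l2_inner M (left_regular x f) (left_regular x g) = l2_inner M f g"
  unfolding l2_inner_def left_regular_def
  by (rule integral_translate[of "\<lambda>y. f y * cnj (g y)"]) (use l2_prod_integrable[OF f g] in auto)

lemma left_regular_norm: "f \<in> l2 M \<Longrightarrow> l2_norm M (left_regular x f) = l2_norm M f"
  using left_regular_inner[of f f x] by (simp add: l2_self l2_norm_nonneg del: of_real_power)

lemma left_regular_add: "left_regular (x + y) f = left_regular x (left_regular y f)"
  unfolding left_regular_def by (simp only: minus_add add.assoc)

lemma left_regular_zero: "left_regular 0 f = f"
  by (simp add: left_regular_def)

lemma left_regular_plus: "left_regular x (f + g) = left_regular x f + left_regular x g"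
  by (simp add: left_regular_def fun_eq_iff)

lemma left_regular_diff: "left_regular x (f - g) = left_regular x f - left_regular x g"
  for f g :: "'a \<Rightarrow> complex"
  by (simp add: left_regular_def fun_eq_iff)

lemma left_regular_fscale: "left_regular x (fscale c f) = fscale c (left_regular x f)"
  by (simp add: left_regular_def fun_eq_iff)

lemma left_regular_adjoint:
  assumes f: "f \<in> l2 M" and g: "g \<in> l2 M"
  shows "l2_inner M (left_regular x f) g = l2_inner M f (left_regular (- x) g)"
  using left_regular_inner[OF f left_regular_l2[OF g], of x "- x"]
  by (simp add: left_regular_add[symmetric] left_regular_zero)

lemma left_regular_bop: "left_regular x \<in> l2.bop M"
  by (auto simp: l2.bop_def left_regular_l2 left_regular_plus left_regular_fscale left_regular_norm
      intro: exI[of _ 1])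

lemma regular_bop: "range left_regular \<subseteq> l2.bop M"
  using left_regular_bop by blast

lemma regular_adj:
  "S \<in> range left_regular \<Longrightarrow> \<exists>S'\<in>range left_regular. \<forall>x\<in>l2 M. \<forall>y\<in>l2 M. l2_inner M (S x) y = l2_inner M x (S' y)"
  using left_regular_adjoint by blast

lemma comm_sub_bop: "l2.comm M A \<subseteq> l2.bop M"
  using l2.comm_bop by blast

lemma VN_eq: "VN M = l2.comm M (l2.comm M (range left_regular))"
  unfolding VN_def by (simp add: commutant_eq regular_bop comm_sub_bop)

lemma VN_bop: "T \<in> VN M \<Longrightarrow> T \<in> l2.bop M"
  unfolding VN_eq by (rule l2.comm_bop)

text \<open>This gives the \<open>THE\<close> in \<open>pairing\<close> a meaning on VN M. The
  translations contain the identity and are closed under composition and adjoints, as the comparison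
  of coefficients demands.\<close>

lemma VN_inner_eq:
  assumes T: "T \<in> VN M" and f: "f \<in> l2 M" "f' \<in> l2 M" "g \<in> l2 M" "g' \<in> l2 M"
    and eq: "coefficient M f g = coefficient M f' g'"
  shows "l2_inner M (T f) g = l2_inner M (T f') g'"
proof (rule l2.double_commutant_ip_eq[OF regular_bop _ _ regular_adj T[unfolded VN_eq] f])
  show "(\<lambda>x. x) \<in> range left_regular"
    by (rule range_eqI[of _ _ 0]) (simp add: fun_eq_iff left_regular_zero)
  show "S \<circ> T \<in> range left_regular"
    if S: "S \<in> range left_regular" and T: "T \<in> range left_regular"
    for S T :: "('a \<Rightarrow> complex) \<Rightarrow> 'a \<Rightarrow> complex"
  proof -
    obtain x y where xy: "S = left_regular x" "T = left_regular y" using S T by blast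
    have "S \<circ> T = left_regular (x + y)" unfolding xy by (rule ext) (simp add: left_regular_add)
    then show ?thesis by blast
  qed
  show "l2_inner M (S f) g = l2_inner M (S f') g'" if "S \<in> range left_regular" for S
    using that eq by (auto simp: coefficient_def fun_eq_iff)
qed

section \<open>The pairing and the Fourier norm of coefficients\<close>

lemma pairing_coefficient:
  assumes T: "T \<in> VN M" and f: "f \<in> l2 M" and g: "g \<in> l2 M"
  shows "pairing M T (coefficient M f g) = l2_inner M (T f) g"
  unfolding pairing_def
proof (rule the_equality)
  show "\<exists>f'\<in>l2 M. \<exists>g'\<in>l2 M. coefficient M f g = coefficient M f' g' \<and> l2_inner M (T f) g = l2_inner M (T f') g'"
    using f g by blast
qed (use VN_inner_eq[OF T] f g in metis)

lemma id_VN: "(\<lambda>f. f) \<in> VN M"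
  by (simp add: VN_eq l2.comm_def l2.bop_id)

lemma op_norm_bound:
  assumes T: "T \<in> l2.bop M" and f: "f \<in> l2 M"
  shows "l2_norm M (T f) \<le> op_norm M T * l2_norm M f"
proof -
  obtain C where C: "C > 0" "\<And>f. f \<in> l2 M \<Longrightarrow> l2_norm M (T f) \<le> C * l2_norm M f"
    using l2.bop_bound[OF T] by blast
  have bdd: "bdd_above ((\<lambda>f. l2_norm M (T f)) ` {f \<in> l2 M. l2_norm M f \<le> 1})"
  proof (rule bdd_aboveI2)
    fix f assume "f \<in> {f \<in> l2 M. l2_norm M f \<le> 1}"
    then have "l2_norm M (T f) \<le> C * l2_norm M f" "C * l2_norm M f \<le> C * 1"
      using C by (auto intro!: mult_left_mono)
    then show "l2_norm M (T f) \<le> C" by simp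
  qed
  show ?thesis
  proof (cases "l2_norm M f = 0")
    case True
    then show ?thesis using C(2)[OF f] l2_norm_nonneg[of M "T f"] by simp
  next
    case False
    then have pos: "l2_norm M f > 0" using l2_norm_nonneg[of M f] by linarith
    let ?g = "fscale (of_real (1 / l2_norm M f)) f"
    have g: "?g \<in> l2 M" "l2_norm M ?g = 1"
      using f pos by (auto simp: l2.nrm_scale norm_divide intro: l2_fscale)
    have "l2_norm M (T ?g) \<le> op_norm M T"
      unfolding op_norm_def by (rule cSUP_upper[OF _ bdd]) (use g in auto)
    moreover have "l2_norm M (T ?g) = l2_norm M (T f) / l2_norm M f"
      using l2.nrm_eqv[OF l2.bop_H[OF T g(1)] _ l2.bop_scale[OF T f]] l2.bop_H[OF T f] pos
      by (simp add: l2.nrm_scale l2_fscale norm_divide)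
    ultimately show ?thesis using pos by (simp add: pos_divide_le_eq)
  qed
qed

lemma op_norm_id:
  assumes h: "h \<in> l2 M" "l2_norm M h = 1" shows "op_norm M (\<lambda>f. f) = 1"
  unfolding op_norm_def by (rule cSup_eq_maximum) (use h in auto)

text \<open>The unit vector \<open>h\<close> witnesses that L2 is non-zero: then the identity has
  norm 1 and the supremum runs over a non-empty set.\<close>

lemma fourier_norm_le:
  assumes h: "h \<in> l2 M" "l2_norm M h = 1" and f: "f \<in> l2 M" and g: "g \<in> l2 M"
  shows "fourier_norm M (coefficient M f g) \<le> l2_norm M f * l2_norm M g"
  unfolding fourier_norm_def
proof (rule cSUP_least)
  show "{T \<in> VN M. op_norm M T = 1} \<noteq> {}" using id_VN op_norm_id[OF h] by blast
  fix T assume "T \<in> {T \<in> VN M. op_norm M T = 1}"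
  then have T: "T \<in> VN M" "op_norm M T = 1" by auto
  have "cmod (pairing M T (coefficient M f g)) = cmod (l2_inner M (T f) g)"
    by (simp add: pairing_coefficient[OF T(1) f g])
  also have "\<dots> \<le> l2_norm M (T f) * l2_norm M g"
    by (intro l2.cauchy_schwarz l2.bop_H[OF VN_bop[OF T(1)]] f g)
  also have "\<dots> \<le> l2_norm M f * l2_norm M g"
    using op_norm_bound[OF VN_bop[OF T(1)] f] T(2) by (intro mult_right_mono l2_norm_nonneg) auto
  finally show "cmod (pairing M T (coefficient M f g)) \<le> l2_norm M f * l2_norm M g" .
qed

text \<open>The identity operator is one of the competitors in the supremum. For f = g a unit vector
  this is the lower bound 1; in general it settles the sign of \<open>fourier_norm\<close>.\<close>

lemma fourier_norm_nonneg:
  assumes h: "h \<in> l2 M" "l2_norm M h = 1" and f: "f \<in> l2 M" and g: "g \<in> l2 M"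
  shows "cmod (l2_inner M f g) \<le> fourier_norm M (coefficient M f g)"
proof -
  have "bdd_above ((\<lambda>T. cmod (pairing M T (coefficient M f g))) ` {T \<in> VN M. op_norm M T = 1})"
  proof (rule bdd_aboveI2)
    fix T assume "T \<in> {T \<in> VN M. op_norm M T = 1}"
    then have T: "T \<in> VN M" "op_norm M T = 1" by auto
    have "cmod (l2_inner M (T f) g) \<le> l2_norm M (T f) * l2_norm M g"
      by (intro l2.cauchy_schwarz l2.bop_H[OF VN_bop[OF T(1)]] f g)
    also have "\<dots> \<le> l2_norm M f * l2_norm M g"
      using op_norm_bound[OF VN_bop[OF T(1)] f] T(2) by (intro mult_right_mono l2_norm_nonneg) auto
    finally show "cmod (pairing M T (coefficient M f g)) \<le> l2_norm M f * l2_norm M g"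
      by (simp add: pairing_coefficient[OF T(1) f g])
  qed
  from cSUP_upper[OF _ this, of "\<lambda>f. f"] show ?thesis
    using id_VN op_norm_id[OF h] pairing_coefficient[OF id_VN f g] by (simp add: fourier_norm_def)
qed

lemma coefficient_normal_state:
  assumes h: "h \<in> l2 M" "l2_norm M h = 1" shows "coefficient M h h \<in> normal_states M"
proof -
  have "fourier_norm M (coefficient M h h) = 1"
    using fourier_norm_le[OF h h(1) h(1)] fourier_norm_nonneg[OF h h(1) h(1)] h(2) by (simp add: l2_self)
  moreover have "coefficient M h h 0 = 1"
    by (simp add: coefficient_def left_regular_zero l2_self h)
  ultimately show ?thesis using h by (auto simp: normal_states_def fourier_algebra_def)
qed

subsection \<open>Support projections of vector states\<close>

lemma is_projection_eq: "is_projection M P \<longleftrightarrow> l2.is_proj M P"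
proof (cases "P \<in> l2.bop M")
  case True
  then show ?thesis
    using l2.bop_H[OF True] l2_op_eq_iff[of M "P \<circ> P" P]
    by (simp add: is_projection_def l2.is_proj_def bounded_ops_eq)
qed (simp add: is_projection_def l2.is_proj_def bounded_ops_eq)

abbreviation cyc :: "('a \<Rightarrow> complex) \<Rightarrow> ('a \<Rightarrow> complex) \<Rightarrow> 'a \<Rightarrow> complex" where
  "cyc \<equiv> l2.cyclic_proj M (range left_regular)"

abbreviation cyc_set :: "('a \<Rightarrow> complex) \<Rightarrow> ('a \<Rightarrow> complex) set" where
  "cyc_set h \<equiv> (\<lambda>T. T h) ` l2.comm M (range left_regular)"

text \<open>The pairing equals <P h, h> = |P h|^2, and |P h - h|^2 = 1 - |P h|^2.\<close>

lemma projection_state_fix: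
  assumes h: "h \<in> l2 M" "l2_norm M h = 1" and P: "P \<in> VN M" "l2.is_proj M P"
  shows "pairing M P (coefficient M h h) = 1 \<longleftrightarrow> l2.eqv M (P h) h"
proof -
  have Ph: "P h \<in> l2 M" using l2.bop_H[OF VN_bop[OF P(1)]] h by blast
  have "l2_inner M (P h) (P h) = l2_inner M (P (P h)) h" using P(2) h Ph by (simp add: l2.is_proj_def)
  also have "\<dots> = l2_inner M (P h) h"
    by (rule l2.ip_eqv) (use P(2) h Ph l2.bop_H[OF VN_bop[OF P(1)]] in \<open>auto simp: l2.is_proj_def\<close>)
  finally have n: "l2_inner M (P h) h = of_real ((l2_norm M (P h))\<^sup>2)" by (simp add: l2_self)
  have sq: "(l2_norm M (P h - h))\<^sup>2 = 1 - (l2_norm M (P h))\<^sup>2"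
    using l2.nrm_diff_sq[OF Ph h(1)] n h(2) by simp
  have "pairing M P (coefficient M h h) = of_real ((l2_norm M (P h))\<^sup>2)"
    by (simp add: pairing_coefficient[OF P(1) h(1) h(1)] n)
  then have "pairing M P (coefficient M h h) = 1 \<longleftrightarrow> (l2_norm M (P h))\<^sup>2 = 1"
    using of_real_eq_1_iff[where 'a = complex, of "(l2_norm M (P h))\<^sup>2"] by simp
  also have "\<dots> \<longleftrightarrow> (l2_norm M (P h - h))\<^sup>2 = 0" unfolding sq by auto
  also have "\<dots> \<longleftrightarrow> l2_norm M (P h - h) = 0" by simp
  finally show ?thesis by (simp add: l2.eqv_def)
qed

lemma projection_le_iff:
  "P \<in> l2.bop M \<Longrightarrow> Q \<in> l2.bop M \<Longrightarrow> projection_le M P Q \<longleftrightarrow> (\<forall>f\<in>l2 M. l2.eqv M (Q (P f)) (P f))"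
  unfolding projection_le_def by (subst l2_op_eq_iff) (auto simp: l2.bop_H)

text \<open>\<open>cyc h\<close> is itself a projection on which the state takes the value 1, and it
  lies below all others; so the infimum is a minimum.\<close>

lemma is_support_proj_cyc:
  assumes h: "h \<in> l2 M" "l2_norm M h = 1"
  shows "is_support_proj M (coefficient M h h) (cyc h)"
proof -
  note C = regular_bop regular_adj h(1)
  have VN: "cyc h \<in> VN M" unfolding VN_eq by (rule l2.cyclic_proj_double_comm[OF C])
  have ip: "l2.is_proj M (cyc h)" by (rule l2.cyclic_proj_is_proj[OF C])
  have one: "pairing M (cyc h) (coefficient M h h) = 1"
    unfolding projection_state_fix[OF h VN ip] by (rule l2.cyclic_proj_self[OF C])
  have "projection_le M (cyc h) P"
    if P: "P \<in> VN M" "is_projection M P" "pairing M P (coefficient M h h) = 1" for P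
  proof -
    have "l2.eqv M (P h) h" using P projection_state_fix[OF h] is_projection_eq by blast
    then show ?thesis
      using projection_le_iff[OF VN_bop[OF VN] VN_bop[OF P(1)]] P(2)
        l2.cyclic_proj_least[OF C P(1)[unfolded VN_eq]] l2.cyclic_proj_clo[OF C]
      by (simp add: is_projection_eq)
  qed
  then show ?thesis using VN ip one by (auto simp: is_support_proj_def is_projection_eq)
qed

text \<open>The choice in \<open>support_proj\<close> yields some infimum; as it lies below
  \<open>cyc h\<close>, it takes its values in the closed cyclic subspace of h.\<close>

lemma support_proj_range:
  assumes h: "h \<in> l2 M" "l2_norm M h = 1"
  defines "S \<equiv> support_proj M (coefficient M h h)"
  shows "S \<in> l2.bop M" and "l2.is_proj M S" and "f \<in> l2 M \<Longrightarrow> S f \<in> l2.clo M (fs.span (cyc_set h))"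
proof -
  note C = regular_bop regular_adj h(1)
  have S: "is_support_proj M (coefficient M h h) S"
    unfolding S_def support_proj_def by (rule someI[where P = "is_support_proj M (coefficient M h h)"])
      (rule is_support_proj_cyc[OF h])
  then have SV: "S \<in> VN M" and Sp: "l2.is_proj M S" by (auto simp: is_support_proj_def is_projection_eq)
  show "S \<in> l2.bop M" "l2.is_proj M S" using VN_bop[OF SV] Sp by auto
  have VN: "cyc h \<in> VN M" unfolding VN_eq by (rule l2.cyclic_proj_double_comm[OF C])
  have ip: "l2.is_proj M (cyc h)" by (rule l2.cyclic_proj_is_proj[OF C])
  have one: "pairing M (cyc h) (coefficient M h h) = 1"
    unfolding projection_state_fix[OF h VN ip] by (rule l2.cyclic_proj_self[OF C])
  have "projection_le M S (cyc h)"
    using S VN ip one by (auto simp: is_support_proj_def is_projection_eq)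
  then have le: "l2.eqv M (cyc h (S f)) (S f)" if "f \<in> l2 M" for f
    using projection_le_iff[OF VN_bop[OF SV] VN_bop[OF VN]] that by blast
  show "S f \<in> l2.clo M (fs.span (cyc_set h))" if f: "f \<in> l2 M"
    by (rule l2.clo_eqv[OF l2.cyclic_subspace(2)[OF C] l2.cyclic_proj_clo[OF C] _ le[OF f]])
      (use l2.bop_H[OF VN_bop[OF SV] f] in auto)
qed

text \<open>The assumption makes the cyclic subspaces of h and k orthogonal, and these contain the
  ranges of the support projections P and Q. So |P Q f|^2 = <P P Q f, Q f> vanishes.\<close>

lemma orthogonal_statesI:
  assumes h: "h \<in> l2 M" "l2_norm M h = 1" and k: "k \<in> l2 M" "l2_norm M k = 1"
    and orth: "\<And>S T. S \<in> l2.comm M (range left_regular) \<Longrightarrow> T \<in> l2.comm M (range left_regular) \<Longrightarrow>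
      l2_inner M (S h) (T k) = 0"
  shows "orthogonal_states M (coefficient M h h) (coefficient M k k)"
proof -
  let ?S = "support_proj M (coefficient M h h)" and ?T = "support_proj M (coefficient M k k)"
  note S = support_proj_range[OF h] and T = support_proj_range[OF k]
  have sub: "cyc_set h \<subseteq> l2 M" "cyc_set k \<subseteq> l2 M"
    using l2.bop_H[OF l2.comm_bop] h k by blast+
  have inner: "l2_inner M a b = 0"
    if a: "a \<in> l2.clo M (fs.span (cyc_set h))" and b: "b \<in> l2.clo M (fs.span (cyc_set k))" for a b
  proof (rule l2.ip_clo_span[OF sub(2) l2.clo_H[OF a] _ b])
    fix g assume g: "g \<in> cyc_set k"
    have gl: "g \<in> l2 M" using g sub by blast
    have "l2_inner M g a = 0"
    proof (rule l2.ip_clo_span[OF sub(1) gl _ a])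
      fix g' assume g': "g' \<in> cyc_set h"
      then have "l2_inner M g' g = 0" using g orth by blast
      then show "l2_inner M g g' = 0" using l2.ip_cnj[of g' M g] g' gl sub by auto
    qed
    then show "l2_inner M a g = 0" using l2.ip_cnj[OF gl l2.clo_H[OF a]] by simp
  qed
  have "l2.eqv M (?S (?T f)) 0" if f: "f \<in> l2 M" for f
  proof -
    have Tf: "?T f \<in> l2 M" using l2.bop_H[OF T(1) f] .
    have STf: "?S (?T f) \<in> l2 M" using l2.bop_H[OF S(1) Tf] .
    have "l2_inner M (?S (?T f)) (?S (?T f)) = l2_inner M (?S (?S (?T f))) (?T f)"
      using S(2) STf Tf by (simp add: l2.is_proj_def)
    also have "\<dots> = 0" by (rule inner[OF S(3)[OF STf] T(3)[OF f]])
    finally have "l2_norm M (?S (?T f)) = 0" by (simp add: l2_self)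
    then show ?thesis by (simp add: l2.eqv_def)
  qed
  then show ?thesis
    unfolding orthogonal_states_def zero_fun_def[symmetric]
    by (subst l2_op_eq_iff) (use l2.bop_H[OF S(1)] l2.bop_H[OF T(1)] in auto)
qed

text \<open>Kernel and range of 1 - \<lambda>(x) are orthogonal because \<lambda>(x) is unitary, and
  the operators of the commutant preserve both. Both orders are recorded because the product of
  projections in \<open>orthogonal_states\<close> is ordered.\<close>

lemma orthogonal_states_translate:
  assumes h: "h \<in> l2 M" "l2_norm M h = 1" and k: "k \<in> l2 M" "l2_norm M k = 1"
    and fix_h: "l2.eqv M (left_regular x h) h"
    and p: "p \<in> l2 M" and k_eq: "k = p - left_regular x p"
  shows "orthogonal_states M (coefficient M h h) (coefficient M k k)"
    and "orthogonal_states M (coefficient M k k) (coefficient M h h)"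
proof -
  have 0: "l2_inner M (S h) (T k) = 0"
    if S: "S \<in> l2.comm M (range left_regular)" and T: "T \<in> l2.comm M (range left_regular)" for S T
  proof -
    note Sb = l2.comm_bop[OF S] and Tb = l2.comm_bop[OF T]
    note m = l2.bop_H[OF Sb] l2.bop_H[OF Tb] left_regular_l2
    have "l2.eqv M (S (left_regular x h)) (S h)"
      by (rule l2.bop_eqv[OF Sb _ h(1) fix_h]) (intro m h)
    moreover have "l2.eqv M (S (left_regular x h)) (left_regular x (S h))"
      using S h by (simp add: l2.comm_def)
    ultimately have fix_S: "l2.eqv M (left_regular x (S h)) (S h)"
      using m h by (meson l2.eqv_sym l2.eqv_trans)
    have T1: "l2.eqv M (T k) (T p - T (left_regular x p))"
      unfolding k_eq by (rule l2.bop_diff[OF Tb p]) (intro m p)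
    have "l2_inner M (S h) (T k) = l2_inner M (S h) (T p - T (left_regular x p))"
      by (rule l2.ip_eqv[OF _ _ _ _ l2.eqv_refl T1]) (intro m h k p l2.H_closed)+
    also have "\<dots> = l2_inner M (S h) (T p) - l2_inner M (S h) (T (left_regular x p))"
      by (rule l2.ip_diff_right) (intro m h p)+
    also have "l2_inner M (S h) (T (left_regular x p)) = l2_inner M (left_regular x (S h)) (left_regular x (T p))"
      by (rule l2.ip_eqv) (use m h p T l2.eqv_sym[OF _ _ fix_S] in \<open>auto simp: l2.comm_def\<close>)
    also have "\<dots> = l2_inner M (S h) (T p)" by (intro left_regular_inner m h p)
    finally show ?thesis by simp
  qed
  show "orthogonal_states M (coefficient M h h) (coefficient M k k)"
    by (rule orthogonal_statesI[OF h k]) (rule 0)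
  have "l2_inner M (T k) (S h) = 0"
    if S: "S \<in> l2.comm M (range left_regular)" and T: "T \<in> l2.comm M (range left_regular)" for S T
    using 0[OF that] l2.ip_cnj[of "S h" M "T k"] l2.bop_H[OF l2.comm_bop[OF S] h(1)]
      l2.bop_H[OF l2.comm_bop[OF T] k(1)] by simp
  then show "orthogonal_states M (coefficient M k k) (coefficient M h h)"
    by (intro orthogonal_statesI h k) blast
qed

end

section \<open>Strong continuity of the left regular representation\<close>

context haar_group
begin

lemma compact_finite: "compact K \<Longrightarrow> emeasure M K < \<infinity>"
  using haar unfolding left_haar_measure_def by blast

lemma fmeasurable_compact: "compact K \<Longrightarrow> K \<in> fmeasurable M"
  by (rule fmeasurableI) (simp_all add: borel_compact compact_finite[simplified])

lemma outer_regular: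
  assumes A: "A \<in> fmeasurable M" and e: "e > 0"
  obtains U where "open U" "A \<subseteq> U" "U \<in> fmeasurable M" "measure M U < measure M A + e"
proof -
  have As: "A \<in> sets borel" "emeasure M A < \<infinity>" using A by (auto simp: fmeasurable_def)
  have "(INF U\<in>{U. open U \<and> A \<subseteq> U}. emeasure M U) = emeasure M A"
    using haar As(1) unfolding left_haar_measure_def by metis
  also have "\<dots> < emeasure M A + ennreal e"
    using e by (simp add: emeasure_eq_measure2[OF A] ennreal_plus[symmetric] ennreal_less_iff del: ennreal_plus)
  finally obtain U where U: "open U" "A \<subseteq> U" "emeasure M U < emeasure M A + ennreal e"
    by (auto simp: INF_less_iff)
  have fin: "emeasure M U < \<infinity>"
    using U(3) As(2) by (metis ennreal_add_less_top ennreal_less_top infinity_ennreal_def less_trans)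
  then have Uf: "U \<in> fmeasurable M" using U by (intro fmeasurableI) auto
  have "ennreal (measure M U) < ennreal (measure M A + e)"
    using U(3) e by (simp add: emeasure_eq_measure2[OF Uf] emeasure_eq_measure2[OF A] ennreal_plus[symmetric] del: ennreal_plus)
  then have "measure M U < measure M A + e" by (simp add: ennreal_less_iff)
  then show ?thesis using that U Uf by blast
qed

lemma inner_regular:
  assumes U: "open U" "U \<in> fmeasurable M" and e: "e > 0"
  obtains K where "compact K" "K \<subseteq> U" "measure M U < measure M K + e"
proof (cases "measure M U < e")
  case True
  then show ?thesis using that[of "{}"] by simp
next
  case False
  have "ennreal (measure M U - e) < ennreal (measure M U)"
    using False e by (intro ennreal_lessI) auto
  also have "\<dots> = (SUP K\<in>{K. compact K \<and> K \<subseteq> U}. emeasure M K)"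
    using haar U(1) emeasure_eq_measure2[OF U(2)] unfolding left_haar_measure_def by metis
  finally obtain K where K: "compact K" "K \<subseteq> U" "ennreal (measure M U - e) < emeasure M K"
    by (auto simp: less_SUP_iff)
  then have "measure M U - e < measure M K"
    using False by (simp add: emeasure_eq_measure2[OF fmeasurable_compact] ennreal_less_iff)
  then show ?thesis using that K by (simp add: algebra_simps)
qed

lemma indicator_l2: assumes A: "A \<in> fmeasurable M" shows "indicator A \<in> l2 M"
proof -
  have "(\<lambda>x. (cmod (indicator A x))\<^sup>2) = (indicator A :: 'a \<Rightarrow> real)" by (auto simp: indicator_def)
  then show ?thesis using A 
    by (auto simp: l2_def fmeasurable_def integrable_real_indicator intro!: borel_measurable_indicator)
qed

lemma indicator_diff_norm:
  assumes A: "A \<in> fmeasurable M" and B: "B \<in> fmeasurable M"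
  shows "(l2_norm M (indicator A - indicator B))\<^sup>2 = measure M ((A - B) \<union> (B - A))"
proof -
  have "(l2_norm M (indicator A - indicator B))\<^sup>2 = (\<integral>x. (cmod (indicator A x - indicator B x))\<^sup>2 \<partial>M)"
    by (simp add: l2_norm_def)
  also have "\<dots> = (\<integral>x. indicator ((A - B) \<union> (B - A)) x \<partial>M)"
    by (intro Bochner_Integration.integral_cong) (auto simp: indicator_def)
  also have "\<dots> = measure M ((A - B) \<union> (B - A))" by simp
  finally show ?thesis .
qed

lemma translate_fmeasurable: "A \<in> fmeasurable M \<Longrightarrow> (\<lambda>y. x + y) ` A \<in> fmeasurable M"
proof (rule fmeasurableI)
  assume A: "A \<in> fmeasurable M"
  then have As: "A \<in> sets borel" by (auto simp: fmeasurable_def)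
  show "(\<lambda>y. x + y) ` A \<in> sets M"
    using measurable_sets[OF measurable_translate[of "- x"], of A] As by (simp add: translate_image)
  show "emeasure M ((\<lambda>y. x + y) ` A) < \<infinity>"
    using A by (simp add: emeasure_translate[OF As] fmeasurable_def)
qed

lemma measure_translate: "A \<in> fmeasurable M \<Longrightarrow> measure M ((\<lambda>y. x + y) ` A) = measure M A"
  by (simp add: measure_def emeasure_translate fmeasurable_def)

lemma left_regular_indicator: "left_regular x (indicator A) = indicator ((\<lambda>y. x + y) ` A)"
  for x :: 'a
  by (rule ext) (simp add: left_regular_def indicator_def translate_image[where x = x and A = A])

text \<open>The vectors whose orbit under \<lambda> is continuous at the identity. They form a
  closed subspace, to which the indicators of compact sets belong by regularity of M; the rest of L2
  follows by approximation.\<close>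

definition Cont :: "('a \<Rightarrow> complex) set" where
  "Cont = {f \<in> l2 M. \<forall>e>0. \<forall>\<^sub>F x in nhds 0. l2_norm M (left_regular x f - f) < e}"

text \<open>The tube lemma around {0} x K, for the preimage of U under addition.\<close>

lemma translate_subset_open:
  assumes "compact K" "open U" "K \<subseteq> U"
  shows "\<forall>\<^sub>F x in nhds (0::'a). (\<lambda>y. x + y) ` K \<subseteq> U"
proof -
  have op: "open ((\<lambda>p::'a \<times> 'a. fst p + snd p) -` U)"
    by (intro open_vimage assms continuous_intros)
  have sub: "{0} \<times> K \<subseteq> (\<lambda>p. fst p + snd p) -` U" using assms by auto
  obtain X where "0 \<in> X" "open X" "X \<times> K \<subseteq> (\<lambda>p. fst p + snd p) -` U"
    using Elementary_Topology.tube_lemma[OF assms(1) op sub] by auto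
  then show ?thesis unfolding eventually_nhds by (intro exI[of _ X]) auto
qed

text \<open>K and x + K have equal measure and, for x near 0, lie in a common open U of slightly
  larger measure. Each misses less than e^2/2 of U, which bounds their symmetric difference.\<close>

lemma indicator_compact_Cont: assumes K: "compact K" shows "indicator K \<in> Cont"
proof -
  note Kf = fmeasurable_compact[OF K]
  have "\<forall>\<^sub>F x in nhds 0. l2_norm M (left_regular x (indicator K) - indicator K) < e" if e: "e > 0" for e
  proof -
    obtain U where U: "open U" "K \<subseteq> U" "U \<in> fmeasurable M" "measure M U < measure M K + e\<^sup>2 / 2"
      using outer_regular[OF Kf, of "e\<^sup>2 / 2"] e by (metis half_gt_zero zero_less_power)
    show ?thesis using translate_subset_open[OF K U(1,2)]
    proof (rule eventually_mono)
      fix x assume x: "(\<lambda>y. x + y) ` K \<subseteq> U"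
      let ?L = "(\<lambda>y. x + y) ` K"
      have L: "?L \<in> fmeasurable M" using translate_fmeasurable[OF Kf] .
      have "(l2_norm M (left_regular x (indicator K) - indicator K))\<^sup>2 = measure M ((?L - K) \<union> (K - ?L))"
        unfolding left_regular_indicator by (rule indicator_diff_norm[OF L Kf])
      also have "\<dots> \<le> measure M ((U - K) \<union> (U - ?L))"
        by (rule measure_mono_fmeasurable[OF _ fmeasurableD[OF fmeasurable.Un[OF fmeasurable_Diff fmeasurable_Diff]]
            fmeasurable.Un[OF fmeasurable_Diff fmeasurable_Diff]]) (use x U Kf L in \<open>auto dest: fmeasurableD\<close>)
      also have "\<dots> \<le> measure M (U - K) + measure M (U - ?L)"
        by (rule measure_Un_le) (use U Kf L in \<open>auto simp: fmeasurable_def\<close>)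
      also have "measure M (U - K) = measure M U - measure M K"
        using U Kf by (intro measurable_measure_Diff) (auto simp: fmeasurable_def)
      also have "measure M (U - ?L) = measure M U - measure M K"
        using U L x measure_translate[OF Kf, of x] by (subst measurable_measure_Diff) (auto simp: fmeasurable_def)
      finally have "(l2_norm M (left_regular x (indicator K) - indicator K))\<^sup>2 < e\<^sup>2" using U(4) by linarith
      then show "l2_norm M (left_regular x (indicator K) - indicator K) < e"
        using e by (rule_tac power2_less_imp_less) auto
    qed
  qed
  then show ?thesis by (simp add: Cont_def indicator_l2[OF Kf])
qed

lemma Cont_l2: "f \<in> Cont \<Longrightarrow> f \<in> l2 M"
  by (simp add: Cont_def)

lemma Cont_subspace: "fs.subspace Cont"
proof (rule fs.subspaceI)
  have "left_regular x 0 = (0 :: 'a \<Rightarrow> complex)" for x by (simp add: fun_eq_iff left_regular_def)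
  then show "0 \<in> Cont" by (simp add: Cont_def l2_zero)
next
  fix f g assume f: "f \<in> Cont" and g: "g \<in> Cont"
  note l = Cont_l2[OF f] Cont_l2[OF g]
  have "\<forall>\<^sub>F x in nhds 0. l2_norm M (left_regular x (f + g) - (f + g)) < e" if "e > 0" for e
  proof -
    have "e / 2 > 0" using that by simp
    then have "\<forall>\<^sub>F x in nhds 0. l2_norm M (left_regular x f - f) < e / 2"
      "\<forall>\<^sub>F x in nhds 0. l2_norm M (left_regular x g - g) < e / 2"
      using f g unfolding Cont_def by blast+
    then show ?thesis
    proof eventually_elim
      case (elim x)
      have eq: "left_regular x (f + g) - (f + g) = (left_regular x f - f) + (left_regular x g - g)"
        by (simp add: left_regular_plus)
      show ?case
        unfolding eq using l2.nrm_triangle[of "left_regular x f - f" M "left_regular x g - g"] elim l left_regular_l2 by auto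
    qed
  qed
  then show "f + g \<in> Cont" using l by (simp add: Cont_def l2_add)
next
  fix c f assume f: "f \<in> Cont"
  note l = Cont_l2[OF f]
  have "\<forall>\<^sub>F x in nhds 0. l2_norm M (left_regular x (fscale c f) - fscale c f) < e" if "e > 0" for e
  proof -
    have "\<forall>\<^sub>F x in nhds 0. l2_norm M (left_regular x f - f) < e / (cmod c + 1)"
      using f that by (auto simp: Cont_def add_nonneg_pos)
    then show ?thesis
    proof eventually_elim
      case (elim x)
      have "l2_norm M (left_regular x (fscale c f) - fscale c f) = cmod c * l2_norm M (left_regular x f - f)"
        using l2.nrm_scale[of "left_regular x f - f" M c] l left_regular_l2
        by (simp add: left_regular_fscale fs.scale_right_diff_distrib)
      also have "\<dots> \<le> (cmod c + 1) * l2_norm M (left_regular x f - f)"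
        by (intro mult_right_mono l2_norm_nonneg) auto
      also have "\<dots> < (cmod c + 1) * (e / (cmod c + 1))"
        by (intro mult_strict_left_mono elim) (auto simp: add_nonneg_pos)
      also have "\<dots> = e" by (smt (verit) nonzero_mult_div_cancel_left norm_ge_zero times_divide_eq_right)
      finally show ?case .
    qed
  qed
  then show "fscale c f \<in> Cont" using l by (simp add: Cont_def l2_fscale)
qed

lemma Cont_closed: assumes f: "f \<in> l2.clo M Cont" shows "f \<in> Cont"
proof -
  note l = l2.clo_H[OF f]
  have "\<forall>\<^sub>F x in nhds 0. l2_norm M (left_regular x f - f) < e" if "e > 0" for e
  proof -
    have "e / 3 > 0" using that by simp
    then obtain g where g: "g \<in> Cont" "l2_norm M (f - g) < e / 3" using f unfolding l2.clo_def by blast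
    note gl = Cont_l2[OF g(1)]
    have "\<forall>\<^sub>F x in nhds 0. l2_norm M (left_regular x g - g) < e / 3"
      using g \<open>e / 3 > 0\<close> unfolding Cont_def by blast
    then show ?thesis
    proof eventually_elim
      case (elim x)
      have "l2_norm M (left_regular x f - left_regular x g) = l2_norm M (f - g)"
        using left_regular_norm[of "f - g" x] l gl by (simp add: left_regular_diff)
      then show ?case
        using l2.nrm_triangle_diff[of "left_regular x f" M "left_regular x g" f]
          l2.nrm_triangle_diff[of "left_regular x g" M g f] l2.nrm_minus_commute[OF l gl]
          elim g(2) l gl left_regular_l2 by auto
    qed
  qed
  then show ?thesis using l by (simp add: Cont_def)
qed

text \<open>Inner regularity concerns open sets, so the compact K approximates an open U containing
  A and need not lie in A; K and A both differ from U by less than e^2/2.\<close>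

lemma indicator_Cont: assumes A: "A \<in> fmeasurable M" shows "indicator A \<in> Cont"
proof (rule Cont_closed, unfold l2.clo_def, intro CollectI conjI allI impI)
  show "indicator A \<in> l2 M" by (rule indicator_l2[OF A])
  fix e :: real assume e: "e > 0"
  then have e2: "e\<^sup>2 / 2 > 0" by simp
  obtain U where U: "open U" "A \<subseteq> U" "U \<in> fmeasurable M" "measure M U < measure M A + e\<^sup>2 / 2"
    using outer_regular[OF A e2] by blast
  obtain K where K: "compact K" "K \<subseteq> U" "measure M U < measure M K + e\<^sup>2 / 2"
    using inner_regular[OF U(1,3) e2] by blast
  note Kf = fmeasurable_compact[OF K(1)]
  have "(l2_norm M (indicator A - indicator K))\<^sup>2 = measure M ((A - K) \<union> (K - A))"
    by (rule indicator_diff_norm[OF A Kf])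
  also have "\<dots> \<le> measure M ((U - K) \<union> (U - A))"
    by (rule measure_mono_fmeasurable[OF _ fmeasurableD[OF fmeasurable.Un[OF fmeasurable_Diff fmeasurable_Diff]]
            fmeasurable.Un[OF fmeasurable_Diff fmeasurable_Diff]]) (use U K Kf A in \<open>auto dest: fmeasurableD\<close>)
  also have "\<dots> \<le> measure M (U - K) + measure M (U - A)"
    by (rule measure_Un_le) (use U Kf A in \<open>auto simp: fmeasurable_def\<close>)
  also have "measure M (U - K) = measure M U - measure M K"
    using U K Kf by (intro measurable_measure_Diff) (auto simp: fmeasurable_def)
  also have "measure M (U - A) = measure M U - measure M A"
    using U A by (intro measurable_measure_Diff) (auto simp: fmeasurable_def)
  finally have "(l2_norm M (indicator A - indicator K))\<^sup>2 < e\<^sup>2" using U(4) K(3) by linarith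
  then have "l2_norm M (indicator A - indicator K) < e"
    using e by (rule_tac power2_less_imp_less) auto
  then show "\<exists>d\<in>Cont. l2_norm M (indicator A - d) < e" using indicator_compact_Cont[OF K(1)] by blast
qed

lemma simple_l2_Cont:
  assumes s: "simple_function M s" "s \<in> l2 M" shows "s \<in> Cont"
proof -
  let ?R = "range s - {0}"
  have fin: "finite ?R" using s(1) by (simp add: simple_function_def)
  have sets: "s -` {v} \<in> fmeasurable M" if v: "v \<in> ?R" for v
  proof (rule fmeasurableI)
    show sv: "s -` {v} \<in> sets M" using simple_functionD(2)[OF s(1), of "{v}"] by simp
    \<comment> \<open>Chebyshev's inequality, for a value v other than 0.\<close>
    have "ennreal ((cmod v)\<^sup>2) * emeasure M (s -` {v}) = (\<integral>\<^sup>+x. ennreal ((cmod v)\<^sup>2) * indicator (s -` {v}) x \<partial>M)"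
      using sv by (simp add: nn_integral_cmult_indicator)
    also have "\<dots> \<le> (\<integral>\<^sup>+x. ennreal ((cmod (s x))\<^sup>2) \<partial>M)"
      by (intro nn_integral_mono) (auto simp: indicator_def)
    also have "\<dots> < \<infinity>" by (simp add: nn_integral_l2[OF s(2)])
    finally show "emeasure M (s -` {v}) < \<infinity>"
      using v by (auto simp: ennreal_mult_less_top)
  qed
  have "s x = (\<Sum>v\<in>?R. fscale v (indicator (s -` {v}))) x" for x
  proof -
    have "(\<Sum>v\<in>?R. fscale v (indicator (s -` {v}))) x = (\<Sum>v\<in>?R. if v = s x then v else 0)"
      unfolding sum_fun_apply by (intro sum.cong) (auto simp: indicator_def)
    also have "\<dots> = s x" using fin by (auto simp: sum.delta)
    finally show ?thesis by simp
  qed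
  then have "s = (\<Sum>v\<in>?R. fscale v (indicator (s -` {v})))" by blast
  also have "\<dots> \<in> Cont"
    by (intro fs.subspace_sum[OF Cont_subspace] fs.subspace_scale[OF Cont_subspace] indicator_Cont sets)
  finally show ?thesis .
qed

lemma l2_Cont: assumes f: "f \<in> l2 M" shows "f \<in> Cont"
proof (rule Cont_closed, unfold l2.clo_def, intro CollectI conjI allI impI)
  show "f \<in> l2 M" by fact
  fix e :: real assume e: "e > 0"
  note [measurable] = l2_measurable[OF f]
  obtain F where F: "\<And>i. simple_function M (F i)" "\<And>x. x \<in> space M \<Longrightarrow> (\<lambda>i. F i x) \<longlonglongrightarrow> f x"
    "\<And>i x. x \<in> space M \<Longrightarrow> dist (F i x) 0 \<le> 2 * dist (f x) 0"
    using borel_measurable_implies_sequence_metric[OF l2_measurable[OF f], of 0] by blast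
  have [measurable]: "F i \<in> borel_measurable M" for i using F(1) by (rule borel_measurable_simple_function)
  have Fb: "cmod (F i x) \<le> 2 * cmod (f x)" for i x using F(3)[of x i] by simp
  have Fl: "F i \<in> l2 M" for i
  proof -
    have "integrable M (\<lambda>x. (cmod (F i x))\<^sup>2)"
    proof (rule Bochner_Integration.integrable_bound)
      show "integrable M (\<lambda>x. 4 * (cmod (f x))\<^sup>2)" by (intro integrable_mult_right l2_integrable f)
      show "AE x in M. norm ((cmod (F i x))\<^sup>2) \<le> norm (4 * (cmod (f x))\<^sup>2)"
        using power_mono[OF Fb, of _ _ 2] by (auto simp: power_mult_distrib)
    qed measurable
    then show ?thesis by (simp add: l2_def)
  qed
  have "(\<lambda>i. \<integral>x. (cmod ((f - F i) x))\<^sup>2 \<partial>M) \<longlonglongrightarrow> (\<integral>x. 0 \<partial>M)"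
  proof (rule integral_dominated_convergence)
    \<comment> \<open>The constant is 3^2: |F i| \<le> 2 |f| gives |f - F i| \<le> 3 |f|.\<close>
    show "integrable M (\<lambda>x. 9 * (cmod (f x))\<^sup>2)" by (intro integrable_mult_right l2_integrable f)
    show "AE x in M. (\<lambda>i. (cmod ((f - F i) x))\<^sup>2) \<longlonglongrightarrow> 0"
    proof (rule AE_I2)
      fix x assume "x \<in> space M"
      then have "(\<lambda>i. (cmod (f x - F i x))\<^sup>2) \<longlonglongrightarrow> (cmod (f x - f x))\<^sup>2" by (intro tendsto_intros F)
      then show "(\<lambda>i. (cmod ((f - F i) x))\<^sup>2) \<longlonglongrightarrow> 0" by simp
    qed
    show "AE x in M. norm ((cmod ((f - F i) x))\<^sup>2) \<le> 9 * (cmod (f x))\<^sup>2" for i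
    proof (rule AE_I2)
      fix x
      have "cmod (f x - F i x) \<le> 3 * cmod (f x)"
        using Fb[of i x] norm_triangle_ineq4[of "f x" "F i x"] by linarith
      from power_mono[OF this, of 2] show "norm ((cmod ((f - F i) x))\<^sup>2) \<le> 9 * (cmod (f x))\<^sup>2"
        by (simp add: power_mult_distrib)
    qed
    show "(\<lambda>x. (cmod ((f - F i) x))\<^sup>2) \<in> borel_measurable M" for i by simp
  qed simp
  then have "(\<lambda>i. (l2_norm M (f - F i))\<^sup>2) \<longlonglongrightarrow> 0" by (simp add: l2_norm_def)
  then have "\<forall>\<^sub>F i in sequentially. (l2_norm M (f - F i))\<^sup>2 < e\<^sup>2"
    by (rule order_tendstoD) (use e in simp)
  then obtain i where "(l2_norm M (f - F i))\<^sup>2 < e\<^sup>2" by (auto simp: eventually_sequentially)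
  then have "l2_norm M (f - F i) < e" using e by (rule_tac power2_less_imp_less) auto
  then show "\<exists>d\<in>Cont. l2_norm M (f - d) < e" using simple_l2_Cont[OF F(1) Fl] by blast
qed

theorem left_regular_continuous:
  "f \<in> l2 M \<Longrightarrow> e > 0 \<Longrightarrow> \<forall>\<^sub>F x in nhds 0. l2_norm M (left_regular x f - f) < e"
  using l2_Cont by (auto simp: Cont_def)

lemma left_regular_diff_norm:
  assumes "f \<in> l2 M"
  shows "l2_norm M (left_regular x f - left_regular y f) = l2_norm M (left_regular (- y + x) f - f)"
proof -
  have "left_regular y (left_regular (- y + x) f - f) = left_regular x f - left_regular y f"
    by (simp add: left_regular_diff left_regular_add[symmetric] add.assoc[symmetric])
  then show ?thesis
    using left_regular_norm[of "left_regular (- y + x) f - f" y] assms left_regular_l2 by simp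
qed

lemma coefficient_continuous:
  assumes f: "f \<in> l2 M" and g: "g \<in> l2 M" shows "continuous_on UNIV (coefficient M f g)"
proof -
  have "(coefficient M f g \<longlongrightarrow> coefficient M f g y) (at y)" for y
  proof (rule tendstoI)
    fix e :: real assume "e > 0"
    then have "e / (l2_norm M g + 1) > 0" using l2_norm_nonneg[of M g] by (simp add: add_nonneg_pos)
    from left_regular_continuous[OF f this]
    have ev: "\<forall>\<^sub>F z in nhds 0. l2_norm M (left_regular z f - f) < e / (l2_norm M g + 1)" .
    have "filterlim (\<lambda>x. - y + x) (nhds (- y + y)) (at y)" by (intro tendsto_intros)
    then have "filterlim (\<lambda>x. - y + x) (nhds 0) (at y)" by simp
    from filterlim_iff[THEN iffD1, OF this, rule_format, OF ev]
    show "\<forall>\<^sub>F x in at y. dist (coefficient M f g x) (coefficient M f g y) < e"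
    proof eventually_elim
      case (elim x)
      have "dist (coefficient M f g x) (coefficient M f g y) = cmod (l2_inner M (left_regular x f - left_regular y f) g)"
        using f g left_regular_l2 by (simp add: dist_norm coefficient_def l2.ip_diff)
      also have "\<dots> \<le> l2_norm M (left_regular x f - left_regular y f) * l2_norm M g"
        using f g left_regular_l2 by (intro l2.cauchy_schwarz) auto
      also have "\<dots> = l2_norm M (left_regular (- y + x) f - f) * l2_norm M g"
        by (simp add: left_regular_diff_norm f)
      also have "\<dots> \<le> l2_norm M (left_regular (- y + x) f - f) * (l2_norm M g + 1)"
        by (intro mult_left_mono l2_norm_nonneg) auto
      also have "\<dots> < e / (l2_norm M g + 1) * (l2_norm M g + 1)"
        using elim l2_norm_nonneg[of M g] by (intro mult_strict_right_mono) auto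
      also have "\<dots> = e" using l2_norm_nonneg[of M g] by (simp add: field_simps)
      finally show ?case .
    qed
  qed
  then show ?thesis by (simp add: continuous_on_def)
qed

section \<open>Positivity of Haar measure on open sets\<close>

lemma compact_neighbourhood:
  obtains V C where "open V" "0 \<in> V" "V \<subseteq> C" "compact (C :: 'a set)"
  using loc_compact unfolding locally_compact_space_def
  by (metis UNIV_I compactin_euclidean_iff open_openin topspace_euclidean)

text \<open>If U were null, every compact set, being covered by finitely many translates of U, would
  be null, and by inner regularity so would the whole group.\<close>

lemma open_positive: assumes U: "open U" "U \<noteq> {}" shows "emeasure M U > 0"
proof (rule ccontr)
  assume "\<not> emeasure M U > 0"
  then have U0: "emeasure M U = 0" by simp
  have "(SUP K\<in>{K. compact K \<and> K \<subseteq> UNIV}. emeasure M K) = emeasure M UNIV"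
    using haar unfolding left_haar_measure_def by (metis open_UNIV)
  moreover have "emeasure M UNIV > 0"
    using haar by (auto simp: left_haar_measure_def zero_less_iff_neq_zero)
  ultimately obtain K where K: "compact K" "emeasure M K > 0"
    by (metis (mono_tags, lifting) less_SUP_iff mem_Collect_eq)
  obtain u where u: "u \<in> U" using U by blast
  have op: "open ((\<lambda>y. x + y) ` U)" for x
    unfolding translate_image by (intro open_vimage U continuous_intros)
  have "K \<subseteq> (\<Union>x\<in>UNIV. (\<lambda>y. x + y) ` U)"
  proof
    fix k
    have "k = (k - u) + u" by simp
    then show "k \<in> (\<Union>x\<in>UNIV. (\<lambda>y. x + y) ` U)" using u by blast
  qed
  then obtain X where X: "finite X" "K \<subseteq> (\<Union>x\<in>X. (\<lambda>y. x + y) ` U)"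
    using compactE_image[OF K(1), of UNIV "\<lambda>x. (\<lambda>y. x + y) ` U"] op by metis
  have "emeasure M K \<le> emeasure M (\<Union>x\<in>X. (\<lambda>y. x + y) ` U)"
    by (rule emeasure_mono[OF X(2)]) (use op in \<open>simp add: borel_open open_UN\<close>)
  also have "\<dots> \<le> (\<Sum>x\<in>X. emeasure M ((\<lambda>y. x + y) ` U))"
    by (rule emeasure_subadditive_finite) (use X op in auto)
  also have "\<dots> = 0" using U U0 by (simp add: emeasure_translate)
  finally show False using K by simp
qed

end

section \<open>Uniformly continuous kernels\<close>

text \<open>Boundedness, and uniform continuity in each variable uniformly in the other, for the
  left uniformity. So a compact set has a finite partition on whose cells the kernel is nearly
  constant in either variable.\<close>

definition uniform_kernel :: "('a::topological_group_add \<Rightarrow> 'a \<Rightarrow> 'b::real_normed_field) \<Rightarrow> bool" where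
  "uniform_kernel k \<longleftrightarrow> (\<exists>B. \<forall>x y. norm (k x y) \<le> B) \<and>
     (\<forall>e>0. \<exists>V. open V \<and> 0 \<in> V \<and>
       (\<forall>x x' y. - x' + x \<in> V \<longrightarrow> norm (k x y - k x' y) \<le> e \<and> norm (k y x - k y x') \<le> e))"

lemma uniform_kernel_swap: "uniform_kernel k \<Longrightarrow> uniform_kernel (\<lambda>x y. k y x)"
  unfolding uniform_kernel_def by metis

lemma uniform_kernel_norm:
  fixes k :: "'a::topological_group_add \<Rightarrow> 'a \<Rightarrow> complex"
  assumes "uniform_kernel k" shows "uniform_kernel (\<lambda>x y. cmod (k x y))"
proof -
  have "\<exists>V. open V \<and> 0 \<in> V \<and> (\<forall>x x' y. - x' + x \<in> V \<longrightarrow>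
      norm (cmod (k x y) - cmod (k x' y)) \<le> e \<and> norm (cmod (k y x) - cmod (k y x')) \<le> e)" if "e > 0" for e
  proof -
    obtain V where V: "open V" "0 \<in> V"
      "\<forall>x x' y. - x' + x \<in> V \<longrightarrow> norm (k x y - k x' y) \<le> e \<and> norm (k y x - k y x') \<le> e"
      using assms \<open>e > 0\<close> unfolding uniform_kernel_def by blast
    have "norm (cmod a - cmod b) \<le> e" if "norm (a - b) \<le> e" for a b
      using norm_triangle_ineq3[of a b] that by simp
    then show ?thesis using V by (intro exI[of _ V]) blast
  qed
  moreover have "\<exists>B. \<forall>x y. norm (cmod (k x y)) \<le> B" using assms by (auto simp: uniform_kernel_def)
  ultimately show ?thesis unfolding uniform_kernel_def by blast
qed

lemma left_uniform_continuous:
  fixes g :: "'a::topological_group_add \<Rightarrow> 'b::real_normed_vector"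
  assumes "\<And>e. e > 0 \<Longrightarrow> \<exists>V. open V \<and> 0 \<in> V \<and> (\<forall>x x'. - x' + x \<in> V \<longrightarrow> norm (g x - g x') \<le> e)"
  shows "continuous_on UNIV g"
proof -
  have "(g \<longlongrightarrow> g y) (at y)" for y
  proof (rule tendstoI)
    fix e :: real assume "e > 0"
    then obtain V where V: "open V" "0 \<in> V" "\<forall>x x'. - x' + x \<in> V \<longrightarrow> norm (g x - g x') \<le> e / 2"
      using assms[of "e / 2"] by auto
    have "filterlim (\<lambda>x. - y + x) (nhds (- y + y)) (at y)" by (intro tendsto_intros)
    then have "filterlim (\<lambda>x. - y + x) (nhds 0) (at y)" by simp
    moreover have "eventually (\<lambda>z. z \<in> V) (nhds 0)" using V by (auto simp: eventually_nhds)
    ultimately have "eventually (\<lambda>x. - y + x \<in> V) (at y)" by (auto simp: filterlim_iff)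
    then show "eventually (\<lambda>x. dist (g x) (g y) < e) (at y)"
    proof eventually_elim
      case (elim x)
      then have "norm (g x - g y) \<le> e / 2" using V(3) by blast
      then show ?case using \<open>e > 0\<close> by (simp add: dist_norm)
    qed
  qed
  then show ?thesis by (simp add: continuous_on_def)
qed

lemma uniform_kernel_continuous:
  assumes "uniform_kernel k"
  shows "continuous_on UNIV (\<lambda>x. k x y)" and "continuous_on UNIV (\<lambda>y. k x y)"
proof -
  have V: "\<exists>V. open V \<and> 0 \<in> V \<and> (\<forall>x x' y. - x' + x \<in> V \<longrightarrow> norm (k x y - k x' y) \<le> e \<and> norm (k y x - k y x') \<le> e)"
    if "e > 0" for e using assms that unfolding uniform_kernel_def by blast
  show "continuous_on UNIV (\<lambda>x. k x y)" "continuous_on UNIV (\<lambda>y. k x y)"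
  proof (rule_tac [!] left_uniform_continuous)
    fix e :: real assume "e > 0"
    from V[OF this] obtain V where V: "open V" "0 \<in> V"
      "\<And>x x' y. - x' + x \<in> V \<Longrightarrow> norm (k x y - k x' y) \<le> e \<and> norm (k y x - k y x') \<le> e" by meson
    show "\<exists>V. open V \<and> 0 \<in> V \<and> (\<forall>x x'. - x' + x \<in> V \<longrightarrow> norm (k x y - k x' y) \<le> e)"
      by (intro exI[of _ V]) (simp add: V)
    show "\<exists>V. open V \<and> 0 \<in> V \<and> (\<forall>y y'. - y' + y \<in> V \<longrightarrow> norm (k x y - k x y') \<le> e)"
      by (intro exI[of _ V]) (simp add: V)
  qed
qed

lemma integral_norm_le:
  fixes f :: "'a \<Rightarrow> 'b::{banach, second_countable_topology}"
  assumes "integrable M f" "integrable M g" "\<And>x. norm (f x) \<le> g x"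
  shows "norm (integral\<^sup>L M f) \<le> integral\<^sup>L M g"
proof -
  have "norm (integral\<^sup>L M f) \<le> (LINT x|M. norm (f x))" by (rule Bochner_Integration.integral_norm_bound)
  also have "\<dots> \<le> integral\<^sup>L M g"
    by (rule Bochner_Integration.integral_mono) (use assms in auto)
  finally show ?thesis .
qed

section \<open>Riemann sums and iterated integrals of kernels\<close>

context haar_group
begin

lemma continuous_measurable:
  "continuous_on UNIV f \<Longrightarrow> f \<in> borel_measurable M"
  for f :: "'a \<Rightarrow> 'b::{topological_space}"
  unfolding borel_M_iff by (rule borel_measurable_continuous_onI)

lemma integrable_mult_bounded:
  fixes p g :: "'a \<Rightarrow> 'b::{real_normed_field, banach, second_countable_topology}"
  assumes p: "integrable M p" and g: "g \<in> borel_measurable M" and B: "\<And>x. norm (g x) \<le> B"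
  shows "integrable M (\<lambda>x. p x * g x)"
proof (rule Bochner_Integration.integrable_bound)
  show "integrable M (\<lambda>x. B *\<^sub>R p x)" using p by simp
  show "(\<lambda>x. p x * g x) \<in> borel_measurable M" using p g by simp
  have "norm (p x * g x) \<le> norm (B *\<^sub>R p x)" for x
    using mult_left_mono[OF order_trans[OF B[of x] abs_ge_self[of B]], of "norm (p x)"]
    by (simp add: norm_mult mult.commute)
  then show "AE x in M. norm (p x * g x) \<le> norm (B *\<^sub>R p x)" by simp
qed

text \<open>A finite cover of C by translates of V, made disjoint along an enumeration.\<close>

lemma compact_partition:
  assumes C: "compact C" and V: "open V" "0 \<in> V"
  shows "\<exists>(n::nat) A a. (\<forall>i. A i \<in> sets M) \<and> disjoint_family A \<and> C \<subseteq> (\<Union>i<n. A i) \<and>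
    (\<forall>i<n. \<forall>x\<in>A i. - a i + x \<in> (V :: 'a set))"
proof -
  have op: "open ((\<lambda>x. - a + x) -` V)" for a by (intro open_vimage V continuous_intros)
  have "C \<subseteq> (\<Union>a\<in>UNIV. (\<lambda>x. - a + x) -` V)"
  proof
    fix x
    have "- x + x \<in> V" using V by simp
    then show "x \<in> (\<Union>a\<in>UNIV. (\<lambda>x. - a + x) -` V)" by blast
  qed
  then obtain F where F: "finite F" "C \<subseteq> (\<Union>a\<in>F. (\<lambda>x. - a + x) -` V)"
    using compactE_image[OF C, of UNIV "\<lambda>a. (\<lambda>x. - a + x) -` V"] op by metis
  obtain n a where a: "F = a ` {i::nat. i < n}"
    using finite_imp_nat_seg_image_inj_on[OF F(1)] by blast
  define B where "B i = (\<lambda>x. - a i + x) -` V" for i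
  have Bs: "B i \<in> sets M" for i using op[of "a i"] by (simp add: B_def)
  have "disjointed B i \<in> sets M" for i
    unfolding disjointed_def using Bs by (intro sets.Diff sets.finite_UN) auto
  moreover have "disjoint_family (disjointed B)" by (rule disjoint_family_disjointed)
  moreover have "C \<subseteq> (\<Union>i<n. disjointed B i)"
  proof -
    have "C \<subseteq> (\<Union>i<n. B i)" using F(2) by (simp add: a B_def lessThan_def)
    also have "(\<Union>i<n. B i) = (\<Union>i<n. disjointed B i)"
      using finite_UN_disjointed_eq[of B n] by (simp add: lessThan_atLeast0)
    finally show ?thesis .
  qed
  moreover have "- a i + x \<in> V" if "x \<in> disjointed B i" for i x
    using that disjointed_subset[of B i] by (auto simp: B_def)
  ultimately show ?thesis by (intro exI[of _ n] exI[of _ "disjointed B"] exI[of _ a]) auto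
qed

lemma step_approx:
  fixes p g :: "'a \<Rightarrow> 'b::{real_normed_field, banach, second_countable_topology}" and n :: nat
  assumes A: "\<And>i. A i \<in> sets M" "disjoint_family A"
    and p: "integrable M p" and p0: "\<And>x. x \<notin> (\<Union>i<n. A i) \<Longrightarrow> p x = 0"
    and g: "g \<in> borel_measurable M" "\<And>x. norm (g x) \<le> B"
    and close: "\<And>i x. i < n \<Longrightarrow> x \<in> A i \<Longrightarrow> norm (g x - c i) \<le> e"
  shows "norm ((LINT x|M. p x * g x) - (\<Sum>i<n. (LINT x|M. indicator (A i) x * p x) * c i))
    \<le> e * (LINT x|M. norm (p x))"
proof -
  have ip: "integrable M (\<lambda>x. indicator (A i) x * p x)" for i
    using integrable_mult_bounded[OF p, of "indicator (A i)" 1] A(1)[of i]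
    by (simp add: mult.commute indicator_def)
  have sum1: "p x * g x - (\<Sum>i<n. indicator (A i) x * p x * c i) = (\<Sum>i<n. indicator (A i) x * p x * (g x - c i))" for x
  proof -
    have "p x = (\<Sum>i<n. indicator (A i) x * p x)"
    proof (cases "x \<in> (\<Union>i<n. A i)")
      case True
      then obtain j where j: "j < n" "x \<in> A j" by blast
      have "(\<Sum>i<n. indicator (A i) x * p x) = (\<Sum>i\<in>{j}. indicator (A i) x * p x)"
        using j A(2) by (intro sum.mono_neutral_right) (auto simp: disjoint_family_on_def indicator_def)
      then show ?thesis using j by simp
    qed (simp add: p0)
    then have eq: "(\<Sum>i<n. indicator (A i) x * p x) * g x = p x * g x" by simp
    have "(\<Sum>i<n. indicator (A i) x * p x * (g x - c i))
        = (\<Sum>i<n. indicator (A i) x * p x) * g x - (\<Sum>i<n. indicator (A i) x * p x * c i)"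
      by (simp only: sum_distrib_right right_diff_distrib sum_subtractf)
    then show ?thesis unfolding eq by (rule sym)
  qed
  have np: "(\<Sum>i<n. norm (indicator (A i) x * p x)) \<le> norm (p x)" for x
  proof (cases "x \<in> (\<Union>i<n. A i)")
    case True
    then obtain j where j: "j < n" "x \<in> A j" by blast
    have "(\<Sum>i<n. norm (indicator (A i) x * p x)) = (\<Sum>i\<in>{j}. norm (indicator (A i) x * p x))"
      using j A(2) by (intro sum.mono_neutral_right) (auto simp: disjoint_family_on_def indicator_def)
    then show ?thesis using j by simp
  qed (simp add: p0)
  have int_pg: "integrable M (\<lambda>x. p x * g x)" by (rule integrable_mult_bounded[OF p g])
  have int_s: "integrable M (\<lambda>x. \<Sum>i<n. indicator (A i) x * p x * c i)"
    by (intro Bochner_Integration.integrable_sum integrable_mult_left ip)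
  have "(LINT x|M. p x * g x) - (\<Sum>i<n. (LINT x|M. indicator (A i) x * p x) * c i)
      = (LINT x|M. p x * g x - (\<Sum>i<n. indicator (A i) x * p x * c i))"
    using int_pg int_s ip
    by (simp add: Bochner_Integration.integral_diff Bochner_Integration.integral_sum)
  also have "norm \<dots> \<le> (LINT x|M. e * norm (p x))"
  proof (rule integral_norm_le)
    show "integrable M (\<lambda>x. p x * g x - (\<Sum>i<n. indicator (A i) x * p x * c i))"
      by (intro Bochner_Integration.integrable_diff int_pg int_s)
    show "integrable M (\<lambda>x. e * norm (p x))" using p by simp
    fix x
    have "norm (\<Sum>i<n. indicator (A i) x * p x * (g x - c i)) \<le> (\<Sum>i<n. e * norm (indicator (A i) x * p x))"
    proof (rule sum_norm_le)
      fix i assume "i \<in> {..<n}"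
      then show "norm (indicator (A i) x * p x * (g x - c i)) \<le> e * norm (indicator (A i) x * p x)"
        using close[of i x] mult_left_mono[OF close[of i x] norm_ge_zero[of "p x"]]
        by (cases "x \<in> A i") (auto simp: norm_mult mult.commute)
    qed
    also have "\<dots> = e * (\<Sum>i<n. norm (indicator (A i) x * p x))" by (simp add: sum_distrib_left)
    also have "\<dots> \<le> e * norm (p x)"
    proof (cases "x \<in> (\<Union>i<n. A i)")
      case True
      \<comment> \<open>A point of A j forces 0 \<le> e, which is not among the assumptions; off the
        cells p vanishes.\<close>
      then obtain j where "j < n" "x \<in> A j" by blast
      then have "0 \<le> e" using close[of j x] norm_ge_zero order_trans by blast
      then show ?thesis using np by (intro mult_left_mono)
    qed (use p0 in simp)
    finally show "norm (p x * g x - (\<Sum>i<n. indicator (A i) x * p x * c i)) \<le> e * norm (p x)"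
      unfolding sum1 .
  qed
  finally show ?thesis by simp
qed

lemma kernel_transform_diff:
  fixes p :: "'a \<Rightarrow> 'b::{real_normed_field, banach, second_countable_topology}"
  assumes k: "uniform_kernel k" and p: "integrable M p"
    and le: "\<And>x. norm (k x y - k x y') \<le> e"
  shows "norm ((LINT x|M. p x * k x y) - (LINT x|M. p x * k x y')) \<le> e * (LINT x|M. norm (p x))"
proof -
  obtain B where B: "\<And>x y. norm (k x y) \<le> B" using k by (auto simp: uniform_kernel_def)
  have i: "integrable M (\<lambda>x. p x * k x y)" for y
    by (intro integrable_mult_bounded[OF p, of _ B] continuous_measurable uniform_kernel_continuous[OF k] B)
  have "(LINT x|M. p x * k x y) - (LINT x|M. p x * k x y') = (LINT x|M. p x * k x y - p x * k x y')"
    by (simp add: i)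
  also have "norm \<dots> \<le> (LINT x|M. e * norm (p x))"
  proof (rule integral_norm_le)
    show "norm (p x * k x y - p x * k x y') \<le> e * norm (p x)" for x
      using mult_left_mono[OF le[of x], of "norm (p x)"]
      by (simp add: right_diff_distrib[symmetric] norm_mult mult.commute)
  qed (use i p in auto)
  finally show ?thesis by simp
qed

lemma kernel_transform:
  fixes p :: "'a \<Rightarrow> 'b::{real_normed_field, banach, second_countable_topology}"
  assumes k: "uniform_kernel k" and p: "integrable M p"
  shows kernel_transform_continuous: "continuous_on UNIV (\<lambda>y. LINT x|M. p x * k x y)"
    and kernel_transform_bounded: "\<exists>B. \<forall>y. norm (LINT x|M. p x * k x y) \<le> B"
proof -
  obtain B where B: "\<And>x y. norm (k x y) \<le> B" using k by (auto simp: uniform_kernel_def)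
  have i: "integrable M (\<lambda>x. p x * k x y)" for y
    by (intro integrable_mult_bounded[OF p, of _ B] continuous_measurable uniform_kernel_continuous[OF k] B)
  let ?N = "LINT x|M. norm (p x)"
  show "continuous_on UNIV (\<lambda>y. LINT x|M. p x * k x y)"
  proof (rule left_uniform_continuous)
    fix e :: real assume e: "e > 0"
    have N: "0 \<le> ?N" by simp
    have "e / (?N + 1) > 0" using N e by (intro divide_pos_pos add_nonneg_pos) simp_all
    then obtain V where V: "open V" "0 \<in> V"
      "\<And>x x' y. - x' + x \<in> V \<Longrightarrow> norm (k y x - k y x') \<le> e / (?N + 1)"
      using k unfolding uniform_kernel_def by meson
    have "e / (?N + 1) * ?N \<le> e / (?N + 1) * (?N + 1)" using e N by (intro mult_left_mono) simp_all
    also have "\<dots> = e" using N by (smt (verit) nonzero_mult_div_cancel_right times_divide_eq_left)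
    finally have "norm ((LINT x|M. p x * k x y) - (LINT x|M. p x * k x y')) \<le> e" if "- y' + y \<in> V" for y y'
      using kernel_transform_diff[OF k p V(3)[OF that]] by linarith
    then show "\<exists>V. open V \<and> 0 \<in> V \<and> (\<forall>y y'. - y' + y \<in> V \<longrightarrow>
        norm ((LINT x|M. p x * k x y) - (LINT x|M. p x * k x y')) \<le> e)" using V by blast
  qed
  have "norm (LINT x|M. p x * k x y) \<le> B * ?N" for y
  proof -
    have "norm (LINT x|M. p x * k x y) \<le> (LINT x|M. B * norm (p x))"
    proof (rule integral_norm_le)
      show "norm (p x * k x y) \<le> B * norm (p x)" for x
        using mult_left_mono[OF B[of x y], of "norm (p x)"] by (simp add: norm_mult mult.commute)
    qed (use i p in auto)
    then show ?thesis by simp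
  qed
  then show "\<exists>B. \<forall>y. norm (LINT x|M. p x * k x y) \<le> B" by blast
qed

definition riemann_sum ::
    "('a \<Rightarrow> 'a \<Rightarrow> 'b::{real_normed_field, banach, second_countable_topology}) \<Rightarrow> nat \<Rightarrow> (nat \<Rightarrow> 'a set) \<Rightarrow>
      (nat \<Rightarrow> 'a) \<Rightarrow> ('a \<Rightarrow> 'b) \<Rightarrow> ('a \<Rightarrow> 'b) \<Rightarrow> 'b" where
  "riemann_sum k n A a p q = (\<Sum>j<n. (LINT y|M. indicator (A j) y * q y) *
     (\<Sum>i<n. (LINT x|M. indicator (A i) x * p x) * k (a i) (a j)))"

text \<open>One partition and one set of nodes serve all p and q and both orders of the variables,
  since the mesh depends only on C and the modulus of continuity of k. In the error 2 e, one e pays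
  for freezing x in the inner integral and one for freezing y in its value.\<close>

lemma kernel_riemann_sum:
  fixes k :: "'a \<Rightarrow> 'a \<Rightarrow> 'b::{real_normed_field, banach, second_countable_topology}"
  assumes k: "uniform_kernel k" and C: "compact C" and e: "e > 0"
  shows "\<exists>n A a. \<forall>k' p q. k' = k \<or> k' = (\<lambda>x y. k y x) \<longrightarrow> integrable M p \<longrightarrow> integrable M q \<longrightarrow>
      (\<forall>x. x \<notin> C \<longrightarrow> p x = 0) \<longrightarrow> (\<forall>x. x \<notin> C \<longrightarrow> q x = 0) \<longrightarrow>
      norm ((LINT y|M. q y * (LINT x|M. p x * k' x y)) - riemann_sum k' n A a p q)
      \<le> 2 * e * (LINT x|M. norm (p x)) * (LINT x|M. norm (q x))"
proof -
  obtain V where V: "open V" "0 \<in> V"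
    "\<And>x x' y. - x' + x \<in> V \<Longrightarrow> norm (k x y - k x' y) \<le> e \<and> norm (k y x - k y x') \<le> e"
    using k e unfolding uniform_kernel_def by meson
  from compact_partition[OF C V(1,2)] obtain n :: nat and A a where
    "(\<forall>i. A i \<in> sets M) \<and> disjoint_family A \<and> C \<subseteq> (\<Union>i<n. A i) \<and> (\<forall>i<n. \<forall>x\<in>A i. - a i + x \<in> V)"
    by blast
  then have A: "\<And>i. A i \<in> sets M" "disjoint_family A" "C \<subseteq> (\<Union>i<n. A i)"
    "\<And>i x. i < n \<Longrightarrow> x \<in> A i \<Longrightarrow> - a i + x \<in> V" by auto
  show ?thesis
  proof (rule exI[of _ n], rule exI[of _ A], rule exI[of _ a], intro allI impI)
    fix k' and p q :: "'a \<Rightarrow> 'b"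
    assume k'eq: "k' = k \<or> k' = (\<lambda>x y. k y x)"
      and p: "integrable M p" and q: "integrable M q"
      and p0': "\<forall>x. x \<notin> C \<longrightarrow> p x = 0" and q0': "\<forall>x. x \<notin> C \<longrightarrow> q x = 0"
    have p0: "p x = 0" and q0: "q x = 0" if "x \<notin> (\<Union>i<n. A i)" for x
      using p0' q0' A(3) that by blast+
    have k': "uniform_kernel k'" using k'eq k uniform_kernel_swap by blast
    have V': "norm (k' x y - k' x' y) \<le> e" "norm (k' y x - k' y x') \<le> e" if "- x' + x \<in> V" for x x' y
      using V(3)[OF that] k'eq by auto
    obtain B where B: "\<And>x y. norm (k' x y) \<le> B" using k' by (auto simp: uniform_kernel_def)
    let ?N = "LINT x|M. norm (p x)"
    define F where "F y = (LINT x|M. p x * k' x y)" for y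
    define c where "c y = (\<Sum>i<n. (LINT x|M. indicator (A i) x * p x) * k' (a i) y)" for y
    have Fc: "norm (F y - c y) \<le> e * ?N" for y
      unfolding F_def c_def
      by (rule step_approx[OF A(1,2) p _ continuous_measurable[OF uniform_kernel_continuous(1)[OF k']] B])
        (use p0 V'(1)[OF A(4)] in blast)+
    obtain B' where B': "\<And>y. norm (F y) \<le> B'"
      using kernel_transform_bounded[OF k' p] unfolding F_def by blast
    have Fm: "F \<in> borel_measurable M"
      unfolding F_def by (intro continuous_measurable kernel_transform_continuous[OF k' p])
    have "norm (F y - c (a j)) \<le> 2 * e * ?N" if "j < n" "y \<in> A j" for y j
    proof -
      have "norm (F y - F (a j)) \<le> e * ?N"
        unfolding F_def by (rule kernel_transform_diff[OF k' p V'(2)[OF A(4)[OF that]]])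
      then show ?thesis using Fc[of "a j"] norm_triangle_ineq[of "F y - F (a j)" "F (a j) - c (a j)"] by simp
    qed
    then have "norm ((LINT y|M. q y * F y) - (\<Sum>j<n. (LINT y|M. indicator (A j) y * q y) * c (a j)))
        \<le> 2 * e * ?N * (LINT x|M. norm (q x))"
      by (intro step_approx[OF A(1,2) q _ Fm B']) (use q0 in blast)+
    then show "norm ((LINT y|M. q y * (LINT x|M. p x * k' x y)) - riemann_sum k' n A a p q)
      \<le> 2 * e * (LINT x|M. norm (p x)) * (LINT x|M. norm (q x))"
      by (simp only: F_def c_def riemann_sum_def)
  qed
qed

text \<open>\<open>M\<close> need not be \<open>\<sigma>\<close>-finite and the kernel need not be measurable for the product \<open>\<sigma>\<close>-algebra,
  so Fubini's theorem is obtained from Riemann sums.\<close>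

lemma kernel_fubini:
  fixes k :: "'a \<Rightarrow> 'a \<Rightarrow> 'b::{real_normed_field, banach, second_countable_topology}"
  assumes k: "uniform_kernel k" and C: "compact C"
    and p: "integrable M p" "\<And>x. x \<notin> C \<Longrightarrow> p x = 0" and q: "integrable M q" "\<And>x. x \<notin> C \<Longrightarrow> q x = 0"
  shows "(LINT y|M. q y * (LINT x|M. p x * k x y)) = (LINT x|M. p x * (LINT y|M. q y * k x y))"
    (is "?L = ?R")
proof -
  let ?P = "LINT x|M. norm (p x)" and ?Q = "LINT x|M. norm (q x)"
  have le: "norm (?L - ?R) \<le> e * (4 * ?P * ?Q)" if e: "e > 0" for e
  proof -
    from kernel_riemann_sum[OF k C e] obtain n A a where
      "\<forall>k' p q. k' = k \<or> k' = (\<lambda>x y. k y x) \<longrightarrow> integrable M p \<longrightarrow> integrable M q \<longrightarrow>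
        (\<forall>x. x \<notin> C \<longrightarrow> p x = 0) \<longrightarrow> (\<forall>x. x \<notin> C \<longrightarrow> q x = 0) \<longrightarrow>
        norm ((LINT y|M. q y * (LINT x|M. p x * k' x y)) - riemann_sum k' n A a p q)
        \<le> 2 * e * (LINT x|M. norm (p x)) * (LINT x|M. norm (q x))"
      by blast
    note * = this[rule_format]
    let ?S = "riemann_sum k n A a p q" and ?S' = "riemann_sum (\<lambda>x y. k y x) n A a q p"
    \<comment> \<open>For finite sums the order may be exchanged, and each iterated integral is
      close to this common value.\<close>
    have "?S = ?S'" unfolding riemann_sum_def by (simp add: sum_distrib_left mult_ac) (rule sum.swap)
    moreover have "norm (?L - ?S) \<le> 2 * e * ?P * ?Q" by (rule *[of k]) (use p q in auto)
    moreover have "norm (?R - ?S') \<le> 2 * e * ?Q * ?P" by (rule *[of "\<lambda>x y. k y x"]) (use p q in auto)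
    moreover have "norm (?L - ?R) \<le> norm (?L - ?S) + norm (?R - ?S)"
      using norm_triangle_ineq4[of "?L - ?S" "?R - ?S"] by simp
    ultimately show ?thesis by (simp add: mult_ac)
  qed
  have "norm (?L - ?R) \<le> 0"
  proof (rule field_le_epsilon)
    fix e :: real assume e: "e > 0"
    let ?K = "4 * ?P * ?Q"
    have K: "0 \<le> ?K" by (intro mult_nonneg_nonneg) simp_all
    then have "e / (?K + 1) > 0" using e by (intro divide_pos_pos) linarith+
    from le[OF this] have "norm (?L - ?R) \<le> e / (?K + 1) * ?K" .
    also have "\<dots> \<le> e / (?K + 1) * (?K + 1)" using e K by (intro mult_left_mono) simp_all
    also have "\<dots> = 0 + e" using K by (smt (verit) nonzero_mult_div_cancel_right times_divide_eq_left)
    finally show "norm (?L - ?R) \<le> 0 + e" .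
  qed
  then show ?thesis by simp
qed

end

context semi_inner
begin

text \<open>0 \<le> T \<le> 1 implies |T| \<le> 1 on a domain that need not be complete: if t is the
  seminorm of the form <T p, q>, Cauchy-Schwarz for this form gives |T p|^2 \<le> t(p) t(T p), and t
  is at most \<open>nrm\<close>.\<close>

lemma positive_contraction:
  assumes D: "subspace D" "D \<subseteq> H" and T: "\<And>p. p \<in> D \<Longrightarrow> T p \<in> D"
    and add: "\<And>p q. p \<in> D \<Longrightarrow> q \<in> D \<Longrightarrow> T (p + q) = T p + T q"
    and scale: "\<And>c p. p \<in> D \<Longrightarrow> T (c \<odot> p) = c \<odot> T p"
    and sym: "\<And>p q. p \<in> D \<Longrightarrow> q \<in> D \<Longrightarrow> ip (T p) q = ip p (T q)"
    and pos: "\<And>p. p \<in> D \<Longrightarrow> 0 \<le> Re (ip (T p) p)"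
    and le: "\<And>p. p \<in> D \<Longrightarrow> Re (ip (T p) p) \<le> (nrm p)\<^sup>2"
    and p: "p \<in> D"
  shows "nrm (T p) \<le> nrm p"
proof -
  have DH: "x \<in> H" if "x \<in> D" for x using D that by blast
  interpret t: semi_inner scale D "\<lambda>p q. ip (T p) q"
  proof unfold_locales
    show "subspace D" by fact
    show "ip (T y) x = cnj (ip (T x) y)" if "x \<in> D" "y \<in> D" for x y
      using sym[OF that(2,1)] ip_cnj[of "T x" y] DH T that by simp
  qed (use DH T add scale pos in \<open>auto simp: ip_simps\<close>)
  have tn: "t.nrm x \<le> nrm x" if "x \<in> D" for x
    using le[OF that] pos[OF that] DH[OF that] by (simp add: t.nrm_def real_le_lsqrt nrm_def ip_nonneg nrm_sq)
  have m: "p \<in> H" "T p \<in> D" "T p \<in> H" using p T DH by auto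
  have "nrm (T p) * nrm (T p) = cmod (ip (T p) (T p))"
    using m by (simp add: ip_self power2_eq_square norm_mult)
  also have "\<dots> \<le> t.nrm p * t.nrm (T p)" by (rule t.cauchy_schwarz[OF p m(2)])
  also have "\<dots> \<le> nrm p * nrm (T p)"
    using p m by (intro mult_mono tn) auto
  finally show ?thesis using m nrm_nonneg[OF m(3)] by (cases "nrm (T p) = 0") auto
qed

end

section \<open>Compactly supported positive definite functions\<close>

text \<open>Continuity is demanded at the identity alone; Krein's inequality spreads it uniformly
  over the group.\<close>

locale positive_definite = haar_group +
  fixes \<phi> :: "'a \<Rightarrow> complex" and K :: "'a set"
  assumes pd: "\<And>n (x :: nat \<Rightarrow> 'a) z. \<exists>r\<ge>0. (\<Sum>i<n. \<Sum>j<n. z i * cnj (z j) * \<phi> (- x j + x i)) = of_real r"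
    and cont0: "\<And>e. e > 0 \<Longrightarrow> \<forall>\<^sub>F x in nhds 0. cmod (\<phi> x - \<phi> 0) < e"
    and K: "compact K" and supp: "\<And>x. x \<notin> K \<Longrightarrow> \<phi> x = 0"
begin

section \<open>Inequalities for positive definite functions\<close>

definition k :: "'a \<Rightarrow> 'a \<Rightarrow> complex" where "k x y = \<phi> (- y + x)"

definition \<phi>0 :: real where "\<phi>0 = Re (\<phi> 0)"

lemma phi0: "\<phi> 0 = of_real \<phi>0" "0 \<le> \<phi>0"
proof -
  obtain r where "r \<ge> 0" "\<phi> 0 = of_real r"
    using pd[of "\<lambda>_. 1" "\<lambda>_. 0" 1] by auto
  then show "\<phi> 0 = of_real \<phi>0" "0 \<le> \<phi>0" by (auto simp: \<phi>0_def)
qed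

lemma kxx: "k x x = of_real \<phi>0"
  by (simp add: k_def phi0)

lemma pd2: "\<exists>r\<ge>0. of_real ((cmod a)\<^sup>2 * \<phi>0 + (cmod b)\<^sup>2 * \<phi>0) + a * cnj b * k x y + b * cnj a * k y x = of_real r"
proof -
  define z where "z i = (if i = 0 then a else b)" for i :: nat
  define u where "u i = (if i = 0 then x else y)" for i :: nat
  obtain r where r: "r \<ge> 0" "(\<Sum>i<2. \<Sum>j<2. z i * cnj (z j) * \<phi> (- u j + u i)) = of_real r"
    using pd[of z u 2] by blast
  have "(\<Sum>i<2. \<Sum>j<2. z i * cnj (z j) * \<phi> (- u j + u i))
    = (a * cnj a) * \<phi> 0 + (b * cnj b) * \<phi> 0 + a * cnj b * k x y + b * cnj a * k y x"
    by (simp add: numeral_2_eq_2 lessThan_Suc k_def z_def u_def)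
  also have "\<dots> = of_real ((cmod a)\<^sup>2 * \<phi>0 + (cmod b)\<^sup>2 * \<phi>0) + a * cnj b * k x y + b * cnj a * k y x"
    by (simp only: complex_norm_square[symmetric] phi0 of_real_mult of_real_add)
  finally show ?thesis using r by (intro exI[of _ r]) simp
qed

text \<open>Reality of the two-point form with coefficients (1, 1) and (\<i>, 1) gives the imaginary
  and the real part.\<close>

lemma k_herm: "k y x = cnj (k x y)"
proof -
  obtain r where r: "of_real ((cmod 1)\<^sup>2 * \<phi>0 + (cmod 1)\<^sup>2 * \<phi>0) + 1 * cnj 1 * k x y + 1 * cnj 1 * k y x = of_real r"
    using pd2[of 1 1 x y] by blast
  obtain s where s: "of_real ((cmod \<i>)\<^sup>2 * \<phi>0 + (cmod 1)\<^sup>2 * \<phi>0) + \<i> * cnj 1 * k x y + 1 * cnj \<i> * k y x = of_real s"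
    using pd2[of \<i> 1 x y] by blast
  have "Im (k x y) + Im (k y x) = 0" using arg_cong[OF r, of Im] by simp
  moreover have "Re (k x y) - Re (k y x) = 0" using arg_cong[OF s, of Im] by simp
  ultimately show ?thesis by (simp add: complex_eq_iff)
qed

text \<open>The two-point form with coefficients 1 and - s k x y, where s = 1 / (\<phi>0 + 1). The
  shift by 1 keeps s defined when \<phi>0 = 0.\<close>

lemma k_bounded: "cmod (k x y) \<le> \<phi>0 + 1"
proof -
  define s where "s = 1 / (\<phi>0 + 1)"
  have s: "s > 0" "s * \<phi>0 \<le> 1" "s * (\<phi>0 + 1) = 1" using phi0(2) by (auto simp: s_def field_simps)
  let ?q = "(cmod (k x y))\<^sup>2"
  obtain r where r: "r \<ge> 0" "of_real ((cmod 1)\<^sup>2 * \<phi>0 + (cmod (- of_real s * k x y))\<^sup>2 * \<phi>0)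
      + 1 * cnj (- of_real s * k x y) * k x y + (- of_real s * k x y) * cnj 1 * k y x = of_real r"
    using pd2[of 1 "- of_real s * k x y" x y] by blast
  have "of_real r = complex_of_real (\<phi>0 + s\<^sup>2 * ?q * \<phi>0) - of_real s * (k x y * cnj (k x y)) - of_real s * (k x y * cnj (k x y))"
    unfolding r(2)[symmetric] k_herm[of y x] by (simp add: norm_mult power_mult_distrib mult_ac)
  also have "\<dots> = of_real (\<phi>0 + s\<^sup>2 * ?q * \<phi>0 - 2 * s * ?q)"
    unfolding complex_norm_square[symmetric] by simp
  finally have "r = \<phi>0 + s\<^sup>2 * ?q * \<phi>0 - 2 * s * ?q" using of_real_eq_iff by blast
  then have "2 * s * ?q \<le> \<phi>0 + s * ?q * (s * \<phi>0)" using r(1) by (simp add: power2_eq_square mult_ac)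
  also have "\<dots> \<le> \<phi>0 + s * ?q * 1" using s by (intro add_left_mono mult_left_mono) auto
  finally have "s * ?q \<le> \<phi>0" by simp
  then have "(\<phi>0 + 1) * (s * ?q) \<le> (\<phi>0 + 1) * \<phi>0" using phi0(2) by (intro mult_left_mono) auto
  also have "(\<phi>0 + 1) * (s * ?q) = ?q" using s(3) by (metis mult.assoc mult.commute mult_1)
  also have "(\<phi>0 + 1) * \<phi>0 \<le> (\<phi>0 + 1)\<^sup>2" using phi0(2) by (simp add: power2_eq_square algebra_simps)
  finally show ?thesis using phi0(2) by (simp add: power2_le_iff_abs_le)
qed

text \<open>Krein's inequality: positivity at the points a, a', y with coefficients 1, -1, - s d,
  where d is the difference to be estimated. Again s = 1 / (\<phi>0 + 1) stands in for the optimal 1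
  / \<phi>0.\<close>

lemma krein: "(cmod (k a y - k a' y))\<^sup>2 \<le> 2 * (\<phi>0 + 1) * cmod (\<phi> (- a' + a) - \<phi> 0)"
proof -
  define s where "s = 1 / (\<phi>0 + 1)"
  have s: "s > 0" "s * \<phi>0 \<le> 1" "s * (\<phi>0 + 1) = 1" using phi0(2) by (auto simp: s_def field_simps)
  define d where "d = k a y - k a' y"
  let ?q = "(cmod d)\<^sup>2"
  define l where "l = of_real s * d"
  define z where "z i = (if i = 0 then 1 else if i = Suc 0 then -1 else - l)" for i :: nat
  define x where "x i = (if i = 0 then a else if i = Suc 0 then a' else y)" for i :: nat
  obtain r where r: "r \<ge> 0" "(\<Sum>i<3. \<Sum>j<3. z i * cnj (z j) * \<phi> (- x j + x i)) = of_real r"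
    using pd[of z x 3] by blast
  have "(\<Sum>i<3. \<Sum>j<3. z i * cnj (z j) * \<phi> (- x j + x i)) = (\<Sum>i<3. \<Sum>j<3. z i * cnj (z j) * k (x i) (x j))"
    by (simp add: k_def)
  also have "\<dots> = k a a + k a' a' - k a a' - k a' a - cnj l * d - l * (k y a - k y a') + l * cnj l * k y y"
    by (simp add: numeral_3_eq_3 lessThan_Suc z_def x_def d_def algebra_simps)
  also have "\<dots> = of_real (2 * \<phi>0) - (k a a' + cnj (k a a')) - cnj l * d - l * cnj d + l * cnj l * of_real \<phi>0"
    unfolding kxx k_herm[of a' a] k_herm[of y a] k_herm[of y a'] by (simp add: d_def)
  also have "\<dots> = of_real (2 * \<phi>0 - 2 * Re (k a a') - 2 * s * ?q + s\<^sup>2 * ?q * \<phi>0)"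
  proof -
    have "cnj l * d = of_real (s * ?q)" "l * cnj d = of_real (s * ?q)" "l * cnj l = of_real (s\<^sup>2 * ?q)"
      unfolding l_def of_real_mult complex_norm_square by (simp_all add: power2_eq_square mult_ac)
    then show ?thesis by (simp add: complex_add_cnj)
  qed
  finally have "r = 2 * \<phi>0 - 2 * Re (k a a') - 2 * s * ?q + s\<^sup>2 * ?q * \<phi>0"
    using r(2) of_real_eq_iff[where 'a = complex] by metis
  then have "2 * s * ?q \<le> 2 * (\<phi>0 - Re (k a a')) + s * ?q * (s * \<phi>0)"
    using r(1) by (simp add: power2_eq_square mult_ac)
  also have "\<dots> \<le> 2 * (\<phi>0 - Re (k a a')) + s * ?q * 1"
    using s by (intro add_left_mono mult_left_mono) auto
  finally have "s * ?q \<le> 2 * (\<phi>0 - Re (k a a'))" by simp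
  also have "\<phi>0 - Re (k a a') \<le> cmod (\<phi> (- a' + a) - \<phi> 0)"
    using abs_Re_le_cmod[of "\<phi> (- a' + a) - \<phi> 0"] by (simp add: k_def \<phi>0_def)
  finally have "(\<phi>0 + 1) * (s * ?q) \<le> (\<phi>0 + 1) * (2 * cmod (\<phi> (- a' + a) - \<phi> 0))"
    using phi0(2) by (intro mult_left_mono) auto
  also have "(\<phi>0 + 1) * (s * ?q) = ?q" using s(3) by (metis mult.assoc mult.commute mult_1)
  finally show ?thesis by (simp add: d_def algebra_simps)
qed

lemma k_kernel: "uniform_kernel k"
  unfolding uniform_kernel_def
proof (intro conjI allI impI)
  show "\<exists>B. \<forall>x y. norm (k x y) \<le> B" using k_bounded by blast
  fix e :: real assume e: "e > 0"
  have "e\<^sup>2 / (2 * (\<phi>0 + 1)) > 0" using e phi0(2) by simp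
  from cont0[OF this] obtain V where V: "open V" "0 \<in> V" "\<And>v. v \<in> V \<Longrightarrow> cmod (\<phi> v - \<phi> 0) < e\<^sup>2 / (2 * (\<phi>0 + 1))"
    unfolding eventually_nhds by blast
  have *: "cmod (k x y - k x' y) \<le> e" if "- x' + x \<in> V" for x x' y
  proof (rule power2_le_imp_le)
    have "2 * (\<phi>0 + 1) * cmod (\<phi> (- x' + x) - \<phi> 0) \<le> 2 * (\<phi>0 + 1) * (e\<^sup>2 / (2 * (\<phi>0 + 1)))"
      using V(3)[OF that] phi0(2) by (intro mult_left_mono) auto
    also have "\<dots> = e\<^sup>2" using phi0(2) by simp
    finally show "(cmod (k x y - k x' y))\<^sup>2 \<le> e\<^sup>2" using krein order_trans by blast
  qed (use e in simp)
  have **: "cmod (k y x - k y x') \<le> e" if "- x' + x \<in> V" for x x' y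
    using *[OF that, of y] complex_mod_cnj[of "k x y - k x' y"] k_herm[of x y] k_herm[of x' y] by simp
  then show "\<exists>V. open V \<and> 0 \<in> V \<and> (\<forall>x x' y. - x' + x \<in> V \<longrightarrow> norm (k x y - k x' y) \<le> e \<and> norm (k y x - k y x') \<le> e)"
    by (intro exI[of _ V] conjI V allI impI * **)
qed

lemma indicator_integrable: "A \<in> fmeasurable M \<Longrightarrow> integrable M (indicator A :: 'a \<Rightarrow> complex)"
proof -
  assume "A \<in> fmeasurable M"
  then have "integrable M (\<lambda>x. complex_of_real (indicator A x))"
    by (intro integrable_of_real integrable_real_indicator) (auto simp: fmeasurable_def)
  moreover have "(\<lambda>x. complex_of_real (indicator A x)) = indicator A" by (simp add: indicator_def fun_eq_iff)
  ultimately show ?thesis by simp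
qed

lemma phi_continuous: "continuous_on UNIV \<phi>"
  using uniform_kernel_continuous(1)[OF k_kernel, of 0] by (simp add: k_def)

lemma phi_measurable: "\<phi> \<in> borel_measurable M"
  by (rule continuous_measurable[OF phi_continuous])

lemma phi_integrable: "integrable M \<phi>"
proof -
  have "integrable M (\<lambda>x. indicator K x * \<phi> x)"
  proof (rule integrable_mult_bounded)
    show "integrable M (indicator K :: 'a \<Rightarrow> complex)"
      by (rule indicator_integrable[OF fmeasurable_compact[OF K]])
    show "norm (\<phi> x) \<le> \<phi>0 + 1" for x using k_bounded[of x 0] by (simp add: k_def)
  qed (rule phi_measurable)
  moreover have "(\<lambda>x. indicator K x * \<phi> x) = \<phi>" using supp by (auto simp: indicator_def fun_eq_iff)
  ultimately show ?thesis by simp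
qed

text \<open>By Schur's test the integral bounds the convolution operator \<Phi> defined below; the
  added 1 permits division when \<phi> = 0.\<close>

definition \<kappa> :: real where "\<kappa> = (LINT x|M. cmod (\<phi> x)) + 1"

lemma kappa_pos: "\<kappa> > 0" "(LINT x|M. cmod (\<phi> x)) \<le> \<kappa>"
proof -
  have "0 \<le> (LINT x|M. cmod (\<phi> x))" by simp
  then show "\<kappa> > 0" "(LINT x|M. cmod (\<phi> x)) \<le> \<kappa>" unfolding \<kappa>_def by linarith+
qed

lemma k_norm_integral:
  "(LINT x|M. cmod (k x y)) = (LINT x|M. cmod (\<phi> x))" "integrable M (\<lambda>x. cmod (k x y))"
  unfolding k_def
  using integral_translate[of "\<lambda>x. cmod (\<phi> x)" "- y"] integrable_translate[of "\<lambda>x. cmod (\<phi> x)" "- y"]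
    phi_integrable by auto

text \<open>Hermitian symmetry exchanges the variables, so left invariance computes this integral
  too and no modular function enters.\<close>

lemma k_norm_integral':
  "(LINT y|M. cmod (k x y)) = (LINT x|M. cmod (\<phi> x))" "integrable M (\<lambda>y. cmod (k x y))"
proof -
  have "cmod (k x y) = cmod (k y x)" for y using k_herm[of x y] by simp
  then have "(\<lambda>y. cmod (k x y)) = (\<lambda>y. cmod (k y x))" by blast
  then show "(LINT y|M. cmod (k x y)) = (LINT x|M. cmod (\<phi> x))" "integrable M (\<lambda>y. cmod (k x y))"
    using k_norm_integral[of x] by simp_all
qed

section \<open>Convolution by \<phi> as a positive operator on L2\<close>

definition l2c :: "('a \<Rightarrow> complex) set" where
  "l2c = {p \<in> l2 M. \<exists>C. compact C \<and> (\<forall>x. x \<notin> C \<longrightarrow> p x = 0)}"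

lemma l2c_l2: "l2c \<subseteq> l2 M"
  by (auto simp: l2c_def)

text \<open>On a compact support C one has |p| \<le> |p|^2 + 1 with C of finite measure, so square
  integrability implies integrability.\<close>

lemma l2c_integrable: assumes p: "p \<in> l2c" shows "integrable M p"
proof -
  obtain C where C: "compact C" "\<And>x. x \<notin> C \<Longrightarrow> p x = 0" and l: "p \<in> l2 M" using p by (auto simp: l2c_def)
  show ?thesis
  proof (rule Bochner_Integration.integrable_bound)
    show "integrable M (\<lambda>x. (cmod (p x))\<^sup>2 + indicator C x)"
      using fmeasurable_compact[OF C(1)]
      by (intro Bochner_Integration.integrable_add l2_integrable[OF l] integrable_real_indicator)
        (auto simp: fmeasurable_def)
    show "p \<in> borel_measurable M" by (rule l2_measurable[OF l])
    have "cmod (p x) \<le> (cmod (p x))\<^sup>2 + indicator C x" for x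
    proof (cases "x \<in> C")
      case True
      have "2 * cmod (p x) \<le> (cmod (p x))\<^sup>2 + 1" using sum_squares_bound[of "cmod (p x)" 1] by simp
      then have "cmod (p x) \<le> (cmod (p x))\<^sup>2 + 1" using norm_ge_zero[of "p x"] by linarith
      then show ?thesis using True by simp
    qed (use C in simp)
    then show "AE x in M. norm (p x) \<le> norm ((cmod (p x))\<^sup>2 + indicator C x)"
      by (auto intro!: AE_I2 order_trans[OF _ abs_ge_self])
  qed
qed

lemma l2c_subspace: "fs.subspace l2c"
proof (rule fs.subspaceI)
  show "0 \<in> l2c" by (auto simp: l2c_def l2_zero intro: exI[of _ "{}"])
next
  fix p q assume "p \<in> l2c" "q \<in> l2c"
  then obtain C C' where "compact C" "compact C'" "p \<in> l2 M" "q \<in> l2 M"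
    "\<forall>x. x \<notin> C \<longrightarrow> p x = 0" "\<forall>x. x \<notin> C' \<longrightarrow> q x = 0" by (auto simp: l2c_def)
  then show "p + q \<in> l2c"
    by (auto simp: l2c_def l2_add intro!: exI[of _ "C \<union> C'"] compact_Un)
next
  fix c p assume "p \<in> l2c"
  then show "fscale c p \<in> l2c" by (auto simp: l2c_def l2_fscale)
qed

lemma l2c_translate: assumes p: "p \<in> l2c" shows "left_regular z p \<in> l2c"
proof -
  obtain C where C: "compact C" "\<And>x. x \<notin> C \<Longrightarrow> p x = 0" and l: "p \<in> l2 M" using p by (auto simp: l2c_def)
  have "compact ((\<lambda>y. z + y) ` C)"
    by (intro compact_continuous_image C continuous_on_subset[OF continuous_translate]) auto
  moreover have "left_regular z p x = 0" if "x \<notin> (\<lambda>y. z + y) ` C" for x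
    using that C(2)[of "- z + x"] by (auto simp: left_regular_def translate_image[where x = z and A = C])
  ultimately show ?thesis using left_regular_l2[OF l] by (auto simp: l2c_def)
qed

text \<open>Since \<phi> is Hermitian this is p * cnj \<phi>, a convolution from the right, and so
  it commutes with left translations. Its quadratic form is the integral version of the sums in
  \<open>pd\<close>.\<close>

definition \<Phi> :: "('a \<Rightarrow> complex) \<Rightarrow> 'a \<Rightarrow> complex" where
  "\<Phi> p y = (LINT x|M. p x * k x y)"

lemma Phi_integrable: "integrable M p \<Longrightarrow> integrable M (\<lambda>x. p x * k x y)"
  by (rule integrable_mult_bounded[OF _ continuous_measurable[OF uniform_kernel_continuous(1)[OF k_kernel]] k_bounded])

lemma Phi_l2c: assumes p: "p \<in> l2c" shows "\<Phi> p \<in> l2c"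
proof -
  obtain C where C: "compact C" "\<And>x. x \<notin> C \<Longrightarrow> p x = 0" and l: "p \<in> l2 M" using p by (auto simp: l2c_def)
  note ip = l2c_integrable[OF p]
  \<comment> \<open>A non-zero integrand has x in C and - y + x in K, so y = x - (- y + x) lies in C
    - K.\<close>
  define C' where "C' = (\<lambda>q. fst q - snd q) ` (C \<times> K)"
  have C': "compact C'" unfolding C'_def
    by (intro compact_continuous_image compact_Times C K continuous_intros)
  have 0: "\<Phi> p y = 0" if y: "y \<notin> C'" for y
  proof -
    have "p x * k x y = 0" for x
    proof (rule ccontr)
      assume "p x * k x y \<noteq> 0"
      then have "x \<in> C" "- y + x \<in> K" using C(2) supp by (auto simp: k_def)
      moreover have "y = x - (- y + x)"
        by (simp only: diff_conv_add_uminus minus_add minus_minus) (simp add: add.assoc[symmetric])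
      ultimately show False using y unfolding C'_def by force
    qed
    then have "(\<lambda>x. p x * k x y) = (\<lambda>x. 0)" by blast
    then show ?thesis by (simp only: \<Phi>_def) simp
  qed
  obtain B where B: "\<And>y. cmod (\<Phi> p y) \<le> B"
    using kernel_transform_bounded[OF k_kernel ip] unfolding \<Phi>_def by blast
  have m: "\<Phi> p \<in> borel_measurable M"
    using continuous_measurable[OF kernel_transform_continuous[OF k_kernel ip]] by (simp add: \<Phi>_def[abs_def])
  have "integrable M (\<lambda>y. (cmod (\<Phi> p y))\<^sup>2)"
  proof (rule Bochner_Integration.integrable_bound)
    show "integrable M (\<lambda>y. B\<^sup>2 * indicator C' y)"
      using fmeasurable_compact[OF C'] by (intro integrable_mult_right integrable_real_indicator) (auto simp: fmeasurable_def)
    show "(\<lambda>y. (cmod (\<Phi> p y))\<^sup>2) \<in> borel_measurable M" using m by simp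
    have "norm ((cmod (\<Phi> p y))\<^sup>2) \<le> norm (B\<^sup>2 * indicator C' y)" for y
      using power_mono[OF B[of y] norm_ge_zero, of 2] 0[of y] by (cases "y \<in> C'") auto
    then show "AE y in M. norm ((cmod (\<Phi> p y))\<^sup>2) \<le> norm (B\<^sup>2 * indicator C' y)" by simp
  qed
  then show ?thesis using m C' 0 by (auto simp: l2c_def l2_def)
qed

lemma Phi_add: "p \<in> l2c \<Longrightarrow> q \<in> l2c \<Longrightarrow> \<Phi> (p + q) = \<Phi> p + \<Phi> q"
  using Phi_integrable[OF l2c_integrable] by (simp add: \<Phi>_def fun_eq_iff distrib_right)

lemma Phi_scale: "\<Phi> (fscale c p) = fscale c (\<Phi> p)"
  by (simp add: \<Phi>_def fun_eq_iff mult.assoc)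

lemma Phi_translate: assumes p: "p \<in> l2c" shows "\<Phi> (left_regular z p) = left_regular z (\<Phi> p)"
proof
  fix y
  have m: "(\<lambda>x. left_regular z p x * k x y) \<in> borel_measurable M"
    using Phi_integrable[OF l2c_integrable[OF l2c_translate[OF p]]] by (rule borel_measurable_integrable)
  have eq: "- y + (z + x) = - (- z + y) + x" for x
    by (simp only: minus_add minus_minus add.assoc)
  have "\<Phi> (left_regular z p) y = (LINT x|M. left_regular z p (z + x) * k (z + x) y)"
    unfolding \<Phi>_def by (rule integral_translate[OF m, symmetric])
  also have "\<dots> = (LINT x|M. p x * k x (- z + y))"
    unfolding k_def eq by (simp add: left_regular_def add.assoc[symmetric])
  finally show "\<Phi> (left_regular z p) y = left_regular z (\<Phi> p) y" by (simp add: \<Phi>_def left_regular_def)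
qed

lemma Phi_inner: "l2_inner M (\<Phi> p) q = (LINT y|M. cnj (q y) * (LINT x|M. p x * k x y))"
  by (simp add: l2_inner_def \<Phi>_def mult.commute)

lemma Phi_sym: assumes p: "p \<in> l2c" and q: "q \<in> l2c" shows "l2_inner M (\<Phi> p) q = l2_inner M p (\<Phi> q)"
proof -
  obtain C C' where C: "compact C" "compact C'" "\<forall>x. x \<notin> C \<longrightarrow> p x = 0" "\<forall>x. x \<notin> C' \<longrightarrow> q x = 0"
    using p q by (auto simp: l2c_def)
  have eq: "(LINT y|M. cnj (q y) * k x y) = cnj (\<Phi> q x)" for x
    unfolding \<Phi>_def by (subst Bochner_Integration.integral_cnj[symmetric]) (simp add: k_herm[of x])
  have "l2_inner M (\<Phi> p) q = (LINT x|M. p x * (LINT y|M. cnj (q y) * k x y))"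
    unfolding Phi_inner
    by (rule kernel_fubini[OF k_kernel compact_Un[OF C(1,2)]]) (use C l2c_integrable[OF p] l2c_integrable[OF q] in auto)
  also have "\<dots> = (LINT x|M. p x * cnj (\<Phi> q x))" by (simp only: eq)
  finally show ?thesis by (simp add: l2_inner_def)
qed

text \<open>A Riemann sum with the same nodes in both variables is a positive definite sum whose
  coefficients are the integrals of p over the cells, and the inner product is a limit of such
  sums.\<close>

lemma Phi_nonneg: assumes p: "p \<in> l2c" shows "0 \<le> Re (l2_inner M (\<Phi> p) p)"
proof -
  obtain C where C: "compact C" "\<And>x. x \<notin> C \<Longrightarrow> p x = 0" using p by (auto simp: l2c_def)
  note ip = l2c_integrable[OF p]
  let ?N = "LINT x|M. cmod (p x)"
  have "- (2 * e * ?N * ?N) \<le> Re (l2_inner M (\<Phi> p) p)" if e: "e > 0" for e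
  proof -
    from kernel_riemann_sum[OF k_kernel C(1) e] obtain n A a where
      "\<forall>k' p q. k' = k \<or> k' = (\<lambda>x y. k y x) \<longrightarrow> integrable M p \<longrightarrow> integrable M q \<longrightarrow>
        (\<forall>x. x \<notin> C \<longrightarrow> p x = 0) \<longrightarrow> (\<forall>x. x \<notin> C \<longrightarrow> q x = 0) \<longrightarrow>
        norm ((LINT y|M. q y * (LINT x|M. p x * k' x y)) - riemann_sum k' n A a p q)
        \<le> 2 * e * (LINT x|M. norm (p x)) * (LINT x|M. norm (q x))"
      by blast
    note * = this[rule_format]
    have "cmod ((LINT y|M. cnj (p y) * (LINT x|M. p x * k x y)) - riemann_sum k n A a p (\<lambda>y. cnj (p y)))
        \<le> 2 * e * (LINT x|M. cmod (p x)) * (LINT x|M. cmod (cnj (p x)))"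
      by (rule *) (use ip C in auto)
    then have le: "cmod (l2_inner M (\<Phi> p) p - riemann_sum k n A a p (\<lambda>y. cnj (p y))) \<le> 2 * e * ?N * ?N"
      by (simp add: Phi_inner)
    define P where "P i = (LINT x|M. indicator (A i) x * p x)" for i
    have cP: "(LINT y|M. indicator (A j) y * cnj (p y)) = cnj (P j)" for j
      unfolding P_def by (subst Bochner_Integration.integral_cnj[symmetric]) (auto simp: indicator_def intro!: Bochner_Integration.integral_cong)
    have "riemann_sum k n A a p (\<lambda>y. cnj (p y)) = (\<Sum>j<n. \<Sum>i<n. P i * cnj (P j) * \<phi> (- a j + a i))"
      unfolding riemann_sum_def cP P_def[symmetric] by (simp add: sum_distrib_left k_def mult_ac)
    also have "\<dots> = (\<Sum>i<n. \<Sum>j<n. P i * cnj (P j) * \<phi> (- a j + a i))" by (rule sum.swap)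
    finally have rs: "riemann_sum k n A a p (\<lambda>y. cnj (p y)) = (\<Sum>i<n. \<Sum>j<n. P i * cnj (P j) * \<phi> (- a j + a i))" .
    obtain r where "r \<ge> 0" "riemann_sum k n A a p (\<lambda>y. cnj (p y)) = of_real r"
      using pd[of P a n] unfolding rs by blast
    then show ?thesis
      using le abs_Re_le_cmod[of "l2_inner M (\<Phi> p) p - of_real r"] by simp
  qed
  note le = this
  show ?thesis
  proof (rule field_le_epsilon)
    fix e :: real assume e: "e > 0"
    let ?K = "2 * ?N * ?N"
    have K: "0 \<le> ?K" by (intro mult_nonneg_nonneg) simp_all
    have "e / (?K + 1) > 0" using e K by (intro divide_pos_pos) linarith+
    from le[OF this] have "- (e / (?K + 1) * ?K) \<le> Re (l2_inner M (\<Phi> p) p)" by (simp add: mult_ac)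
    moreover have "e / (?K + 1) * ?K \<le> e / (?K + 1) * (?K + 1)"
      using \<open>e / (?K + 1) > 0\<close> by (intro mult_left_mono) simp_all
    moreover have "e / (?K + 1) * (?K + 1) = e"
      using K by (smt (verit) nonzero_mult_div_cancel_right times_divide_eq_left)
    ultimately show "0 \<le> Re (l2_inner M (\<Phi> p) p) + e" by linarith
  qed
qed

text \<open>Schur's test: \<open>2 |p x| |p y| \<le> |p x|\<^sup>2 + |p y|\<^sup>2\<close> inside the double integral.\<close>

lemma Phi_bounded: assumes p: "p \<in> l2c" shows "Re (l2_inner M (\<Phi> p) p) \<le> \<kappa> * (l2_norm M p)\<^sup>2"
proof -
  obtain C where C: "compact C" "\<And>x. x \<notin> C \<Longrightarrow> p x = 0" using p by (auto simp: l2c_def)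
  note ip = l2c_integrable[OF p]
  have pl: "p \<in> l2 M" "\<Phi> p \<in> l2 M" using p Phi_l2c l2c_l2 by auto
  note ip2 = l2_integrable[OF pl(1)]
  let ?I = "LINT x|M. cmod (\<phi> x)"
  note kr = uniform_kernel_norm[OF k_kernel]
  define G where "G y = (LINT x|M. (cmod (p x))\<^sup>2 * cmod (k x y))" for y
  have krb: "norm (cmod (k x y)) \<le> \<phi>0 + 1" for x y using k_bounded by simp
  have krm: "(\<lambda>x. cmod (k x y)) \<in> borel_measurable M" "(\<lambda>y. cmod (k x y)) \<in> borel_measurable M" for x y
    using continuous_measurable[OF uniform_kernel_continuous(1)[OF kr]]
      continuous_measurable[OF uniform_kernel_continuous(2)[OF kr]] by auto
  have Gi: "integrable M (\<lambda>x. (cmod (p x))\<^sup>2 * cmod (k x y))" for y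
    by (rule integrable_mult_bounded[OF ip2 krm(1) krb])
  have Cf: "integrable M (indicator C :: 'a \<Rightarrow> real)"
    using fmeasurable_compact[OF C(1)] by (intro integrable_real_indicator) (auto simp: fmeasurable_def)
  obtain B where B: "\<And>y. norm (G y) \<le> B" using kernel_transform_bounded[OF kr ip2] unfolding G_def by blast
  have Gm: "G \<in> borel_measurable M"
    using continuous_measurable[OF kernel_transform_continuous[OF kr ip2]] by (simp add: G_def[abs_def])
  have iCG: "integrable M (\<lambda>y. indicator C y * G y)" by (rule integrable_mult_bounded[OF Cf Gm B])
  \<comment> \<open>The factor \<open>indicator C y\<close> is harmless because p vanishes off C,
    and it gives the compact support in y that \<open>kernel_fubini\<close> asks for.\<close>
  have pointwise: "cmod (\<Phi> p y * cnj (p y)) \<le> (indicator C y * G y + ?I * (cmod (p y))\<^sup>2) / 2" for y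
  proof (cases "y \<in> C")
    case True
    have "cmod (\<Phi> p y) * cmod (p y) \<le> (LINT x|M. cmod (p x * k x y)) * cmod (p y)"
      unfolding \<Phi>_def by (intro mult_right_mono Bochner_Integration.integral_norm_bound) simp
    also have "\<dots> = (LINT x|M. cmod (p x) * cmod (p y) * cmod (k x y))"
      by (simp add: norm_mult mult_ac flip: integral_mult_right_zero)
    also have "\<dots> \<le> (LINT x|M. ((cmod (p x))\<^sup>2 * cmod (k x y) + (cmod (p y))\<^sup>2 * cmod (k x y)) / 2)"
    proof (rule Bochner_Integration.integral_mono)
      have "integrable M (\<lambda>x. cmod (p x * k x y) * cmod (p y))"
        using Phi_integrable[OF ip, of y] by simp
      then show "integrable M (\<lambda>x. cmod (p x) * cmod (p y) * cmod (k x y))"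
        by (simp add: norm_mult mult_ac)
      show "integrable M (\<lambda>x. ((cmod (p x))\<^sup>2 * cmod (k x y) + (cmod (p y))\<^sup>2 * cmod (k x y)) / 2)"
        using Gi k_norm_integral(2) by simp
      fix x
      have "cmod (p x) * cmod (p y) \<le> ((cmod (p x))\<^sup>2 + (cmod (p y))\<^sup>2) / 2"
        using sum_squares_bound[of "cmod (p x)" "cmod (p y)"] by simp
      then have "cmod (p x) * cmod (p y) * cmod (k x y) \<le> ((cmod (p x))\<^sup>2 + (cmod (p y))\<^sup>2) / 2 * cmod (k x y)"
        by (intro mult_right_mono) auto
      then show "cmod (p x) * cmod (p y) * cmod (k x y) \<le> ((cmod (p x))\<^sup>2 * cmod (k x y) + (cmod (p y))\<^sup>2 * cmod (k x y)) / 2"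
        by (simp add: distrib_right)
    qed
    also have "\<dots> = (G y + (cmod (p y))\<^sup>2 * ?I) / 2"
      using Gi k_norm_integral by (simp add: G_def)
    finally show ?thesis using True by (simp add: norm_mult mult.commute)
  next
    case False
    then show ?thesis using C(2)[of y] by simp
  qed
  have "Re (l2_inner M (\<Phi> p) p) \<le> cmod (LINT y|M. \<Phi> p y * cnj (p y))"
    unfolding l2_inner_def by (rule complex_Re_le_cmod)
  also have "\<dots> \<le> (LINT y|M. (indicator C y * G y + ?I * (cmod (p y))\<^sup>2) / 2)"
    by (rule integral_norm_le[OF l2_prod_integrable[OF pl(2,1)] _ pointwise]) (use iCG ip2 in simp)
  also have "\<dots> = ((LINT y|M. indicator C y * G y) + ?I * (l2_norm M p)\<^sup>2) / 2"
    using iCG ip2 by (simp add: l2_norm_def)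
  also have "(LINT y|M. indicator C y * G y) = (LINT x|M. (cmod (p x))\<^sup>2 * (LINT y|M. indicator C y * cmod (k x y)))"
    unfolding G_def by (rule kernel_fubini[OF kr C(1) ip2 _ Cf]) (use C in auto)
  also have "\<dots> \<le> (LINT x|M. (cmod (p x))\<^sup>2 * ?I)"
  proof (rule Bochner_Integration.integral_mono)
    have Ck: "(LINT y|M. indicator C y * cmod (k x y)) \<le> ?I" for x
      unfolding k_norm_integral'(1)[of x, symmetric]
      by (rule Bochner_Integration.integral_mono)
        (use integrable_mult_bounded[OF Cf krm(2) krb] k_norm_integral' in \<open>auto simp: indicator_def\<close>)
    then show "(cmod (p x))\<^sup>2 * (LINT y|M. indicator C y * cmod (k x y)) \<le> (cmod (p x))\<^sup>2 * ?I" for x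
      by (intro mult_left_mono) auto
    have "0 \<le> (LINT y|M. indicator C y * cmod (k x y))" for x by simp
    then have nb: "norm (LINT y|M. indicator C y * cmod (k x y)) \<le> ?I" for x using Ck by simp
    have "continuous_on UNIV (\<lambda>x. LINT y|M. indicator C y * cmod (k x y))"
      using kernel_transform_continuous[OF uniform_kernel_swap[OF kr] Cf] by simp
    from integrable_mult_bounded[OF ip2 continuous_measurable[OF this] nb]
    show "integrable M (\<lambda>x. (cmod (p x))\<^sup>2 * (LINT y|M. indicator C y * cmod (k x y)))" .
    show "integrable M (\<lambda>x. (cmod (p x))\<^sup>2 * ?I)" using ip2 by simp
  qed
  also have "(LINT x|M. (cmod (p x))\<^sup>2 * ?I) = ?I * (l2_norm M p)\<^sup>2" by (simp add: l2_norm_def mult.commute)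
  finally have "Re (l2_inner M (\<Phi> p) p) \<le> ?I * (l2_norm M p)\<^sup>2" by simp
  also have "\<dots> \<le> \<kappa> * (l2_norm M p)\<^sup>2" using kappa_pos by (intro mult_right_mono) auto
  finally show ?thesis .
qed

text \<open>Here 1 - defect = \<Phi> / \<kappa>, so the binomial series in \<open>defect\<close>
  produces a square root of \<Phi> / \<kappa>. Positivity of \<Phi> and Schur's bound place
  \<open>defect\<close> between 0 and 1.\<close>

definition defect :: "('a \<Rightarrow> complex) \<Rightarrow> 'a \<Rightarrow> complex" where
  "defect p = p - fscale (of_real (1 / \<kappa>)) (\<Phi> p)"

lemma defect_l2c: "p \<in> l2c \<Longrightarrow> defect p \<in> l2c"
  unfolding defect_def by (intro fs.subspace_diff[OF l2c_subspace] fs.subspace_scale[OF l2c_subspace] Phi_l2c)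

lemma defect_translate: "p \<in> l2c \<Longrightarrow> defect (left_regular z p) = left_regular z (defect p)"
  by (simp add: defect_def Phi_translate left_regular_diff left_regular_fscale)

lemma defect_inner:
  "p \<in> l2c \<Longrightarrow> q \<in> l2c \<Longrightarrow> l2_inner M (defect p) q = l2_inner M p q - of_real (1 / \<kappa>) * l2_inner M (\<Phi> p) q"
  unfolding defect_def using l2c_l2 Phi_l2c by (simp add: l2.ip_diff l2.ip_scale l2_fscale subset_iff)

lemma defect_sym: assumes p: "p \<in> l2c" and q: "q \<in> l2c" shows "l2_inner M (defect p) q = l2_inner M p (defect q)"
proof -
  have l: "p \<in> l2 M" "q \<in> l2 M" "\<Phi> q \<in> l2 M" using p q Phi_l2c l2c_l2 by auto
  show ?thesis
    unfolding defect_inner[OF p q] Phi_sym[OF p q] unfolding defect_def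
    using l by (simp add: l2.ip_diff_right l2.ip_scale_right l2_fscale)
qed

lemma defect_contraction: assumes p: "p \<in> l2c" shows "l2_norm M (defect p) \<le> l2_norm M p"
proof (rule l2.positive_contraction[OF l2c_subspace l2c_l2 defect_l2c _ _ defect_sym _ _ p])
  show "defect (p + q) = defect p + defect q" if "p \<in> l2c" "q \<in> l2c" for p q
    using that by (simp add: defect_def Phi_add fs.scale_right_distrib)
  show "defect (fscale c p) = fscale c (defect p)" for c p
    by (simp add: defect_def Phi_scale fs.scale_right_diff_distrib mult.commute)
  fix p assume p: "p \<in> l2c"
  have l: "p \<in> l2 M" using p l2c_l2 by blast
  have eq: "Re (l2_inner M (defect p) p) = (l2_norm M p)\<^sup>2 - Re (l2_inner M (\<Phi> p) p) / \<kappa>"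
    unfolding defect_inner[OF p p] by (simp add: l2_self)
  show "0 \<le> Re (l2_inner M (defect p) p)" using eq Phi_bounded[OF p] kappa_pos by (simp add: pos_divide_le_eq mult.commute)
  show "Re (l2_inner M (defect p) p) \<le> (l2_norm M p)\<^sup>2" using eq Phi_nonneg[OF p] kappa_pos by simp
qed

abbreviation R :: "nat \<Rightarrow> ('a \<Rightarrow> complex) \<Rightarrow> 'a \<Rightarrow> complex" where
  "R \<equiv> l2.sqrt_approx defect"

lemma R_mem: "p \<in> l2c \<Longrightarrow> R N p \<in> l2 M"
  by (rule l2.sqrt_approx_mem[OF l2c_l2 defect_l2c defect_sym defect_contraction])

text \<open>R N is a polynomial in \<open>defect\<close>, so it commutes with translations exactly
  and not just almost everywhere.\<close>

lemma R_translate: assumes p: "p \<in> l2c" shows "R N (left_regular z p) = left_regular z (R N p)"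
proof -
  have "(defect ^^ i) p \<in> l2c \<and> (defect ^^ i) (left_regular z p) = left_regular z ((defect ^^ i) p)" for i
    using p by (induction i) (auto simp: defect_l2c defect_translate)
  then show ?thesis
    unfolding l2.sqrt_approx_def by (simp add: fun_eq_iff sum_fun_apply left_regular_def)
qed

lemma R_inner:
  assumes p: "p \<in> l2c" and q: "q \<in> l2c"
  shows "(\<lambda>N. l2_inner M (R N p) (R N q)) \<longlonglongrightarrow> l2_inner M (\<Phi> p) q / of_real \<kappa>"
  using l2.sqrt_approx_ip[OF l2c_l2 defect_l2c defect_sym defect_contraction p q] by (simp add: defect_inner[OF p q])

lemma R_limit:
  assumes p: "p \<in> l2c"
  shows "\<exists>r\<in>l2 M. (\<lambda>N. l2_norm M (R N p - r)) \<longlonglongrightarrow> 0"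
  by (rule l2.complete) (use R_mem[OF p] l2.sqrt_approx_Cauchy[OF l2c_l2 defect_l2c defect_sym defect_contraction p] in auto)

section \<open>Approximate identities and Godement's theorem\<close>

definition small_set :: "real \<Rightarrow> 'a set \<Rightarrow> bool" where
  "small_set d V \<longleftrightarrow> V \<in> fmeasurable M \<and> measure M V > 0 \<and> (\<exists>C. compact C \<and> V \<subseteq> C) \<and>
    (\<forall>x y s. s \<in> V \<longrightarrow> cmod (k (x + s) y - k x y) \<le> d \<and> cmod (k x (y + s) - k x y) \<le> d)"

lemma small_set_exists:
  assumes e: "e > 0" shows "\<exists>V. small_set e V"
proof -
  obtain V where V: "open V" "0 \<in> V"
    "\<And>x x' y. - x' + x \<in> V \<Longrightarrow> norm (k x y - k x' y) \<le> e \<and> norm (k y x - k y x') \<le> e"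
    using k_kernel e unfolding uniform_kernel_def by meson
  obtain W C :: "'a set" where W: "open W" "0 \<in> W" "W \<subseteq> C" "compact C" using compact_neighbourhood by blast
  have op: "open (V \<inter> W)" using V W by blast
  have f: "V \<inter> W \<in> fmeasurable M"
    by (rule fmeasurableI2[OF fmeasurable_compact[OF W(4)]]) (use W op in auto)
  have "emeasure M (V \<inter> W) > 0" by (rule open_positive[OF op]) (use V W in auto)
  then have "measure M (V \<inter> W) > 0" by (simp add: emeasure_eq_measure2[OF f] ennreal_less_zero_iff)
  moreover have "cmod (k (x + s) y - k x y) \<le> e \<and> cmod (k x (y + s) - k x y) \<le> e" if "s \<in> V \<inter> W" for x y s
    using V(3)[of x "x + s" y] V(3)[of y "y + s" x] that by (simp add: add.assoc[symmetric])
  ultimately show ?thesis unfolding small_set_def using f W by (intro exI[of _ "V \<inter> W"]) blast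
qed

definition bump :: "'a set \<Rightarrow> 'a \<Rightarrow> complex" where
  "bump V = fscale (of_real (1 / measure M V)) (indicator V)"

lemma bump_l2c:
  assumes "V \<in> fmeasurable M" "compact C" "V \<subseteq> C" shows "bump V \<in> l2c"
  using indicator_l2[OF assms(1)] assms(2,3)
  by (auto simp: l2c_def bump_def l2_fscale indicator_def intro!: exI[of _ C])

lemma bump_integral:
  assumes V: "V \<in> fmeasurable M" "measure M V > 0"
  shows "integrable M (bump V)" "(LINT x|M. bump V x) = 1" "(LINT x|M. cmod (bump V x)) = 1"
proof -
  have i: "integrable M (indicator V :: 'a \<Rightarrow> complex)" "integrable M (indicator V :: 'a \<Rightarrow> real)"
    using V indicator_integrable by (auto simp: fmeasurable_def intro!: integrable_real_indicator)
  have ci: "indicator V x = complex_of_real (indicator V x)" for x by (simp add: indicator_def)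
  show "integrable M (bump V)" using i by (simp add: bump_def fscale_def)
  show "(LINT x|M. bump V x) = 1"
    unfolding bump_def fscale_apply ci integral_mult_right_zero integral_complex_of_real using V by simp
  have "cmod (bump V x) = (1 / measure M V) * indicator V x" for x
    by (simp add: bump_def indicator_def norm_divide)
  then show "(LINT x|M. cmod (bump V x)) = 1" using V by simp
qed

lemma bump_average:
  assumes V: "V \<in> fmeasurable M" "measure M V > 0"
    and g: "g \<in> borel_measurable M" "\<And>x. cmod (g x) \<le> B'"
    and close: "\<And>x. x \<in> V \<Longrightarrow> cmod (g x - c) \<le> d"
  shows "cmod ((LINT x|M. bump V x * g x) - c) \<le> d"
proof -
  note i = bump_integral[OF V]
  have "(LINT x|M. bump V x * g x) - c = (LINT x|M. bump V x * g x) - (LINT x|M. bump V x * c)"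
    using i(2) by simp
  also have "\<dots> = (LINT x|M. bump V x * g x - bump V x * c)"
    using integrable_mult_bounded[OF i(1) g] i(1) by (subst Bochner_Integration.integral_diff) auto
  also have "cmod \<dots> \<le> (LINT x|M. d * cmod (bump V x))"
  proof (rule integral_norm_le)
    show "integrable M (\<lambda>x. bump V x * g x - bump V x * c)" using integrable_mult_bounded[OF i(1) g] i(1) by simp
    show "integrable M (\<lambda>x. d * cmod (bump V x))" using i(1) by simp
    show "cmod (bump V x * g x - bump V x * c) \<le> d * cmod (bump V x)" for x
    proof (cases "x \<in> V")
      case True
      have "cmod (bump V x * g x - bump V x * c) = cmod (bump V x) * cmod (g x - c)"
        by (simp add: right_diff_distrib[symmetric] norm_mult)
      also have "\<dots> \<le> cmod (bump V x) * d" by (intro mult_left_mono close True) simp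
      finally show ?thesis by (simp add: mult.commute)
    qed (simp add: bump_def)
  qed
  finally show ?thesis using i(3) by simp
qed

text \<open>After the substitution s \<mapsto> x + s the inner product is the average of k (x + s) y
  over s in V and y in W, to be compared with k x 0 = \<phi> x. The error d comes from s and d' from
  y.\<close>

lemma Phi_bump:
  assumes V: "V \<in> fmeasurable M" "measure M V > 0" "compact C" "V \<subseteq> C"
    and W: "W \<in> fmeasurable M" "measure M W > 0"
    and d: "\<And>x y s. s \<in> V \<Longrightarrow> cmod (k (x + s) y - k x y) \<le> d"
    and d': "\<And>x y s. s \<in> W \<Longrightarrow> cmod (k x (y + s) - k x y) \<le> d'"
  shows "cmod (l2_inner M (\<Phi> (left_regular x (bump V))) (bump W) - \<phi> x) \<le> d + d'"
proof -
  note Vl = bump_l2c[OF V(1,3,4)]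
  have inner: "cmod (\<Phi> (left_regular x (bump V)) y - k x y) \<le> d" for y
  proof -
    have m: "(\<lambda>s. left_regular x (bump V) s * k s y) \<in> borel_measurable M"
      using Phi_integrable[OF l2c_integrable[OF l2c_translate[OF Vl]]] by (rule borel_measurable_integrable)
    have "\<Phi> (left_regular x (bump V)) y = (LINT s|M. left_regular x (bump V) (x + s) * k (x + s) y)"
      unfolding \<Phi>_def by (rule integral_translate[OF m, symmetric])
    also have "\<dots> = (LINT s|M. bump V s * k (x + s) y)"
      by (simp add: left_regular_def add.assoc[symmetric])
    finally have eq: "\<Phi> (left_regular x (bump V)) y = (LINT s|M. bump V s * k (x + s) y)" .
    have "(\<lambda>s. k (x + s) y) \<in> borel_measurable M"
      by (rule measurable_compose[OF measurable_translate continuous_measurable[OF uniform_kernel_continuous(1)[OF k_kernel]]])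
    then show ?thesis unfolding eq by (rule bump_average[OF V(1,2) _ k_bounded d])
  qed
  have cnj_e: "cnj (bump W y) = bump W y" for y by (simp add: bump_def indicator_def)
  have Pl: "\<Phi> (left_regular x (bump V)) \<in> l2c" by (intro Phi_l2c l2c_translate Vl)
  obtain B' where B': "\<And>y. cmod (\<Phi> (left_regular x (bump V)) y) \<le> B'"
    using kernel_transform_bounded[OF k_kernel l2c_integrable[OF l2c_translate[OF Vl]]] unfolding \<Phi>_def by blast
  have Pm: "\<Phi> (left_regular x (bump V)) \<in> borel_measurable M" using Pl l2c_l2 l2_measurable by blast
  have close: "cmod (\<Phi> (left_regular x (bump V)) y - \<phi> x) \<le> d + d'" if "y \<in> W" for y
    using inner[of y] d'[OF that, of x 0] norm_triangle_ineq[of "\<Phi> (left_regular x (bump V)) y - k x y" "k x y - \<phi> x"]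
    by (simp add: k_def)
  have "cmod ((LINT y|M. bump W y * \<Phi> (left_regular x (bump V)) y) - \<phi> x) \<le> d + d'"
    by (rule bump_average[OF W Pm B' close])
  then show ?thesis by (simp add: l2_inner_def cnj_e mult.commute)
qed

text \<open>Godement's theorem: the square root of convolution by \<open>\<phi>\<close>, applied to an approximate identity,
  converges to a vector that represents \<open>\<phi>\<close>.\<close>

theorem positive_definite_coefficient: "\<exists>c\<in>l2 M. \<phi> = coefficient M c c"
proof -
  have "\<forall>n. \<exists>V. small_set (1 / (real n + 1)) V"
    by (intro allI small_set_exists) simp
  from choice[OF this] obtain V where "\<And>n. small_set (1 / (real n + 1)) (V n)" by blast
  then have V: "V n \<in> fmeasurable M" "measure M (V n) > 0" "\<exists>C. compact C \<and> V n \<subseteq> C"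
    "s \<in> V n \<Longrightarrow> cmod (k (x + s) y - k x y) \<le> 1 / (real n + 1)"
    "s \<in> V n \<Longrightarrow> cmod (k x (y + s) - k x y) \<le> 1 / (real n + 1)" for n x y s
    unfolding small_set_def by blast+
  define E where "E n = bump (V n)" for n
  have El: "E n \<in> l2c" for n using V(3)[of n] bump_l2c[OF V(1)] unfolding E_def by blast
  have est: "cmod (l2_inner M (\<Phi> (left_regular x (E n))) (E m) - \<phi> x) \<le> 1 / (real n + 1) + 1 / (real m + 1)" for x n m
  proof -
    obtain C where "compact C" "V n \<subseteq> C" using V(3)[of n] by blast
    then show ?thesis unfolding E_def by (intro Phi_bump[OF V(1,2) _ _ V(1,2) V(4) V(5)])
  qed
  have "\<forall>n. \<exists>r. r \<in> l2 M \<and> (\<lambda>N. l2_norm M (R N (E n) - r)) \<longlonglongrightarrow> 0" using R_limit[OF El] by blast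
  from choice[OF this] obtain r where r: "\<And>n. r n \<in> l2 M" "\<And>n. (\<lambda>N. l2_norm M (R N (E n) - r n)) \<longlonglongrightarrow> 0" by blast
  \<comment> \<open>r n plays the role of (\<Phi> / \<kappa>)^(1/2) E n. Translation passes through
    the square root, so its inner products involve \<Phi> alone.\<close>
  have r_ip: "l2_inner M (left_regular x (r n)) (r m) = l2_inner M (\<Phi> (left_regular x (E n))) (E m) / of_real \<kappa>" for x n m
  proof -
    have "(\<lambda>N. l2_inner M (left_regular x (R N (E n))) (R N (E m))) \<longlonglongrightarrow> l2_inner M (left_regular x (r n)) (r m)"
    proof (rule l2.ip_tendsto)
      have "l2_norm M (left_regular x (R N (E n)) - left_regular x (r n)) = l2_norm M (R N (E n) - r n)" for N
        unfolding left_regular_diff[symmetric] by (intro left_regular_norm l2.H_closed R_mem El r)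
      then show "(\<lambda>N. l2_norm M (left_regular x (R N (E n)) - left_regular x (r n))) \<longlonglongrightarrow> 0" using r(2) by simp
    qed (intro R_mem El r left_regular_l2)+
    moreover have "(\<lambda>N. l2_inner M (left_regular x (R N (E n))) (R N (E m))) \<longlonglongrightarrow>
        l2_inner M (\<Phi> (left_regular x (E n))) (E m) / of_real \<kappa>"
      using R_inner[OF l2c_translate[OF El] El] by (simp add: R_translate[OF El])
    ultimately show ?thesis by (rule LIMSEQ_unique)
  qed
  \<comment> \<open>The numbers Re (G i j) differ from \<phi>0 by at most 1/(i+1) + 1/(j+1); the
    errors of the three terms of |r n - r m|^2 add up to the factor 4.\<close>
  have diff: "(l2_norm M (r n - r m))\<^sup>2 \<le> (4 / \<kappa>) * (1 / (real n + 1) + 1 / (real m + 1))" for n m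
  proof -
    define G where "G i j = l2_inner M (\<Phi> (E i)) (E j)" for i j
    have Gr: "l2_inner M (r i) (r j) = G i j / of_real \<kappa>" for i j
      using r_ip[of 0 i j] by (simp add: left_regular_zero G_def)
    have "\<bar>Re (G i j) - \<phi>0\<bar> \<le> 1 / (real i + 1) + 1 / (real j + 1)" for i j
      using est[of 0 i j] abs_Re_le_cmod[of "G i j - \<phi> 0"] by (simp add: left_regular_zero G_def \<phi>0_def)
    then have Ge: "Re (G i j) \<le> \<phi>0 + (1 / (real i + 1) + 1 / (real j + 1))"
        "\<phi>0 - (1 / (real i + 1) + 1 / (real j + 1)) \<le> Re (G i j)" for i j
      by (simp_all add: abs_le_iff algebra_simps)
    have "(l2_norm M (r n - r m))\<^sup>2 = (Re (G n n) - 2 * Re (G n m) + Re (G m m)) / \<kappa>"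
      unfolding l2.nrm_diff_sq[OF r(1) r(1)]
      by (simp add: r l2.nrm_sq Gr diff_divide_distrib add_divide_distrib)
    also have "\<dots> \<le> (4 * (1 / (real n + 1) + 1 / (real m + 1))) / \<kappa>"
    proof (rule divide_right_mono)
      have lin: "g - 2 * g' + g'' \<le> 4 * (a + b)"
        if "g \<le> t + (a + a)" "t - (a + b) \<le> g'" "g'' \<le> t + (b + b)" for a b g g' g'' t :: real
        using that by argo
      show "Re (G n n) - 2 * Re (G n m) + Re (G m m) \<le> 4 * (1 / (real n + 1) + 1 / (real m + 1))"
        by (rule lin[OF Ge(1)[of n n] Ge(2)[of n m] Ge(1)[of m m]])
    qed (use kappa_pos(1) in simp)
    finally show ?thesis by simp
  qed
  have "\<exists>N. \<forall>m\<ge>N. \<forall>n\<ge>N. l2_norm M (r m - r n) < d" if d: "d > 0" for d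
  proof -
    obtain N :: nat where N: "8 / (\<kappa> * d\<^sup>2) < real N" using reals_Archimedean2 by blast
    have "l2_norm M (r i - r j) < d" if "i \<ge> N" "j \<ge> N" for i j
    proof (rule power2_less_imp_less)
      have "1 / (real i + 1) \<le> 1 / (real N + 1)" "1 / (real j + 1) \<le> 1 / (real N + 1)"
        using that by (auto intro!: divide_left_mono)
      then have "(4 / \<kappa>) * (1 / (real i + 1) + 1 / (real j + 1)) \<le> (4 / \<kappa>) * (2 * (1 / (real N + 1)))"
        using kappa_pos by (intro mult_left_mono) auto
      also have "\<dots> < d\<^sup>2"
      proof -
        have "8 < real N * (\<kappa> * d\<^sup>2)" using N kappa_pos d by (simp add: pos_divide_less_eq)
        also have "\<dots> \<le> (real N + 1) * (\<kappa> * d\<^sup>2)" using kappa_pos by (intro mult_right_mono) auto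
        finally have "8 / (\<kappa> * (real N + 1)) < d\<^sup>2"
          using kappa_pos(1) by (subst pos_divide_less_eq) (auto simp: mult_ac intro!: mult_pos_pos add_nonneg_pos)
        then show ?thesis by simp
      qed
      finally show "(l2_norm M (r i - r j))\<^sup>2 < d\<^sup>2" using diff[of i j] by linarith
    qed (use d in simp)
    then show ?thesis by blast
  qed
  then obtain c where c: "c \<in> l2 M" "(\<lambda>n. l2_norm M (r n - c)) \<longlonglongrightarrow> 0"
    using l2.complete[of r M] r by blast
  have coef: "l2_inner M (left_regular x c) c = \<phi> x / of_real \<kappa>" for x
  proof -
    have "(\<lambda>n. l2_inner M (left_regular x (r n)) (r n)) \<longlonglongrightarrow> l2_inner M (left_regular x c) c"
    proof (rule l2.ip_tendsto)
      have "l2_norm M (left_regular x (r n) - left_regular x c) = l2_norm M (r n - c)" for n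
        unfolding left_regular_diff[symmetric] by (intro left_regular_norm l2.H_closed r c)
      then show "(\<lambda>n. l2_norm M (left_regular x (r n) - left_regular x c)) \<longlonglongrightarrow> 0" using c(2) by simp
    qed (intro r c left_regular_l2)+
    moreover have "(\<lambda>n. l2_inner M (left_regular x (r n)) (r n)) \<longlonglongrightarrow> \<phi> x / of_real \<kappa>"
      unfolding r_ip
    proof (intro tendsto_divide tendsto_const)
      have "(\<lambda>n. 1 / (real n + 1) + 1 / (real n + 1)) \<longlonglongrightarrow> 0 + 0"
        using LIMSEQ_inverse_real_of_nat by (intro tendsto_add) (simp_all add: inverse_eq_divide add.commute)
      then have "(\<lambda>n. l2_inner M (\<Phi> (left_regular x (E n))) (E n) - \<phi> x) \<longlonglongrightarrow> 0"
        by (intro Lim_null_comparison[OF always_eventually[OF allI[OF est]]]) simp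
      then show "(\<lambda>n. l2_inner M (\<Phi> (left_regular x (E n))) (E n)) \<longlonglongrightarrow> \<phi> x" by (simp add: LIM_zero_iff)
    qed (use kappa_pos in auto)
    ultimately show ?thesis by (rule LIMSEQ_unique)
  qed
  \<comment> \<open>Undoes the division of \<Phi> by \<kappa>.\<close>
  let ?c = "fscale (of_real (sqrt \<kappa>)) c"
  have "coefficient M ?c ?c x = \<phi> x" for x
  proof -
    have "complex_of_real (sqrt \<kappa>) * of_real (sqrt \<kappa>) = of_real \<kappa>"
      using kappa_pos(1) by (simp flip: of_real_mult)
    moreover have "coefficient M ?c ?c x = (of_real (sqrt \<kappa>) * of_real (sqrt \<kappa>)) * l2_inner M (left_regular x c) c"
      using c left_regular_l2[OF c(1)]
      by (simp add: coefficient_def left_regular_fscale l2.ip_scale l2.ip_scale_right l2_fscale)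
    ultimately show ?thesis using kappa_pos by (simp add: coef)
  qed
  then show ?thesis using l2_fscale[OF c(1)] by (intro bexI[of _ ?c]) (auto simp: fun_eq_iff)
qed

end

section \<open>Products of states with concentrated states\<close>

context semi_hilbert
begin

text \<open>The representing vector b is a limit of vectors d from the graph, for which |<d, b>|
  \<le> C |d|; in the limit |b|^2 \<le> C |b|.\<close>

lemma riesz_norm:
  assumes DH: "\<And>d r. (d, r) \<in> D \<Longrightarrow> d \<in> H"
    and D0: "(0, 0) \<in> D"
    and Dadd: "\<And>d r d' r'. (d, r) \<in> D \<Longrightarrow> (d', r') \<in> D \<Longrightarrow> (d + d', r + r') \<in> D"
    and Dscale: "\<And>d r c. (d, r) \<in> D \<Longrightarrow> (c \<odot> d, c * r) \<in> D"
    and bound: "\<And>d r. (d, r) \<in> D \<Longrightarrow> cmod r \<le> C * nrm d" and C: "0 \<le> C"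
  shows "\<exists>b\<in>H. nrm b \<le> C \<and> (\<forall>d r. (d, r) \<in> D \<longrightarrow> r = ip d b)"
proof -
  obtain b where b: "b \<in> H" "\<And>d r. (d, r) \<in> D \<Longrightarrow> r = ip d b"
    "\<And>e. e > 0 \<Longrightarrow> \<exists>(d, r)\<in>D. nrm (b - d) < e"
    by (rule riesz[OF DH D0 Dadd Dscale bound]) auto
  have nb: "0 \<le> nrm b" using b by simp
  have le: "(nrm b)\<^sup>2 \<le> C * nrm b + e * (nrm b + C)" if e: "e > 0" for e
  proof -
    obtain d r where d: "(d, r) \<in> D" "nrm (b - d) < e" using b(3)[OF e] by blast
    have dH: "d \<in> H" using DH d by blast
    have "(nrm b)\<^sup>2 = cmod (ip b b)" using b(1) by (simp add: ip_self norm_power)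
    also have "ip b b = ip (b - d) b + r" using b(1) b(2)[OF d(1)] dH by (simp add: ip_diff)
    also have "cmod (ip (b - d) b + r) \<le> nrm (b - d) * nrm b + C * nrm d"
      using cauchy_schwarz[of "b - d" b] bound[OF d(1)] b(1) dH norm_triangle_ineq[of "ip (b - d) b" r] by auto
    also have "\<dots> \<le> e * nrm b + C * (nrm b + e)"
    proof (intro add_mono mult_mono C)
      show "nrm d \<le> nrm b + e"
        using nrm_triangle[of b "d - b"] nrm_minus_commute[OF dH b(1)] d(2) b(1) dH by simp
    qed (use d nb e dH in auto)
    finally show ?thesis by (simp add: algebra_simps)
  qed
  have "(nrm b)\<^sup>2 \<le> C * nrm b"
  proof (rule field_le_epsilon)
    fix e :: real assume e: "e > 0"
    have K: "0 < nrm b + C + 1" using nb C by simp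
    have "(nrm b)\<^sup>2 \<le> C * nrm b + e / (nrm b + C + 1) * (nrm b + C)" using le[of "e / (nrm b + C + 1)"] e K by simp
    also have "\<dots> \<le> C * nrm b + e / (nrm b + C + 1) * (nrm b + C + 1)"
      using e K by (intro add_left_mono mult_left_mono) auto
    also have "\<dots> = C * nrm b + e" using K by simp
    finally show "(nrm b)\<^sup>2 \<le> C * nrm b + e" .
  qed
  then have "nrm b \<le> C" using nb C by (cases "nrm b = 0") (auto simp: power2_eq_square)
  then show ?thesis using b by blast
qed

end

lemma l2_of_real_cmod: "f \<in> l2 M \<Longrightarrow> (\<lambda>x. of_real (cmod (f x))) \<in> l2 M"
  by (auto simp: l2_def)

lemma l2_integral_cmod_mult:
  assumes f: "f \<in> l2 M" and g: "g \<in> l2 M"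
  shows "integrable M (\<lambda>x. cmod (f x) * cmod (g x))" "(LINT x|M. cmod (f x) * cmod (g x)) \<le> l2_norm M f * l2_norm M g"
proof -
  let ?f = "\<lambda>x. complex_of_real (cmod (f x))" and ?g = "\<lambda>x. complex_of_real (cmod (g x))"
  note l = l2_of_real_cmod[OF f] l2_of_real_cmod[OF g]
  show "integrable M (\<lambda>x. cmod (f x) * cmod (g x))"
    using integrable_norm[OF l2_prod_integrable[OF f g]] by (simp add: norm_mult)
  have "l2_inner M ?f ?g = (LINT x|M. complex_of_real (cmod (f x) * cmod (g x)))" by (simp add: l2_inner_def)
  also have "\<dots> = of_real (LINT x|M. cmod (f x) * cmod (g x))" by (rule integral_complex_of_real)
  finally have "(LINT x|M. cmod (f x) * cmod (g x)) = Re (l2_inner M ?f ?g)" by simp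
  also have "\<dots> \<le> l2_norm M ?f * l2_norm M ?g"
    using l2.cauchy_schwarz[OF l] complex_Re_le_cmod order_trans by blast
  finally show "(LINT x|M. cmod (f x) * cmod (g x)) \<le> l2_norm M f * l2_norm M g" by (simp add: l2_norm_def)
qed

lemma sum_lessThan_add: "(\<Sum>i<n + m. f i) = (\<Sum>i<n. f i) + (\<Sum>i<m. f (n + i))"
  for f :: "nat \<Rightarrow> 'b::comm_monoid_add"
  by (induction m) (auto simp: add.assoc)

section \<open>The dominating positive definite function\<close>

context haar_group
begin

context
  fixes f g h :: "'a \<Rightarrow> complex" and C :: "'a set" and \<epsilon> :: real
  assumes f: "f \<in> l2 M" and g: "g \<in> l2 M" and h: "h \<in> l2 M" and fg: "l2_inner M f g = 1"
    and h1: "l2_norm M h = 1" and C: "compact C" "\<And>x. x \<notin> C \<Longrightarrow> h x = 0" and eps: "\<epsilon> > 0"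
    and near: "\<And>t. h t \<noteq> 0 \<Longrightarrow> l2_norm M (left_regular (- t) f - f) \<le> \<epsilon>"
      "\<And>t. h t \<noteq> 0 \<Longrightarrow> l2_norm M (left_regular (- t) g - g) \<le> \<epsilon>"
begin

text \<open>With v the coefficient of f, g and <f, g> = 1, for every t the number v x - 1 equals <ev
  x t, \<lambda>(- t) g> + <f, \<lambda>(- t) g - g>. The dependence on x sits in the first term;
  the second is small for t in the support of h.\<close>

definition ev :: "'a \<Rightarrow> 'a \<Rightarrow> 'a \<Rightarrow> complex" where "ev x t = left_regular (- t + x) f - f"

text \<open>The Gram kernel of the vectors (ev x t, \<epsilon>) in L2 + C. The second component
  accounts for the term <f, \<lambda>(- t) g - g>, at most \<epsilon> |f| on the support of
  h.\<close>

definition G :: "'a \<Rightarrow> 'a \<Rightarrow> 'a \<Rightarrow> complex" where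
  "G x y t = l2_inner M (ev x t) (ev y t) + of_real (\<epsilon>\<^sup>2)"

definition F :: "'a \<Rightarrow> 'a \<Rightarrow> 'a \<Rightarrow> complex" where
  "F x y t = left_regular x h t * cnj (left_regular y h t) * G x y t"

text \<open>Positive definite by construction: the inner product of the vector fields t \<mapsto>
  h(- x + t) (ev x t, \<epsilon>) at x and at 0.\<close>

definition ph :: "'a \<Rightarrow> complex" where "ph x = (LINT t|M. F x 0 t)"

lemma ev_l2: "ev x t \<in> l2 M"
  unfolding ev_def by (intro l2.H_closed left_regular_l2 f)

lemma ev_norm: "l2_norm M (ev x t) \<le> 2 * l2_norm M f"
  using l2.nrm_triangle[of "left_regular (- t + x) f" M "- f"] f left_regular_l2[OF f] left_regular_norm[OF f]
  by (simp add: ev_def l2.nrm_minus)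

lemma G_bound: "cmod (G x y t) \<le> 4 * (l2_norm M f)\<^sup>2 + \<epsilon>\<^sup>2"
proof -
  have "cmod (G x y t) \<le> cmod (l2_inner M (ev x t) (ev y t)) + \<epsilon>\<^sup>2"
    unfolding G_def using norm_triangle_ineq[of "l2_inner M (ev x t) (ev y t)" "of_real (\<epsilon>\<^sup>2)"]
    by (simp add: norm_power)
  also have "cmod (l2_inner M (ev x t) (ev y t)) \<le> l2_norm M (ev x t) * l2_norm M (ev y t)"
    by (intro l2.cauchy_schwarz ev_l2)
  also have "\<dots> \<le> (2 * l2_norm M f) * (2 * l2_norm M f)"
    by (intro mult_mono ev_norm) (simp_all add: l2_norm_nonneg)
  finally show ?thesis by (simp add: power2_eq_square)
qed

text \<open>Expresses the dependence on t through coefficient functions, whose continuity makes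
  \<open>G x y\<close> measurable.\<close>

lemma G_eq:
  "G x y t = l2_inner M (left_regular x f) (left_regular y f) - coefficient M f f (- t + x)
    - cnj (coefficient M f f (- t + y)) + l2_inner M f f + of_real (\<epsilon>\<^sup>2)"
proof -
  note l = left_regular_l2[OF f]
  have "l2_inner M (left_regular (- t + x) f) (left_regular (- t + y) f) = l2_inner M (left_regular x f) (left_regular y f)"
    unfolding left_regular_add by (rule left_regular_inner[OF l l])
  moreover have "l2_inner M f (left_regular (- t + y) f) = cnj (coefficient M f f (- t + y))"
    unfolding coefficient_def by (rule l2.ip_cnj[OF l f])
  ultimately show ?thesis
    unfolding G_def ev_def using l f by (simp add: l2.ip_diff l2.ip_diff_right coefficient_def)
qed

lemma G_measurable: "G x y \<in> borel_measurable M"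
proof -
  have c: "continuous_on UNIV (\<lambda>t. coefficient M f f (- t + x))" for x
    by (rule continuous_on_compose2[OF coefficient_continuous[OF f f]]) (auto intro!: continuous_intros)
  have "continuous_on UNIV (\<lambda>t. l2_inner M (left_regular x f) (left_regular y f) - coefficient M f f (- t + x)
    - cnj (coefficient M f f (- t + y)) + l2_inner M f f + of_real (\<epsilon>\<^sup>2))"
    by (intro continuous_intros c)
  then show ?thesis using continuous_measurable G_eq by (metis (no_types, lifting) ext)
qed

lemma F_integrable: "integrable M (F x y)"
  unfolding F_def[abs_def]
  by (rule integrable_mult_bounded[OF l2_prod_integrable[OF left_regular_l2[OF h] left_regular_l2[OF h]] G_measurable G_bound])

text \<open>Left invariance: the substitution t \<mapsto> y + t turns the pair x, y into - y + x,
  0.\<close>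

lemma F_integral: "(LINT t|M. F x y t) = ph (- y + x)"
proof -
  have "F x y (y + t) = F (- y + x) 0 t" for t
  proof -
    have 1: "left_regular x h (y + t) = left_regular (- y + x) h t"
      unfolding left_regular_def by (simp only: minus_add minus_minus add.assoc)
    have 2: "left_regular y h (y + t) = left_regular 0 h t"
      by (simp add: left_regular_def add.assoc[symmetric])
    have "- (y + t) + x = - t + (- y + x)" by (simp only: minus_add add.assoc)
    moreover have "- (y + t) + y = - t + 0" by (simp only: minus_add add.assoc) simp
    ultimately have "G x y (y + t) = G (- y + x) 0 t" unfolding G_def ev_def by simp
    then show ?thesis unfolding F_def 1 2 by simp
  qed
  moreover have "(LINT t|M. F x y (y + t)) = (LINT t|M. F x y t)"
    by (rule integral_translate[OF borel_measurable_integrable[OF F_integrable]])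
  ultimately show ?thesis by (simp add: ph_def)
qed

text \<open>\<open>quad\<close> is the squared norm of \<open>\<Sum>i<n. z i * h (- x i + t)\<close> times the pair of vectors
  \<open>(ev (x i) t, \<epsilon>)\<close> of \<open>L\<^sub>2 \<oplus> \<complex>\<close>.\<close>

definition xi :: "nat \<Rightarrow> (nat \<Rightarrow> complex) \<Rightarrow> (nat \<Rightarrow> 'a) \<Rightarrow> 'a \<Rightarrow> 'a \<Rightarrow> complex" where
  "xi n z x t = (\<Sum>i<n. fscale (z i * left_regular (x i) h t) (ev (x i) t))"

definition sg :: "nat \<Rightarrow> (nat \<Rightarrow> complex) \<Rightarrow> (nat \<Rightarrow> 'a) \<Rightarrow> 'a \<Rightarrow> complex" where
  "sg n z x t = (\<Sum>i<n. z i * left_regular (x i) h t)"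

definition quad :: "nat \<Rightarrow> (nat \<Rightarrow> complex) \<Rightarrow> (nat \<Rightarrow> 'a) \<Rightarrow> 'a \<Rightarrow> real" where
  "quad n z x t = (l2_norm M (xi n z x t))\<^sup>2 + \<epsilon>\<^sup>2 * (cmod (sg n z x t))\<^sup>2"

lemma xi_l2: "xi n z x t \<in> l2 M"
  unfolding xi_def by (intro l2.H_sum l2_fscale ev_l2)

lemma quad_eq: "of_real (quad n z x t) = (\<Sum>i<n. \<Sum>j<n. z i * cnj (z j) * F (x i) (x j) t)"
proof -
  let ?a = "\<lambda>i. z i * left_regular (x i) h t"
  have "complex_of_real ((l2_norm M (xi n z x t))\<^sup>2) = (\<Sum>i<n. \<Sum>j<n. ?a i * cnj (?a j) * l2_inner M (ev (x i) t) (ev (x j) t))"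
    unfolding l2_self[symmetric] xi_def by (rule l2.ip_lincomb[OF ev_l2])
  moreover have "complex_of_real ((cmod (sg n z x t))\<^sup>2) = (\<Sum>i<n. \<Sum>j<n. ?a i * cnj (?a j))"
    unfolding complex_norm_square sg_def by (simp add: sum_product)
  ultimately show ?thesis
    unfolding quad_def of_real_add of_real_mult F_def G_def
    by (simp add: sum_distrib_left sum.distrib distrib_left mult_ac)
qed

lemma quad_integral:
  "integrable M (quad n z x)" "(\<Sum>i<n. \<Sum>j<n. z i * cnj (z j) * ph (- x j + x i)) = of_real (LINT t|M. quad n z x t)"
proof -
  have i: "integrable M (\<lambda>t. \<Sum>i<n. \<Sum>j<n. z i * cnj (z j) * F (x i) (x j) t)"
    by (intro Bochner_Integration.integrable_sum integrable_mult_right F_integrable)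
  then have "integrable M (\<lambda>t. complex_of_real (quad n z x t))" by (simp only: quad_eq)
  then have "integrable M (\<lambda>t. Re (complex_of_real (quad n z x t)))" by (rule integrable_Re)
  then show "integrable M (quad n z x)" by simp
  have "complex_of_real (LINT t|M. quad n z x t) = (LINT t|M. (\<Sum>i<n. \<Sum>j<n. z i * cnj (z j) * F (x i) (x j) t))"
    unfolding integral_complex_of_real[symmetric] quad_eq ..
  also have "\<dots> = (\<Sum>i<n. \<Sum>j<n. z i * cnj (z j) * (LINT t|M. F (x i) (x j) t))"
    by (subst Bochner_Integration.integral_sum, intro Bochner_Integration.integrable_sum integrable_mult_right F_integrable,
        subst Bochner_Integration.integral_sum, intro integrable_mult_right F_integrable)
      (simp only: integral_mult_right_zero)
  finally show "(\<Sum>i<n. \<Sum>j<n. z i * cnj (z j) * ph (- x j + x i)) = of_real (LINT t|M. quad n z x t)"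
    by (simp only: F_integral)
qed

lemma quad_nonneg: "0 \<le> quad n z x t"
  by (simp add: quad_def)

text \<open>This serves the continuity of ph at 0. The increment splits into the change of h against
  a bounded G and the change of G, which is a change of f up to a unitary translation; strong
  continuity controls both.\<close>

lemma ph_diff:
  "cmod (ph x - ph 0) \<le> (4 * (l2_norm M f)\<^sup>2 + \<epsilon>\<^sup>2) * l2_norm M (left_regular x h - h)
    + 2 * l2_norm M f * l2_norm M (left_regular x f - f)"
proof -
  let ?B = "4 * (l2_norm M f)\<^sup>2 + \<epsilon>\<^sup>2" and ?d = "2 * l2_norm M f * l2_norm M (left_regular x f - f)"
  have Gd: "cmod (G x 0 t - G 0 0 t) \<le> ?d" for t
  proof -
    have ed: "ev x t - ev 0 t = left_regular (- t) (left_regular x f - f)"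
      by (simp add: ev_def left_regular_add left_regular_diff left_regular_zero)
    have en: "l2_norm M (ev x t - ev 0 t) = l2_norm M (left_regular x f - f)"
      unfolding ed by (intro left_regular_norm l2.H_closed left_regular_l2 f)
    have eq: "G x 0 t - G 0 0 t = l2_inner M (ev x t - ev 0 t) (ev 0 t)"
      using ev_l2 by (simp add: G_def l2.ip_diff)
    have le: "cmod (l2_inner M (ev x t - ev 0 t) (ev 0 t)) \<le> l2_norm M (ev x t - ev 0 t) * l2_norm M (ev 0 t)"
      by (intro l2.cauchy_schwarz l2.H_closed ev_l2)
    have "l2_norm M (ev x t - ev 0 t) * l2_norm M (ev 0 t) \<le> l2_norm M (left_regular x f - f) * (2 * l2_norm M f)"
      unfolding en by (intro mult_left_mono ev_norm l2_norm_nonneg)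
    with le show ?thesis unfolding eq by (simp add: mult_ac)
  qed
  have lh: "left_regular x h - h \<in> l2 M" by (intro l2.H_closed left_regular_l2 h)
  have Fd: "F x 0 t - F 0 0 t = (left_regular x h - h) t * cnj (h t) * G x 0 t + h t * cnj (h t) * (G x 0 t - G 0 0 t)" for t
    by (simp add: F_def left_regular_zero algebra_simps)
  have hh: "(LINT t|M. cmod (h t) * cmod (h t)) = 1"
    using h1 unfolding l2_norm_def by (simp add: power2_eq_square)
  have "ph x - ph 0 = (LINT t|M. F x 0 t - F 0 0 t)" unfolding ph_def by (simp add: F_integrable)
  also have "cmod \<dots> \<le> (LINT t|M. ?B * (cmod ((left_regular x h - h) t) * cmod (h t)) + ?d * (cmod (h t) * cmod (h t)))"
  proof (rule integral_norm_le)
    show "integrable M (\<lambda>t. F x 0 t - F 0 0 t)" by (intro Bochner_Integration.integrable_diff F_integrable)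
    show "integrable M (\<lambda>t. ?B * (cmod ((left_regular x h - h) t) * cmod (h t)) + ?d * (cmod (h t) * cmod (h t)))"
      by (intro Bochner_Integration.integrable_add integrable_mult_right l2_integral_cmod_mult lh h)
    fix t
    have "cmod (F x 0 t - F 0 0 t) \<le> cmod ((left_regular x h - h) t * cnj (h t) * G x 0 t) + cmod (h t * cnj (h t) * (G x 0 t - G 0 0 t))"
      unfolding Fd by (rule norm_triangle_ineq)
    also have "\<dots> \<le> (cmod ((left_regular x h - h) t) * cmod (h t)) * ?B + (cmod (h t) * cmod (h t)) * ?d"
      unfolding norm_mult complex_mod_cnj by (intro add_mono mult_left_mono G_bound Gd) simp_all
    finally show "cmod (F x 0 t - F 0 0 t) \<le> ?B * (cmod ((left_regular x h - h) t) * cmod (h t)) + ?d * (cmod (h t) * cmod (h t))"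
      by (simp add: mult_ac)
  qed
  also have "\<dots> = ?B * (LINT t|M. cmod ((left_regular x h - h) t) * cmod (h t)) + ?d * (LINT t|M. cmod (h t) * cmod (h t))"
    using l2_integral_cmod_mult(1)[OF lh h] l2_integral_cmod_mult(1)[OF h h]
    by (subst Bochner_Integration.integral_add) auto
  also have "\<dots> \<le> ?B * (l2_norm M (left_regular x h - h) * l2_norm M h) + ?d * 1"
    unfolding hh
    by (intro add_mono mult_left_mono l2_integral_cmod_mult lh h) (simp_all add: l2_norm_nonneg)
  finally show ?thesis by (simp add: h1)
qed

text \<open>Sums over ph are integrals of the nonnegative \<open>quad\<close>. The support is
  compact because h(- x + t) and h t are both non-zero only if x = t - (- x + t) lies in C -
  C.\<close>

lemma ph_positive_definite: "positive_definite M ph ((\<lambda>q. fst q - snd q) ` (C \<times> C))"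
proof unfold_locales
  show "\<exists>r\<ge>0. (\<Sum>i<n. \<Sum>j<n. z i * cnj (z j) * ph (- x j + x i)) = of_real r"
    for n :: nat and x z
    unfolding quad_integral(2) by (intro exI[of _ "LINT t|M. quad n z x t"]) (simp add: quad_nonneg)
  show "compact ((\<lambda>q. fst q - snd q) ` (C \<times> C))"
    by (intro compact_continuous_image compact_Times C continuous_intros)
  show "ph x = 0" if x: "x \<notin> (\<lambda>q. fst q - snd q) ` (C \<times> C)" for x
  proof -
    have "left_regular x h t * cnj (h t) = 0" for t
    proof (rule ccontr)
      assume "left_regular x h t * cnj (h t) \<noteq> 0"
      then have "t \<in> C" "- x + t \<in> C" using C(2) by (auto simp: left_regular_def)
      moreover have "x = t - (- x + t)"
        by (simp only: diff_conv_add_uminus minus_add minus_minus) (simp add: add.assoc[symmetric])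
      ultimately show False using x by force
    qed
    then have "(\<lambda>t. F x 0 t) = (\<lambda>t. 0)" by (simp add: F_def left_regular_zero fun_eq_iff)
    then show ?thesis by (simp only: ph_def) simp
  qed
  fix e :: real assume e: "e > 0"
  let ?B = "4 * (l2_norm M f)\<^sup>2 + \<epsilon>\<^sup>2"
  define d where "d = e / (?B + 2 * l2_norm M f + 1)"
  have K: "?B + 2 * l2_norm M f + 1 > 0" by (intro add_nonneg_pos add_nonneg_nonneg) (simp_all add: l2_norm_nonneg)
  then have d: "d > 0" using e by (simp add: d_def)
  show "\<forall>\<^sub>F x in nhds 0. cmod (ph x - ph 0) < e"
    using left_regular_continuous[OF h d] left_regular_continuous[OF f d]
  proof eventually_elim
    case (elim x)
    have "cmod (ph x - ph 0) \<le> ?B * l2_norm M (left_regular x h - h) + 2 * l2_norm M f * l2_norm M (left_regular x f - f)"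
      by (rule ph_diff)
    also have "\<dots> \<le> ?B * d + 2 * l2_norm M f * d"
      using elim by (intro add_mono mult_left_mono) (simp_all add: l2_norm_nonneg)
    also have "\<dots> < (?B + 2 * l2_norm M f + 1) * d" using d by (simp add: algebra_simps)
    also have "\<dots> = e" using K by (simp add: d_def)
    finally show ?case .
  qed
qed

text \<open>The value at 0 is the integral of |h t|^2 (|\<lambda>(- t) f - f|^2 + \<epsilon>^2), and
  on the support of h both terms in brackets are at most \<epsilon>^2.\<close>

lemma ph_zero: "Re (ph 0) \<le> 2 * \<epsilon>\<^sup>2"
proof -
  have "ph 0 = of_real (LINT t|M. quad 1 (\<lambda>_. 1) (\<lambda>_. 0) t)"
    using quad_integral(2)[where n = 1 and z = "\<lambda>_. 1" and x = "\<lambda>_. 0"] by simp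
  then have "Re (ph 0) = (LINT t|M. quad 1 (\<lambda>_. 1) (\<lambda>_. 0) t)" by simp
  also have "\<dots> \<le> (LINT t|M. 2 * \<epsilon>\<^sup>2 * (cmod (h t))\<^sup>2)"
  proof (rule Bochner_Integration.integral_mono[OF quad_integral(1)])
    show "integrable M (\<lambda>t. 2 * \<epsilon>\<^sup>2 * (cmod (h t))\<^sup>2)" by (intro integrable_mult_right l2_integrable h)
    fix t
    have q: "quad 1 (\<lambda>_. 1) (\<lambda>_. 0) t = (cmod (h t))\<^sup>2 * (l2_norm M (ev 0 t))\<^sup>2 + \<epsilon>\<^sup>2 * (cmod (h t))\<^sup>2"
      using l2.nrm_scale[OF ev_l2, of "h t" 0 t] by (simp add: quad_def xi_def sg_def left_regular_zero power_mult_distrib)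
    show "quad 1 (\<lambda>_. 1) (\<lambda>_. 0) t \<le> 2 * \<epsilon>\<^sup>2 * (cmod (h t))\<^sup>2"
    proof (cases "h t = 0")
      case False
      have "(l2_norm M (ev 0 t))\<^sup>2 \<le> \<epsilon>\<^sup>2"
        using near(1)[OF False] by (intro power_mono) (simp_all add: ev_def l2_norm_nonneg)
      then have "(cmod (h t))\<^sup>2 * (l2_norm M (ev 0 t))\<^sup>2 \<le> (cmod (h t))\<^sup>2 * \<epsilon>\<^sup>2" by (intro mult_left_mono) auto
      then show ?thesis unfolding q by (simp add: mult.commute)
    qed (unfold q, simp)
  qed
  also have "\<dots> = 2 * \<epsilon>\<^sup>2 * (l2_norm M h)\<^sup>2" by (simp add: l2_norm_def)
  finally show ?thesis by (simp add: h1)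
qed

text \<open>The sum is <J, h> with J the sum of the z i (v (x i) - 1) \<lambda>(x i) h. Where h t is
  non-zero, the splitting of v - 1 noted at \<open>ev\<close> gives |J t| \<le> N (|xi| + \<epsilon>
  |sg|) with N = |f| + |g|; squaring the bracket costs the factor 2.\<close>

lemma product_functional_bound:
  "(cmod (\<Sum>i<n. z i * (coefficient M f g (x i) * coefficient M h h (x i) - coefficient M h h (x i))))\<^sup>2
    \<le> 2 * (l2_norm M f + l2_norm M g)\<^sup>2 * (LINT t|M. quad n z x t)"
proof -
  let ?N = "l2_norm M f + l2_norm M g"
  have N: "0 \<le> ?N" "l2_norm M f \<le> ?N" "l2_norm M g \<le> ?N"
    using l2_norm_nonneg[of M f] l2_norm_nonneg[of M g] by linarith+
  let ?v = "\<lambda>i. coefficient M f g (x i) - 1"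
  define J where "J = (\<Sum>i<n. fscale (z i * ?v i) (left_regular (x i) h))"
  have Jl: "J \<in> l2 M" unfolding J_def by (intro l2.H_sum l2_fscale left_regular_l2 h)
  have Jh: "(\<Sum>i<n. z i * (coefficient M f g (x i) * coefficient M h h (x i) - coefficient M h h (x i))) = l2_inner M J h"
  proof -
    have "z i * (coefficient M f g (x i) * coefficient M h h (x i) - coefficient M h h (x i))
        = l2_inner M (fscale (z i * ?v i) (left_regular (x i) h)) h" for i
      by (subst l2.ip_scale) (simp_all add: left_regular_l2 h coefficient_def algebra_simps)
    then show ?thesis unfolding J_def by (subst l2.ip_sum) (simp_all add: l2_fscale left_regular_l2 h)
  qed
  \<comment> \<open>Only the values of J on the support of h enter <J, h>, and only there is
    \<lambda>(- t) g known to be close to g.\<close>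
  define J' where "J' t = (if h t = 0 then 0 else J t)" for t
  have [measurable]: "J \<in> borel_measurable M" "h \<in> borel_measurable M" using l2_measurable Jl h by auto
  have J'm: "J' \<in> borel_measurable M" unfolding J'_def by measurable
  have "integrable M (\<lambda>t. (cmod (J' t))\<^sup>2)"
    by (rule Bochner_Integration.integrable_bound[OF l2_integrable[OF Jl]]) (use J'm in \<open>auto simp: J'_def\<close>)
  then have J'l: "J' \<in> l2 M" using J'm by (simp add: l2_def)
  have "l2_inner M J h = l2_inner M J' h"
    unfolding l2_inner_def by (intro Bochner_Integration.integral_cong) (auto simp: J'_def)
  then have "cmod (l2_inner M J h) \<le> l2_norm M J'"
    using l2.cauchy_schwarz[OF J'l h] h1 by simp
  then have "(cmod (l2_inner M J h))\<^sup>2 \<le> (l2_norm M J')\<^sup>2" by (intro power_mono) auto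
  also have "\<dots> = (LINT t|M. (cmod (J' t))\<^sup>2)" by (simp add: l2_norm_def)
  also have "\<dots> \<le> (LINT t|M. 2 * ?N\<^sup>2 * quad n z x t)"
  proof (rule Bochner_Integration.integral_mono[OF l2_integrable[OF J'l]])
    show "integrable M (\<lambda>t. 2 * ?N\<^sup>2 * quad n z x t)" by (intro integrable_mult_right quad_integral)
    fix t
    show "(cmod (J' t))\<^sup>2 \<le> 2 * ?N\<^sup>2 * quad n z x t"
    proof (cases "h t = 0")
      case True then show ?thesis by (simp add: J'_def quad_nonneg)
    next
      case False
      let ?g = "left_regular (- t) g"
      have gl: "?g \<in> l2 M" by (rule left_regular_l2[OF g])
      have v: "?v i = l2_inner M (ev (x i) t) ?g + l2_inner M f (?g - g)" for i
      proof -
        have "coefficient M f g (x i) = l2_inner M (left_regular (- t + x i) f) ?g"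
          unfolding coefficient_def left_regular_add by (rule left_regular_inner[symmetric]) (intro left_regular_l2 f g)+
        then show ?thesis
          using f g gl left_regular_l2[OF f] by (simp add: ev_def l2.ip_diff l2.ip_diff_right fg)
      qed
      have "J t = (\<Sum>i<n. z i * left_regular (x i) h t * l2_inner M (ev (x i) t) ?g)
          + (\<Sum>i<n. z i * left_regular (x i) h t * l2_inner M f (?g - g))"
        unfolding J_def sum_fun_apply fscale_apply v by (simp add: sum.distrib[symmetric] algebra_simps)
      also have "(\<Sum>i<n. z i * left_regular (x i) h t * l2_inner M (ev (x i) t) ?g) = l2_inner M (xi n z x t) ?g"
        unfolding xi_def using ev_l2 gl by (simp add: l2.ip_sum l2_fscale l2.ip_scale)
      also have "(\<Sum>i<n. z i * left_regular (x i) h t * l2_inner M f (?g - g)) = sg n z x t * l2_inner M f (?g - g)"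
        by (simp add: sg_def sum_distrib_right)
      finally have "cmod (J t) \<le> cmod (l2_inner M (xi n z x t) ?g) + cmod (sg n z x t * l2_inner M f (?g - g))"
        using norm_triangle_ineq by metis
      also have "\<dots> \<le> l2_norm M (xi n z x t) * l2_norm M ?g + cmod (sg n z x t) * (l2_norm M f * l2_norm M (?g - g))"
        unfolding norm_mult by (intro add_mono mult_left_mono l2.cauchy_schwarz xi_l2 gl f l2.H_closed g) simp
      also have "\<dots> \<le> l2_norm M (xi n z x t) * ?N + cmod (sg n z x t) * (?N * \<epsilon>)"
        using N near(2)[OF False] left_regular_norm[OF g]
        by (intro add_mono mult_left_mono mult_mono) (simp_all add: l2_norm_nonneg)
      also have "\<dots> = ?N * (l2_norm M (xi n z x t) + \<epsilon> * cmod (sg n z x t))" by (simp add: algebra_simps)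
      finally have "(cmod (J t))\<^sup>2 \<le> (?N * (l2_norm M (xi n z x t) + \<epsilon> * cmod (sg n z x t)))\<^sup>2"
        by (intro power_mono) auto
      also have "\<dots> = ?N\<^sup>2 * (l2_norm M (xi n z x t) + \<epsilon> * cmod (sg n z x t))\<^sup>2" by (rule power_mult_distrib)
      also have "\<dots> \<le> ?N\<^sup>2 * (2 * quad n z x t)"
      proof (rule mult_left_mono)
        show "(l2_norm M (xi n z x t) + \<epsilon> * cmod (sg n z x t))\<^sup>2 \<le> 2 * quad n z x t"
          using sum_squares_bound[of "l2_norm M (xi n z x t)" "\<epsilon> * cmod (sg n z x t)"]
          by (simp add: quad_def power2_sum power_mult_distrib)
      qed simp
      finally show ?thesis using False by (simp add: J'_def mult_ac)
    qed
  qed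
  also have "\<dots> = 2 * ?N\<^sup>2 * (LINT t|M. quad n z x t)" by simp
  finally show ?thesis unfolding Jh .
qed

text \<open>The translates of c have Gram kernel ph, so domination by ph makes \<lambda>(x) c
  \<mapsto> w x a functional of norm at most sqrt 2 N on their span, and b represents it. As |c|^2 =
  ph 0 \<le> 2 \<epsilon>^2, the product of the norms is at most sqrt 2 \<epsilon> times sqrt 2
  N.\<close>

lemma product_state_coefficient:
  "\<exists>c\<in>l2 M. \<exists>b\<in>l2 M. (\<lambda>x. coefficient M f g x * coefficient M h h x - coefficient M h h x) = coefficient M c b \<and>
    l2_norm M c * l2_norm M b \<le> 2 * (l2_norm M f + l2_norm M g) * \<epsilon>"
proof -
  let ?N = "l2_norm M f + l2_norm M g"
  have N: "0 \<le> ?N" using l2_norm_nonneg[of M f] l2_norm_nonneg[of M g] by linarith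
  define w where "w x = coefficient M f g x * coefficient M h h x - coefficient M h h x" for x
  obtain c where c: "c \<in> l2 M" "ph = coefficient M c c"
    using positive_definite.positive_definite_coefficient[OF ph_positive_definite] by blast
  note cl = left_regular_l2[OF c(1)]
  have "(l2_norm M c)\<^sup>2 \<le> 2 * \<epsilon>\<^sup>2"
    using ph_zero unfolding c(2) coefficient_def left_regular_zero l2_self by simp
  also have "\<dots> = (sqrt 2 * \<epsilon>)\<^sup>2" by (simp add: power_mult_distrib)
  finally have nc: "l2_norm M c \<le> sqrt 2 * \<epsilon>" by (rule power2_le_imp_le) (use eps in simp)
  define V where "V n z x = (\<Sum>i<n. fscale (z i) (left_regular (x i) c))" for n and z :: "nat \<Rightarrow> complex" and x
  \<comment> \<open>Different data n, z, x may give the same vector. That this graph is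
    single-valued is a consequence of \<open>bound\<close> below, and Riesz' theorem takes a graph
    for this reason.\<close>
  define D where "D = {(V n z x, \<Sum>i<n. z i * w (x i)) | n z x. True}"
  have Vl: "V n z x \<in> l2 M" for n z x unfolding V_def by (intro l2.H_sum l2_fscale cl)
  have Vn: "(l2_norm M (V n z x))\<^sup>2 = (LINT t|M. quad n z x t)" for n z x
  proof -
    have "l2_inner M (left_regular a c) (left_regular b c) = ph (- b + a)" for a b
      unfolding c(2) coefficient_def left_regular_add
      using left_regular_adjoint[OF cl cl, of "- b" a b]
        left_regular_inner[OF cl cl, of "- b" a b] by (simp add: left_regular_add[symmetric] left_regular_zero)
    then have "l2_inner M (V n z x) (V n z x) = of_real (LINT t|M. quad n z x t)"
      unfolding V_def quad_integral(2)[symmetric] by (subst l2.ip_lincomb) (simp_all add: cl)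
    then show ?thesis unfolding l2_self of_real_eq_iff .
  qed
  have bound: "cmod (\<Sum>i<n. z i * w (x i)) \<le> sqrt 2 * ?N * l2_norm M (V n z x)" for n z x
  proof (rule power2_le_imp_le)
    show "(cmod (\<Sum>i<n. z i * w (x i)))\<^sup>2 \<le> (sqrt 2 * ?N * l2_norm M (V n z x))\<^sup>2"
      using product_functional_bound[where n = n and z = z and x = x]
      unfolding power_mult_distrib Vn w_def by simp
    show "0 \<le> sqrt 2 * ?N * l2_norm M (V n z x)" using N by (intro mult_nonneg_nonneg) (simp_all add: l2_norm_nonneg)
  qed
  have "\<exists>b\<in>l2 M. l2_norm M b \<le> sqrt 2 * ?N \<and> (\<forall>d r. (d, r) \<in> D \<longrightarrow> r = l2_inner M d b)"
  proof (rule l2.riesz_norm[of D M "sqrt 2 * ?N"])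
    show "(0, 0) \<in> D"
      unfolding D_def by (intro CollectI exI[of _ 0] exI[of _ "\<lambda>_. 0"]) (simp add: V_def)
    show "d \<in> l2 M" if "(d, r) \<in> D" for d r using that Vl by (auto simp: D_def)
    show "cmod r \<le> sqrt 2 * ?N * l2_norm M d" if "(d, r) \<in> D" for d r using that bound by (auto simp: D_def)
    show "(fscale a d, a * r) \<in> D" if dr: "(d, r) \<in> D" for d r a
    proof -
      obtain n z x where "d = V n z x" "r = (\<Sum>i<n. z i * w (x i))" using dr by (auto simp: D_def)
      then have "fscale a d = V n (\<lambda>i. a * z i) x" "a * r = (\<Sum>i<n. (a * z i) * w (x i))"
        by (simp_all add: V_def fs.scale_sum_right sum_distrib_left mult.assoc)
      then show ?thesis unfolding D_def by blast
    qed
    show "(d + d', r + r') \<in> D" if dr: "(d, r) \<in> D" and dr': "(d', r') \<in> D" for d r d' r'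
    proof -
      obtain n z x where 1: "d = V n z x" "r = (\<Sum>i<n. z i * w (x i))" using dr by (auto simp: D_def)
      obtain n' z' x' where 2: "d' = V n' z' x'" "r' = (\<Sum>i<n'. z' i * w (x' i))" using dr' by (auto simp: D_def)
      define z'' where "z'' i = (if i < n then z i else z' (i - n))" for i
      define x'' where "x'' i = (if i < n then x i else x' (i - n))" for i
      have "d + d' = V (n + n') z'' x''" "r + r' = (\<Sum>i<n + n'. z'' i * w (x'' i))"
        by (simp_all add: 1 2 V_def sum_lessThan_add z''_def x''_def)
      then show ?thesis unfolding D_def by blast
    qed
    show "0 \<le> sqrt 2 * ?N" using N by simp
  qed
  then obtain b where b: "b \<in> l2 M" "l2_norm M b \<le> sqrt 2 * ?N" "\<And>d r. (d, r) \<in> D \<Longrightarrow> r = l2_inner M d b"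
    by blast
  have "w x = coefficient M c b x" for x
  proof -
    have "(left_regular x c, w x) \<in> D"
      unfolding D_def
      by (rule CollectI, intro exI[of _ 1] exI[of _ "\<lambda>_. 1"] exI[of _ "\<lambda>_. x"]) (simp add: V_def)
    from b(3)[OF this] show ?thesis by (simp add: coefficient_def)
  qed
  then have "w = coefficient M c b" by (simp add: fun_eq_iff)
  moreover have "l2_norm M c * l2_norm M b \<le> 2 * ?N * \<epsilon>"
  proof -
    have "l2_norm M c * l2_norm M b \<le> (sqrt 2 * \<epsilon>) * (sqrt 2 * ?N)"
      using nc b(2) eps by (intro mult_mono) (simp_all add: l2_norm_nonneg)
    also have "\<dots> = (sqrt 2 * sqrt 2) * (?N * \<epsilon>)" by (simp only: mult_ac)
    also have "\<dots> = 2 * ?N * \<epsilon>" by simp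
    finally show ?thesis .
  qed
  ultimately show ?thesis using c(1) b(1) by (intro bexI[of _ c] bexI[of _ b]) (simp_all add: w_def[abs_def])
qed

lemma product_state_fourier_norm:
  "\<bar>fourier_norm M (\<lambda>x. coefficient M f g x * coefficient M h h x - coefficient M h h x)\<bar>
    \<le> 2 * (l2_norm M f + l2_norm M g) * \<epsilon>"
proof -
  obtain c b where cb: "c \<in> l2 M" "b \<in> l2 M"
    "(\<lambda>x. coefficient M f g x * coefficient M h h x - coefficient M h h x) = coefficient M c b"
    "l2_norm M c * l2_norm M b \<le> 2 * (l2_norm M f + l2_norm M g) * \<epsilon>"
    using product_state_coefficient by blast
  have "0 \<le> fourier_norm M (coefficient M c b)"
    using fourier_norm_nonneg[OF h h1 cb(1,2)] norm_ge_zero order_trans by blast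
  then show ?thesis using fourier_norm_le[OF h h1 cb(1,2)] cb(3,4) by simp
qed

end

end

section \<open>Neighbourhood bases and cardinalities\<close>

lemma finite_card_le_infinite: "finite A \<Longrightarrow> infinite B \<Longrightarrow> |A| \<le>o |B|"
  by (meson finite_iff_ordLess_natLeq infinite_iff_natLeq_ordLeq ordLess_imp_ordLeq ordLess_ordLeq_trans)

text \<open>T n consists of the sets reached from the empty set by n insertions of elements of A. T
  (n + 1) is an image of A x T n, so no T n is larger than A, nor is their countable union.\<close>

lemma card_of_Fpow_le: assumes A: "infinite A" shows "|Fpow A| \<le>o |A|"
proof -
  define T where "T = rec_nat {{}} (\<lambda>_ S. (\<lambda>(a, F). insert a F) ` (A \<times> S))"
  have T0: "T 0 = {{}}" and TS: "T (Suc n) = (\<lambda>(a, F). insert a F) ` (A \<times> T n)" for n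
    by (simp_all add: T_def)
  have "|T n| \<le>o |A|" for n
  proof (induction n)
    case 0
    show ?case unfolding T0 by (rule finite_card_le_infinite) (use A in auto)
  next
    case (Suc n)
    have "|T (Suc n)| \<le>o |A \<times> T n|" unfolding TS by (rule card_of_image)
    also have "|A \<times> T n| \<le>o |A|"
      by (rule card_of_Sigma_ordLeq_infinite[OF A card_of_refl[THEN ordIso_imp_ordLeq]]) (use Suc in blast)
    finally show ?case .
  qed
  then have "|\<Union>n\<in>UNIV. T n| \<le>o |A|"
    using A by (intro card_of_UNION_ordLeq_infinite) (auto simp: infinite_iff_card_of_nat)
  moreover have "Fpow A \<subseteq> (\<Union>n\<in>UNIV. T n)"
  proof
    fix F assume "F \<in> Fpow A"
    then have "finite F" "F \<subseteq> A" by (auto simp: Fpow_def)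
    then have "F \<in> T (card F)"
    proof (induction F)
      case (insert a F)
      then have "F \<in> T (card F)" "a \<in> A" by auto
      then show ?case using insert by (auto simp: TS)
    qed (simp add: T0)
    then show "F \<in> (\<Union>n\<in>UNIV. T n)" by blast
  qed
  ultimately show ?thesis using card_of_mono1 ordLeq_transitive by blast
qed

lemma finite_card_less:
  fixes \<mu> :: "'c rel"
  assumes "finite A" "natLeq <o \<mu>" shows "|A| <o \<mu>"
  using assms ordLess_transitive by (auto simp: finite_iff_ordLess_natLeq)

lemma card_of_Fpow_less:
  fixes \<mu> :: "'c rel"
  assumes A: "|A| <o \<mu>" and \<mu>: "natLeq <o \<mu>" shows "|Fpow A| <o \<mu>"
proof (cases "finite A")
  case True
  then have "finite (Fpow A)" by (simp add: Fpow_def)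
  then show ?thesis using \<mu> by (rule finite_card_less)
next
  case False
  then show ?thesis using card_of_Fpow_le[OF False] A ordLeq_ordLess_trans by blast
qed

text \<open>For infinite A the countable factor is absorbed. For finite A the product is at most
  countable, and the strict inequality \<open>natLeq <o \<mu>\<close> decides.\<close>

lemma card_of_Times_nat_less:
  fixes \<mu> :: "'c rel"
  assumes A: "|A| <o \<mu>" and \<mu>: "natLeq <o \<mu>" shows "|A \<times> (UNIV :: nat set)| <o \<mu>"
proof (cases "finite A")
  case True
  have "|A \<times> (UNIV :: nat set)| \<le>o |UNIV :: nat set|"
    using True by (intro card_of_Sigma_ordLeq_infinite finite_card_le_infinite ballI card_of_refl[THEN ordIso_imp_ordLeq]) auto
  then have "|A \<times> (UNIV :: nat set)| \<le>o natLeq" using card_of_nat ordLeq_ordIso_trans by blast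
  then show ?thesis using \<mu> ordLeq_ordLess_trans by blast
next
  case False
  have "|A \<times> (UNIV :: nat set)| \<le>o |A|"
    by (intro card_of_Sigma_ordLeq_infinite)
      (use False in \<open>auto simp: infinite_iff_card_of_nat intro: card_of_mono1\<close>)
  then show ?thesis using A ordLeq_ordLess_trans by blast
qed

text \<open>Compactness: the complements of the sets in \<W> cover C minus an open V' around x, and
  a finite subcover is a finite intersection inside V'. So isolating x takes about as many
  neighbourhoods as a basis has.\<close>

lemma nhds_basis_finite_intersections:
  fixes x :: "'a::t2_space"
  assumes C: "compact C" "\<forall>\<^sub>F y in nhds x. y \<in> C"
    and W: "\<And>W. W \<in> \<W> \<Longrightarrow> closed W" "\<And>W. W \<in> \<W> \<Longrightarrow> \<forall>\<^sub>F y in nhds x. y \<in> W"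
    and Int: "C \<inter> \<Inter>\<W> \<subseteq> {x}"
  shows "nhds_basis x ((\<lambda>F. C \<inter> \<Inter>F) ` Fpow \<W>)"
  unfolding nhds_basis_def
proof (intro conjI ballI allI impI)
  fix U assume "U \<in> (\<lambda>F. C \<inter> \<Inter>F) ` Fpow \<W>"
  then obtain F where F: "finite F" "F \<subseteq> \<W>" "U = C \<inter> \<Inter>F" by (auto simp: Fpow_def)
  have "\<forall>\<^sub>F y in nhds x. \<forall>W\<in>F. y \<in> W"
    by (rule eventually_ball_finite[OF F(1)]) (use F W in blast)
  with C(2) show "\<forall>\<^sub>F y in nhds x. y \<in> U"
    by eventually_elim (use F in auto)
next
  fix V assume "\<forall>\<^sub>F y in nhds x. y \<in> V"
  then obtain V' where V': "open V'" "x \<in> V'" "V' \<subseteq> V" unfolding eventually_nhds by blast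
  have "compact (C - V')" by (rule compact_diff[OF C(1) V'(1)])
  moreover have "open (- W)" if "W \<in> \<W>" for W using W(1)[OF that] by (rule open_Compl)
  moreover have "C - V' \<subseteq> (\<Union>W\<in>\<W>. - W)" using Int V' by blast
  ultimately obtain F where F: "F \<subseteq> \<W>" "finite F" "C - V' \<subseteq> (\<Union>W\<in>F. - W)"
    by (rule compactE_image)
  then have "C \<inter> \<Inter>F \<subseteq> V" using V' by blast
  then show "\<exists>U\<in>(\<lambda>F. C \<inter> \<Inter>F) ` Fpow \<W>. U \<subseteq> V" using F by (auto simp: Fpow_def)
qed

text \<open>Regularity of a topological group: choose N with N - N inside U. If x is adherent to N,
  then x + N meets N and x lies in N - N.\<close>

lemma closed_neighbourhood:
  assumes "open U" "0 \<in> (U :: 'a::topological_group_add set)"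
  obtains V where "open V" "0 \<in> V" "closure V \<subseteq> U"
proof -
  have "open ((\<lambda>p::'a \<times> 'a. fst p - snd p) -` U)"
    by (intro open_vimage assms continuous_intros)
  moreover have "(0, 0) \<in> (\<lambda>p::'a \<times> 'a. fst p - snd p) -` U" using assms by simp
  ultimately obtain A B where AB: "open A" "open B" "0 \<in> A" "0 \<in> B" "A \<times> B \<subseteq> (\<lambda>p. fst p - snd p) -` U"
    by (elim open_prod_elim) auto
  have "closure (A \<inter> B) \<subseteq> U"
  proof
    fix x assume x: "x \<in> closure (A \<inter> B)"
    have op: "open ((\<lambda>y. - x + y) -` (A \<inter> B))" by (intro open_vimage continuous_intros open_Int AB)
    have mem: "x \<in> (\<lambda>y. - x + y) -` (A \<inter> B)" using AB by simp
    have "(A \<inter> B) \<inter> ((\<lambda>y. - x + y) -` (A \<inter> B)) \<noteq> {}"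
      by (rule closure_iff_nhds_not_empty[THEN iffD1, rule_format, OF x order_refl op mem])
    then obtain y where y: "y \<in> A \<inter> B" "- x + y \<in> A \<inter> B" by blast
    have "y - (- x + y) = x"
      by (simp only: diff_conv_add_uminus minus_add minus_minus) (simp add: add.assoc[symmetric])
    then show "x \<in> U" using y AB(5) by force
  qed
  then show ?thesis using AB by (intro that[of "A \<inter> B"]) auto
qed

section \<open>Transfinite construction of the orthogonal vectors\<close>

context haar_group
begin

text \<open>Turns invariance of h under \<lambda>(x) into a condition on a continuous scalar
  function of x.\<close>

lemma state_norm_diff:
  assumes h: "h \<in> l2 M" "l2_norm M h = 1"
  shows "(l2_norm M (left_regular x h - h))\<^sup>2 = 2 - 2 * Re (coefficient M h h x)"
  unfolding l2.nrm_diff_sq[OF left_regular_l2[OF h(1)] h(1)]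
  by (simp add: left_regular_norm h coefficient_def)

text \<open>The stabiliser of fewer than \<open>\<mu>\<close> unit vectors is an intersection of fewer than \<open>\<mu>\<close> closed
  neighbourhoods of \<open>0\<close>; here uncountability of \<open>\<mu>\<close> is used.\<close>

lemma nontrivial_stabiliser:
  fixes \<mu> :: "'c rel"
  assumes \<mu>: "min_nhds_basis_card (0::'a) \<mu>" "natLeq <o \<mu>"
    and S: "|S| <o \<mu>" and h: "\<And>s. s \<in> S \<Longrightarrow> h s \<in> l2 M" "\<And>s. s \<in> S \<Longrightarrow> l2_norm M (h s) = 1"
    and U: "open U" "0 \<in> U"
  shows "\<exists>x\<in>U. x \<noteq> 0 \<and> (\<forall>s\<in>S. l2.eqv M (left_regular x (h s)) (h s))"
proof -
  obtain V where V: "open V" "0 \<in> V" "closure V \<subseteq> U" using closed_neighbourhood[OF U] by blast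
  obtain W C :: "'a set" where W: "open W" "0 \<in> W" "W \<subseteq> C" "compact C" using compact_neighbourhood by blast
  \<comment> \<open>The closure of V forces the element found below into U; C provides
    compactness.\<close>
  define K where "K = C \<inter> closure V"
  have K: "compact K" unfolding K_def by (intro compact_Int_closed W closed_closure)
  have K0: "\<forall>\<^sub>F y in nhds 0. y \<in> K"
    unfolding eventually_nhds K_def using W V closure_subset[of V] by (intro exI[of _ "V \<inter> W"]) auto
  \<comment> \<open>By \<open>state_norm_diff\<close> the condition reads |\<lambda>(y) (h s) - h
    s|^2 \<le> 1/(n+1). These are closed neighbourhoods of 0, and their intersection over n is the
    stabiliser of h s.\<close>
  define Q where "Q = (\<lambda>(s, n::nat). {y. 2 - 2 * Re (coefficient M (h s) (h s) y) \<le> 1 / (real n + 1)})"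
  define \<W> where "\<W> = Q ` (S \<times> UNIV)"
  have cont: "continuous_on UNIV (\<lambda>y. 2 - 2 * Re (coefficient M (h s) (h s) y))" if "s \<in> S" for s
    using coefficient_continuous[OF h(1)[OF that] h(1)[OF that]] by (intro continuous_intros)
  \<comment> \<open>Otherwise the finite intersections of these sets, fewer than \<mu> in number,
    would form a neighbourhood basis.\<close>
  have "\<not> K \<inter> \<Inter>\<W> \<subseteq> {0}"
  proof
    assume Int: "K \<inter> \<Inter>\<W> \<subseteq> {0}"
    have cl: "closed X" if X: "X \<in> \<W>" for X
    proof -
      obtain s n where "s \<in> S" "X = Q (s, n)" using X by (auto simp: \<W>_def)
      then show ?thesis using cont[of s] by (auto simp: Q_def intro!: closed_Collect_le continuous_intros)
    qed
    have nh: "\<forall>\<^sub>F y in nhds 0. y \<in> X" if X: "X \<in> \<W>" for X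
    proof -
      obtain s n where s: "s \<in> S" "X = Q (s, n)" using X by (auto simp: \<W>_def)
      have "open {y. 2 - 2 * Re (coefficient M (h s) (h s) y) < 1 / (real n + 1)}"
        using cont[OF s(1)] by (intro open_Collect_less) (auto intro!: continuous_intros)
      moreover have "coefficient M (h s) (h s) 0 = 1"
        using h[OF s(1)] by (simp add: coefficient_def left_regular_zero l2_self)
      ultimately show ?thesis
        unfolding eventually_nhds s(2) Q_def
        by (intro exI[of _ "{y. 2 - 2 * Re (coefficient M (h s) (h s) y) < 1 / (real n + 1)}"]) auto
    qed
    have "nhds_basis 0 ((\<lambda>F. K \<inter> \<Inter>F) ` Fpow \<W>)"
      by (rule nhds_basis_finite_intersections[OF K K0 cl nh Int])
    then have "\<mu> \<le>o |(\<lambda>F. K \<inter> \<Inter>F) ` Fpow \<W>|" using \<mu>(1) by (simp add: min_nhds_basis_card_def)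
    also have "|(\<lambda>F. K \<inter> \<Inter>F) ` Fpow \<W>| \<le>o |Fpow \<W>|" by (rule card_of_image)
    also have "|Fpow \<W>| <o \<mu>"
    proof (rule card_of_Fpow_less[OF _ \<mu>(2)])
      have "|\<W>| \<le>o |S \<times> (UNIV :: nat set)|" unfolding \<W>_def by (rule card_of_image)
      then show "|\<W>| <o \<mu>" using card_of_Times_nat_less[OF S \<mu>(2)] ordLeq_ordLess_trans by blast
    qed
    finally have "\<mu> <o \<mu>" .
    then show False using ordLess_irreflexive by blast
  qed
  then obtain x where x: "x \<in> K" "x \<in> \<Inter>\<W>" "x \<noteq> 0" by blast
  have "l2.eqv M (left_regular x (h s)) (h s)" if s: "s \<in> S" for s
  proof -
    let ?q = "2 - 2 * Re (coefficient M (h s) (h s) x)"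
    have le: "?q \<le> 1 / (real n + 1)" for n
      using x(2) s unfolding \<W>_def Q_def by force
    have "?q \<le> 0"
    proof (rule ccontr)
      assume "\<not> ?q \<le> 0"
      then obtain n where "inverse (real (Suc n)) < ?q" using reals_Archimedean[of ?q] by auto
      then show False using le[of n] by (simp add: inverse_eq_divide add.commute)
    qed
    then have "(l2_norm M (left_regular x (h s) - h s))\<^sup>2 \<le> 0" using state_norm_diff[OF h[OF s]] by simp
    then show ?thesis by (simp add: l2.eqv_def)
  qed
  then show ?thesis using x V unfolding K_def by blast
qed

text \<open>As 0 and x are separated by open sets, V and x + V are disjoint and inside X for a small
  V around 0. The difference of their indicators has squared norm 2 M(V), which explains the factor
  a.\<close>

lemma difference_vector:
  assumes X: "open X" "0 \<in> X" "x \<in> X" "x \<noteq> 0" and C: "compact C" "X \<subseteq> C"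
  shows "\<exists>p\<in>l2 M. l2_norm M (p - left_regular x p) = 1 \<and> (\<forall>t. (p - left_regular x p) t \<noteq> 0 \<longrightarrow> t \<in> X)"
proof -
  obtain A B where AB: "open A" "open B" "0 \<in> A" "x \<in> B" "A \<inter> B = {}"
    using separation_t2[of 0 x] X(4) by auto
  define V where "V = X \<inter> A \<inter> (\<lambda>y. x + y) -` (X \<inter> B)"
  have V: "open V" unfolding V_def
    by (intro open_Int open_vimage X AB continuous_intros)
  have V0: "0 \<in> V" using X AB by (simp add: V_def)
  have VO: "V \<subseteq> X" "(\<lambda>y. x + y) ` V \<subseteq> X" "V \<inter> (\<lambda>y. x + y) ` V = {}"
    using AB(5) by (auto simp: V_def)
  have Vf: "V \<in> fmeasurable M"
    by (rule fmeasurableI2[OF fmeasurable_compact[OF C(1)]]) (use VO C V in auto)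
  have "emeasure M V > 0" by (rule open_positive[OF V]) (use V0 in auto)
  then have m: "measure M V > 0" by (simp add: emeasure_eq_measure2[OF Vf] ennreal_less_zero_iff)
  define a where "a = 1 / sqrt (2 * measure M V)"
  define p where "p = fscale (of_real a) (indicator V)"
  have p: "p \<in> l2 M" unfolding p_def by (intro l2_fscale indicator_l2 Vf)
  have d: "p - left_regular x p = fscale (of_real a) (indicator V - indicator ((\<lambda>y. x + y) ` V))"
    unfolding p_def left_regular_fscale left_regular_indicator by (simp add: fs.scale_right_diff_distrib)
  note xVf = translate_fmeasurable[OF Vf, of x]
  have "(l2_norm M (indicator V - indicator ((\<lambda>y. x + y) ` V)))\<^sup>2 = measure M (V \<union> (\<lambda>y. x + y) ` V)"
    unfolding indicator_diff_norm[OF Vf xVf] using VO(3) by (intro arg_cong[where f = "measure M"]) blast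
  also have "\<dots> = measure M V + measure M ((\<lambda>y. x + y) ` V)"
    using measure_Un3[OF Vf xVf] VO(3) by simp
  also have "\<dots> = 2 * measure M V" by (simp add: measure_translate[OF Vf])
  finally have n: "l2_norm M (indicator V - indicator ((\<lambda>y. x + y) ` V)) = sqrt (2 * measure M V)"
    by (metis l2_norm_nonneg real_sqrt_abs abs_of_nonneg)
  have "l2_norm M (p - left_regular x p) = \<bar>a\<bar> * sqrt (2 * measure M V)"
    unfolding d n[symmetric] by (subst l2.nrm_scale) (auto intro!: l2.H_closed indicator_l2 Vf xVf)
  also have "\<dots> = 1" using m by (simp add: a_def)
  finally have "l2_norm M (p - left_regular x p) = 1" .
  moreover have "t \<in> X" if "(p - left_regular x p) t \<noteq> 0" for t
  proof -
    have "indicator V t - indicator ((\<lambda>y. x + y) ` V) t \<noteq> (0::complex)" using that unfolding d by auto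
    then have "t \<in> V \<or> t \<in> (\<lambda>y. x + y) ` V" by (auto simp: indicator_def split: if_splits)
    then show ?thesis using VO by blast
  qed
  ultimately show ?thesis using p by blast
qed

text \<open>Recursion along the cardinal order of \<B>. At each index the earlier vectors are fewer
  than \<mu>, so some x \<noteq> 0 close to 0 fixes them all, and \<open>difference_vector\<close>
  makes the next vector from x. As any two indices are comparable, all pairs become
  orthogonal.\<close>

lemma orthogonal_family:
  fixes \<mu> :: "'c rel"
  assumes \<mu>: "min_nhds_basis_card (0::'a) \<mu>" "natLeq <o \<mu>"
    and B: "nhds_basis (0::'a) \<B>" "|\<B>| =o \<mu>"
  shows "\<exists>h C. compact C \<and> (\<forall>U\<in>\<B>. h U \<in> l2 M \<and> l2_norm M (h U) = 1 \<and> (\<forall>t. h U t \<noteq> 0 \<longrightarrow> t \<in> U \<inter> C)) \<and>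
    (\<forall>U\<in>\<B>. \<forall>V\<in>\<B>. U \<noteq> V \<longrightarrow> orthogonal_states M (coefficient M (h U) (h U)) (coefficient M (h V) (h V)))"
proof -
  obtain W C :: "'a set" where W: "open W" "0 \<in> W" "W \<subseteq> C" "compact C" using compact_neighbourhood by blast
  let ?r = "|\<B>|"
  have wo: "Well_order ?r" by (rule card_of_Well_order)
  have field: "Field ?r = \<B>" by (rule Field_card_of)
  have wf: "wf (?r - Id)" using wo by (simp add: well_order_on_def)
  define good where "good U k \<longleftrightarrow> k \<in> l2 M \<and> l2_norm M k = 1 \<and> (\<forall>t. k t \<noteq> 0 \<longrightarrow> t \<in> U \<inter> C)" for U k
  \<comment> \<open>P consults h only at predecessors of U, as choice along a well-founded relation
    requires, and is vacuous outside \<B>, so that a value exists for every set U.\<close>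
  define P where "P h U k \<longleftrightarrow> (U \<in> \<B> \<longrightarrow> good U k \<and>
    (\<exists>x p. p \<in> l2 M \<and> k = p - left_regular x p \<and> (\<forall>U'\<in>underS ?r U. l2.eqv M (left_regular x (h U')) (h U'))))" for h U k
  have "\<exists>h. \<forall>U. P h U (h U)"
  proof (rule dependent_wf_choice[OF wf])
    fix h h' :: "'a set \<Rightarrow> 'a \<Rightarrow> complex" and U k
    assume eq: "\<And>V. (V, U) \<in> ?r - Id \<Longrightarrow> h V = h' V"
    have "\<forall>V\<in>underS ?r U. h V = h' V" using eq by (auto simp: underS_def)
    then show "P h U k = P h' U k" unfolding P_def by simp
  next
    fix U and h :: "'a set \<Rightarrow> 'a \<Rightarrow> complex"
    assume IH: "\<And>V. (V, U) \<in> ?r - Id \<Longrightarrow> P h V (h V)"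
    show "\<exists>k. P h U k"
    proof (cases "U \<in> \<B>")
      case True
      have hV: "good V (h V)" if "V \<in> underS ?r U" for V
      proof -
        have "(V, U) \<in> ?r - Id" using that by (auto simp: underS_def)
        moreover from this have "V \<in> \<B>" using field by (auto simp: Field_def)
        ultimately show ?thesis using IH[of V] by (simp add: P_def)
      qed
      \<comment> \<open>The order is a cardinal, so its proper initial segments are strictly
        smaller.\<close>
      have "|underS ?r U| <o ?r" by (rule card_of_underS[OF card_of_Card_order]) (use True field in simp)
      then have S: "|underS ?r U| <o \<mu>" using B(2) ordLess_ordIso_trans by blast
      have "\<forall>\<^sub>F y in nhds 0. y \<in> U" using B(1) True by (simp add: nhds_basis_def)
      then obtain X' where X': "open X'" "0 \<in> X'" "X' \<subseteq> U" unfolding eventually_nhds by blast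
      \<comment> \<open>Intersecting with W also places the support inside the fixed compact C,
        which Godement's theorem will call for.\<close>
      define X where "X = X' \<inter> W"
      have X: "open X" "0 \<in> X" "X \<subseteq> U \<inter> C" using X' W by (auto simp: X_def)
      obtain x where x: "x \<in> X" "x \<noteq> 0" "\<forall>V\<in>underS ?r U. l2.eqv M (left_regular x (h V)) (h V)"
        using nontrivial_stabiliser[OF \<mu> S _ _ X(1,2), of h] hV by (auto simp: good_def)
      obtain p where "p \<in> l2 M" "l2_norm M (p - left_regular x p) = 1"
        "\<forall>t. (p - left_regular x p) t \<noteq> 0 \<longrightarrow> t \<in> X"
        using difference_vector[OF X(1,2) x(1,2) W(4)] X(3) by auto
      then have "P h U (p - left_regular x p)"
        unfolding P_def good_def using x(3) X(3) left_regular_l2 l2.H_closed(3) by blast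
      then show ?thesis by blast
    qed (simp add: P_def)
  qed
  then obtain h where h: "\<And>U. P h U (h U)" by blast
  have g: "h U \<in> l2 M" "l2_norm M (h U) = 1" "h U t \<noteq> 0 \<Longrightarrow> t \<in> U \<inter> C" if "U \<in> \<B>" for U t
    using h[of U] that by (auto simp: P_def good_def)
  have orth: "orthogonal_states M (coefficient M (h U) (h U)) (coefficient M (h V) (h V)) \<and>
      orthogonal_states M (coefficient M (h V) (h V)) (coefficient M (h U) (h U))"
    if UV: "U \<in> \<B>" "V \<in> \<B>" "(U, V) \<in> ?r" "U \<noteq> V" for U V
  proof -
    have "U \<in> underS ?r V" using UV by (auto simp: underS_def)
    then obtain x p where "p \<in> l2 M" "h V = p - left_regular x p" "l2.eqv M (left_regular x (h U)) (h U)"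
      using h[of V] UV(2) unfolding P_def by blast
    then show ?thesis
      using orthogonal_states_translate[OF g(1,2)[OF UV(1)] g(1,2)[OF UV(2)]] by blast
  qed
  have total: "(U, V) \<in> ?r \<or> (V, U) \<in> ?r" if "U \<in> \<B>" "V \<in> \<B>" "U \<noteq> V" for U V
    using wo that field unfolding well_order_on_def linear_order_on_def total_on_def by auto
  show ?thesis
    by (intro exI[of _ h] exI[of _ C] conjI ballI impI allI W(4) g; (use orth total in blast)?)
qed

end

theorem mainTheorem7:
  fixes M :: "'a::{topological_group_add, t2_space} measure"
    and \<mu> :: "'c rel"
  assumes "locally_compact_space (euclidean :: 'a topology)"
    and "left_haar_measure M"
    and "min_nhds_basis_card (0::'a) \<mu>"
    and "natLeq <o \<mu>"
  shows "\<exists>(I :: 'a set set) le u. TI_net M I le u \<and> orthogonal_net M I u \<and> |I| =o \<mu>"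
proof -
  interpret haar_group M by unfold_locales (use assms in auto)
  obtain \<B> where B: "nhds_basis (0::'a) \<B>" "|\<B>| =o \<mu>"
    using assms(3) by (auto simp: min_nhds_basis_card_def)
  obtain h C where C: "compact C"
    and "\<forall>U\<in>\<B>. h U \<in> l2 M \<and> l2_norm M (h U) = 1 \<and> (\<forall>t. h U t \<noteq> 0 \<longrightarrow> t \<in> U \<inter> C)"
    and orth: "\<forall>U\<in>\<B>. \<forall>V\<in>\<B>. U \<noteq> V \<longrightarrow>
      orthogonal_states M (coefficient M (h U) (h U)) (coefficient M (h V) (h V))"
  proof -
    from orthogonal_family[OF assms(3,4) B] show ?thesis by (elim exE conjE) (rule that)
  qed
  then have h: "h U \<in> l2 M" "l2_norm M (h U) = 1" "h U t \<noteq> 0 \<Longrightarrow> t \<in> U \<inter> C" if "U \<in> \<B>" for U t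
    using that by blast+
  define u where "u U = coefficient M (h U) (h U)" for U
  \<comment> \<open>Convergence is along reverse inclusion. The well-order behind
    \<open>orth\<close> is a different one, but orthogonality of all pairs does not refer to
    it.\<close>
  define le :: "'a set \<Rightarrow> 'a set \<Rightarrow> bool" where "le U V \<longleftrightarrow> V \<subseteq> U" for U V
  have basis: "\<exists>U\<in>\<B>. U \<subseteq> V" if "\<forall>\<^sub>F y in nhds 0. y \<in> V" for V
    using B(1) that unfolding nhds_basis_def by blast
  have nh: "\<forall>\<^sub>F y in nhds 0. y \<in> U" if "U \<in> \<B>" for U
    using B(1) that unfolding nhds_basis_def by blast
  have "directed_set \<B> le"
    unfolding directed_set_def
  proof (intro conjI ballI)
    show "\<B> \<noteq> {}" using basis[of UNIV] by auto
    show "reflp_on \<B> le" "transp_on \<B> le" by (auto simp: le_def reflp_on_def transp_on_def)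
    show "\<exists>W\<in>\<B>. le U W \<and> le V W" if "U \<in> \<B>" "V \<in> \<B>" for U V
      using basis[of "U \<inter> V"] eventually_conj[OF nh[OF that(1)] nh[OF that(2)]] by (auto simp: le_def)
  qed
  moreover have "u U \<in> normal_states M" if "U \<in> \<B>" for U
    unfolding u_def by (rule coefficient_normal_state[OF h(1,2)[OF that]])
  moreover have "((\<lambda>U. fourier_norm M (\<lambda>x. v x * u U x - u U x)) \<longlongrightarrow> 0) (net_filter \<B> le)"
    if v: "v \<in> normal_states M" for v
  proof (rule tendstoI)
    fix e :: real assume e: "e > 0"
    \<comment> \<open>The state v is given by two vectors, which are kept distinct; v 0 = 1 becomes
      <f, g> = 1.\<close>
    obtain f g where f: "f \<in> l2 M" and g: "g \<in> l2 M" and vfg: "v = coefficient M f g"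
      using v by (auto simp: normal_states_def fourier_algebra_def)
    have fg: "l2_inner M f g = 1"
      using v by (simp add: normal_states_def vfg coefficient_def left_regular_zero)
    let ?N = "l2_norm M f + l2_norm M g"
    have N: "0 \<le> ?N" using l2_norm_nonneg[of M f] l2_norm_nonneg[of M g] by linarith
    \<comment> \<open>The final estimate is 2 N d; the added 1 makes it strictly less than
      e.\<close>
    define d where "d = e / (2 * ?N + 1)"
    have d: "d > 0" using e N by (simp add: d_def)
    have Nd: "2 * ?N * d < e"
    proof -
      have "2 * ?N * d < (2 * ?N + 1) * d" using d by (simp add: algebra_simps)
      also have "\<dots> = e" using N by (simp add: d_def)
      finally show ?thesis .
    qed
    \<comment> \<open>\<open>product_state_fourier_norm\<close> compares f and g with their
      translates by - t, so strong continuity at 0 is composed with inversion.\<close>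
    have um: "filterlim uminus (nhds (0::'a)) (nhds 0)" using tendsto_uminus_nhds[of "0::'a"] by simp
    have "\<forall>\<^sub>F t in nhds 0. t \<in> {t. l2_norm M (left_regular (- t) f - f) < d \<and> l2_norm M (left_regular (- t) g - g) < d}"
      using eventually_conj[OF um[unfolded filterlim_iff, rule_format, OF left_regular_continuous[OF f d]]
          um[unfolded filterlim_iff, rule_format, OF left_regular_continuous[OF g d]]] by simp
    from basis[OF this] obtain U0 where U0: "U0 \<in> \<B>"
      "U0 \<subseteq> {t. l2_norm M (left_regular (- t) f - f) < d \<and> l2_norm M (left_regular (- t) g - g) < d}" by blast
    have "\<bar>fourier_norm M (\<lambda>x. v x * u U x - u U x)\<bar> < e" if U: "U \<in> \<B>" "U \<subseteq> U0" for U
    proof -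
      have "\<bar>fourier_norm M (\<lambda>x. v x * u U x - u U x)\<bar> \<le> 2 * ?N * d"
        unfolding vfg u_def
        by (rule product_state_fourier_norm[OF f g h(1)[OF U(1)] fg h(2)[OF U(1)] C _ d])
          (use h(3)[OF U(1)] U0(2) U(2) in force)+
      then show ?thesis using Nd by linarith
    qed
    then have "\<forall>\<^sub>F U in principal {U \<in> \<B>. le U0 U}. dist (fourier_norm M (\<lambda>x. v x * u U x - u U x)) 0 < e"
      by (simp add: eventually_principal le_def)
    moreover have "net_filter \<B> le \<le> principal {U \<in> \<B>. le U0 U}"
      unfolding net_filter_def by (rule INF_lower[OF U0(1)])
    ultimately show "\<forall>\<^sub>F U in net_filter \<B> le. dist (fourier_norm M (\<lambda>x. v x * u U x - u U x)) 0 < e"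
      using filter_leD by blast
  qed
  ultimately have "TI_net M \<B> le u" by (simp add: TI_net_def)
  moreover have "orthogonal_net M \<B> u" using orth by (simp add: orthogonal_net_def u_def)
  ultimately show ?thesis using B(2) by blast
qed

end
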